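(* Let $F:\mathbb{R}^n\rightrightarrows\mathbb{R}^m$ be a set-valued mapping with closed graph and let $(\bar x,\bar y)\in\operatorname{gph}F$. Then $$\mathrm{rg}[F](\bar x,\bar y)\le \mathrm{rad[SR]}_{Lip}F(\bar x\,|\,\bar y)\le \overline{\mathrm{rg}}[F](\bar x,\bar y),$$ $$\mathrm{rad[SR]}_{ss}F(\bar x\,|\,\bar y)=\mathrm{rad[SR]}_{C^1}F(\bar x\,|\,\bar y)=\mathrm{rg}^\circ[F](\bar x,\bar y).$$
   Context: Norms: $\mathbb{R}^n$ and $\mathbb{R}^m$ carry arbitrary norms, both written $\|\cdot\|$, with dual norms $\|\cdot\|_*$. Starred vectors are elements of the dual spaces, identified with column vectors. $L(\mathbb{R}^n,\mathbb{R}^m)$ is the set of $m\times n$ matrices, with the operator norm $\|B\|=\sup_{\|x\|\le 1}\|Bx\|$. Infima over the empty set are $+\infty$. Normal cones: For a set $A\subset\mathbb{R}^d$ and $z\in A$, $T_A(z)=\{w\mid \exists w_i\to w,\ t_i\searrow0,\ z+t_iw_i\in A\ \forall i\}$ and $N_A(z)=\{z^*\mid \langle z^*,w\rangle\le0\ \forall w\in T_A(z)\}$ (Fréchet normal cone); $N_A(z)=\emptyset$ if $z\notin A$. For $w\in\mathbb{R}^d$, the directional limiting normal cone is $\overline N_A(z;w)=\{z^*\mid\exists t_i\searrow0,\ w_i\to w,\ z_i^*\to z^*,\ z_i^*\in N_A(z+t_iw_i)\ \forall i\}$. Set-valued mappings: $\operatorname{gph}F=\{(x,y)\mid y\in F(x)\}$.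 The primal-dual derivative of $F$ at $(\bar x,\bar y)\in\operatorname{gph}F$ is, for $(u,v^* )\in\mathbb{R}^n\times(\mathbb{R}^m)^*$, $$\widehat DF(\bar x,\bar y)(u,v^* )=\{(u^*,v)\in(\mathbb{R}^n)^*\times\mathbb{R}^m\mid (u^*,-v^* )\in\overline N_{\operatorname{gph}F}((\bar x,\bar y);(u,v))\}.$$ Constants: $\mathrm{rg}[F](\bar x,\bar y)=\inf\{\max\{\|u^*\|_*,\|v\|\}\mid (u^*,v)\in\widehat DF(\bar x,\bar y)(u,v^* ),\ \|u\|=\|v^*\|_*=1\}$; $\overline{\mathrm{rg}}[F](\bar x,\bar y)=\inf\{\|u^*\|_*+\|v\|\mid (u^*,v)\in\widehat DF(\bar x,\bar y)(u,v^* ),\ \|u\|=\|v^*\|_*=1\}$; $\mathrm{rg}^\circ[F](\bar x,\bar y)=\inf\{\|B\|\mid B\in L(\mathbb{R}^n,\mathbb{R}^m),\ (B^Tv^*,Bu)\in\widehat DF(\bar x,\bar y)(u,v^* )\text{ for some }u,v^*\text{ with }\|u\|=\|v^*\|_*=1\}$. Metric subregularity: $G:\mathbb{R}^n\rightrightarrows\mathbb{R}^m$ is metrically subregular at $\bar x$ for $\bar y$ if $(\bar x,\bar y)\in\operatorname{gph}G$ and there are $\kappa\ge0$ and a neighborhood $U$ of $\bar x$ with $d(x,G^{-1}(\bar y))\le\kappa\, d(\bar y,G(x))$ for all $x\in U$, where $G^{-1}(y)=\{x\mid y\in G(x)\}$, $d(x,C)=\inf_{c\in C}\|x-c\|$ and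 $d(\cdot,\emptyset)=+\infty$. Radii: $\operatorname{lip}(h;\bar x)=\limsup_{x,x'\to\bar x,\,x\ne x'}\|h(x)-h(x')\|/\|x-x'\|$. Consider the classes of functions $h:\mathbb{R}^n\to\mathbb{R}^m$ with $h(\bar x)=0$: $\mathcal F_{Lip}$ (Lipschitz continuous around $\bar x$), $\mathcal F_{ss}$ (semismooth at $\bar x$), $\mathcal F_{C^1}$ ($C^1$ around $\bar x$). Here $h$ is semismooth at $\bar x$ if it is Lipschitz continuous around $\bar x$ and for every $u\in\mathbb{R}^n$ the limit of $Vu'$, over $V\in\partial_Ch(\bar x+tu')$, $u'\to u$, $t\searrow0$, exists; $\partial_Ch(x)$ is the Clarke generalized Jacobian (the convex hull of all limits of $\nabla h(x_k)$, $x_k\to x$, $h$ differentiable at $x_k$). For $\mathcal P\in\{Lip,ss,C^1\}$, $$\mathrm{rad[SR]}_{\mathcal P}F(\bar x\,|\,\bar y)=\inf_{h\in\mathcal F_{\mathcal P}}\{\operatorname{lip}(h;\bar x)\mid F+h\text{ is not metrically subregular at }\bar x\text{ for }\bar y\}.$$ *)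

theory Defs
  imports "HOL-Analysis.Analysis"
begin

text \<open>
  The arbitrary norms on \<open>\<real>\<^sup>n\<close> and \<open>\<real>\<^sup>m\<close> are explicit functions \<open>N\<close> and \<open>M\<close>; the standard norm
  of \<open>real ^ 'n\<close> is used only for convergence, neighbourhoods and local Lipschitz continuity, which do
  not depend on the choice of norm.
  Dual vectors are column vectors, paired by the standard inner product \<open>\<bullet>\<close>.
  An \<open>m \<times> n\<close> matrix has type \<open>real ^ 'n ^ 'm\<close>.
\<close>

definition is_norm :: "('a::real_vector \<Rightarrow> real) \<Rightarrow> bool" where
  "is_norm N \<longleftrightarrow>
     (\<forall>x. N x = 0 \<longleftrightarrow> x = 0) \<and>
     (\<forall>x y. N (x + y) \<le> N x + N y) \<and>
     (\<forall>c x. N (c *\<^sub>R x) = \<bar>c\<bar> * N x)"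

definition dual_norm :: "('a::real_inner \<Rightarrow> real) \<Rightarrow> 'a \<Rightarrow> real" where
  "dual_norm N x' = (SUP x\<in>{x. N x \<le> 1}. x' \<bullet> x)"

definition op_norm ::
  "(real ^ 'n \<Rightarrow> real) \<Rightarrow> (real ^ 'm \<Rightarrow> real) \<Rightarrow> real ^ 'n ^ 'm \<Rightarrow> real" where
  "op_norm N M B = (SUP x\<in>{x. N x \<le> 1}. M (B *v x))"


text \<open>
  \<open>t\<^sub>i \<searrow> 0\<close> is rendered as \<open>t\<^sub>i > 0\<close> and \<open>t\<^sub>i \<rightarrow> 0\<close>; a monotone \<open>t\<close> is obtained by passing to a subsequence.
\<close>

definition tangent_cone :: "'a::euclidean_space set \<Rightarrow> 'a \<Rightarrow> 'a set" where
  "tangent_cone A z =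
     {w. \<exists>ws t. ws \<longlonglongrightarrow> w \<and> (\<forall>i. (0::real) < t i) \<and> t \<longlonglongrightarrow> 0 \<and> (\<forall>i::nat. z + t i *\<^sub>R ws i \<in> A)}"

definition normal_cone :: "'a::euclidean_space set \<Rightarrow> 'a \<Rightarrow> 'a set" where
  "normal_cone A z = (if z \<in> A then {z'. \<forall>w\<in>tangent_cone A z. z' \<bullet> w \<le> 0} else {})"

definition dir_lim_normal_cone :: "'a::euclidean_space set \<Rightarrow> 'a \<Rightarrow> 'a \<Rightarrow> 'a set" where
  "dir_lim_normal_cone A z w =
     {z'. \<exists>t ws zs. (\<forall>i. (0::real) < t i) \<and> t \<longlonglongrightarrow> 0 \<and> ws \<longlonglongrightarrow> w \<and> zs \<longlonglongrightarrow> z' \<and>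
        (\<forall>i::nat. zs i \<in> normal_cone A (z + t i *\<^sub>R ws i))}"


definition gph :: "('a \<Rightarrow> 'b set) \<Rightarrow> ('a \<times> 'b) set" where
  "gph F = {(x, y). y \<in> F x}"

definition primal_dual_derivative ::
  "('a::euclidean_space \<Rightarrow> 'b::euclidean_space set) \<Rightarrow> 'a \<Rightarrow> 'b \<Rightarrow> 'a \<Rightarrow> 'b \<Rightarrow> ('a \<times> 'b) set" where
  "primal_dual_derivative F x y u v' =
     {(u', v). (u', - v') \<in> dir_lim_normal_cone (gph F) (x, y) (u, v)}"

definition rg ::
  "('a::euclidean_space \<Rightarrow> real) \<Rightarrow> ('b::euclidean_space \<Rightarrow> real) \<Rightarrow> ('a \<Rightarrow> 'b set) \<Rightarrow> 'a \<Rightarrow> 'b \<Rightarrow> ereal" where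
  "rg N M F x y =
     Inf {ereal (max (dual_norm N u') (M v)) | u' v u v'.
       (u', v) \<in> primal_dual_derivative F x y u v' \<and> N u = 1 \<and> dual_norm M v' = 1}"

definition rg_bar ::
  "('a::euclidean_space \<Rightarrow> real) \<Rightarrow> ('b::euclidean_space \<Rightarrow> real) \<Rightarrow> ('a \<Rightarrow> 'b set) \<Rightarrow> 'a \<Rightarrow> 'b \<Rightarrow> ereal" where
  "rg_bar N M F x y =
     Inf {ereal (dual_norm N u' + M v) | u' v u v'.
       (u', v) \<in> primal_dual_derivative F x y u v' \<and> N u = 1 \<and> dual_norm M v' = 1}"

definition rg_circ ::
  "(real ^ 'n \<Rightarrow> real) \<Rightarrow> (real ^ 'm \<Rightarrow> real) \<Rightarrow> (real ^ 'n \<Rightarrow> (real ^ 'm) set)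
     \<Rightarrow> real ^ 'n \<Rightarrow> real ^ 'm \<Rightarrow> ereal" where
  "rg_circ N M F x y =
     Inf {ereal (op_norm N M B) | B :: real ^ 'n ^ 'm. \<exists>u v'.
       (transpose B *v v', B *v u) \<in> primal_dual_derivative F x y u v' \<and>
       N u = 1 \<and> dual_norm M v' = 1}"


text \<open>The value is \<open>\<infinity>\<close> if \<open>C = {}\<close>.\<close>

definition norm_dist :: "('a::real_vector \<Rightarrow> real) \<Rightarrow> 'a \<Rightarrow> 'a set \<Rightarrow> ereal" where
  "norm_dist N x C = (INF c\<in>C. ereal (N (x - c)))"

text \<open>
  Here \<open>0 * \<infinity> = 0\<close> in \<open>ereal\<close>. The convention for this product is immaterial: under either one,
  if \<open>\<kappa> = 0\<close> is admissible then so is \<open>\<kappa> = 1\<close>.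
\<close>

definition metrically_subregular ::
  "('a::euclidean_space \<Rightarrow> real) \<Rightarrow> ('b::euclidean_space \<Rightarrow> real) \<Rightarrow> ('a \<Rightarrow> 'b set) \<Rightarrow> 'a \<Rightarrow> 'b \<Rightarrow> bool" where
  "metrically_subregular N M G x0 y0 \<longleftrightarrow>
     (x0, y0) \<in> gph G \<and>
     (\<exists>\<kappa>::real. 0 \<le> \<kappa> \<and> (\<exists>U. open U \<and> x0 \<in> U \<and>
        (\<forall>x\<in>U. norm_dist N x {x. y0 \<in> G x} \<le> ereal \<kappa> * norm_dist M y0 (G x))))"

definition lip ::
  "('a::euclidean_space \<Rightarrow> real) \<Rightarrow> ('b::euclidean_space \<Rightarrow> real) \<Rightarrow> ('a \<Rightarrow> 'b) \<Rightarrow> 'a \<Rightarrow> ereal" where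
  "lip N M h x0 =
     Limsup (at (x0, x0) within {(x, x'). x \<noteq> x'}) (\<lambda>(x, x'). ereal (M (h x - h x') / N (x - x')))"

definition lipschitz_around :: "('a::metric_space \<Rightarrow> 'b::metric_space) \<Rightarrow> 'a \<Rightarrow> bool" where
  "lipschitz_around h x0 \<longleftrightarrow> (\<exists>L U. open U \<and> x0 \<in> U \<and> L-lipschitz_on U h)"

definition clarke_jacobian :: "(real ^ 'n \<Rightarrow> real ^ 'm) \<Rightarrow> real ^ 'n \<Rightarrow> (real ^ 'n ^ 'm) set" where
  "clarke_jacobian h x =
     convex hull {V. \<exists>xs::nat \<Rightarrow> real ^ 'n. xs \<longlonglongrightarrow> x \<and> (\<forall>k. h differentiable (at (xs k))) \<and>
       (\<lambda>k. jacobian h (at (xs k))) \<longlonglongrightarrow> V}"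

definition semismooth :: "(real ^ 'n \<Rightarrow> real ^ 'm) \<Rightarrow> real ^ 'n \<Rightarrow> bool" where
  "semismooth h x0 \<longleftrightarrow>
     lipschitz_around h x0 \<and>
     (\<forall>u. \<exists>l. \<forall>\<epsilon>>0. \<forall>\<^sub>F (u', t) in nhds u \<times>\<^sub>F at_right (0::real).
        \<forall>V\<in>clarke_jacobian h (x0 + t *\<^sub>R u'). dist (V *v u') l < \<epsilon>)"

definition C1_around :: "(real ^ 'n \<Rightarrow> real ^ 'm) \<Rightarrow> real ^ 'n \<Rightarrow> bool" where
  "C1_around h x0 \<longleftrightarrow>
     (\<exists>U. open U \<and> x0 \<in> U \<and> (\<forall>x\<in>U. h differentiable (at x)) \<and>
        continuous_on U (\<lambda>x. jacobian h (at x)))"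

definition F_Lip :: "real ^ 'n \<Rightarrow> (real ^ 'n \<Rightarrow> real ^ 'm) set" where
  "F_Lip x0 = {h. h x0 = 0 \<and> lipschitz_around h x0}"

definition F_ss :: "real ^ 'n \<Rightarrow> (real ^ 'n \<Rightarrow> real ^ 'm) set" where
  "F_ss x0 = {h. h x0 = 0 \<and> semismooth h x0}"

definition F_C1 :: "real ^ 'n \<Rightarrow> (real ^ 'n \<Rightarrow> real ^ 'm) set" where
  "F_C1 x0 = {h. h x0 = 0 \<and> C1_around h x0}"

text \<open>The first argument \<open>P\<close> is the class of admissible perturbations.\<close>

definition rad_SR ::
  "(real ^ 'n \<Rightarrow> real ^ 'm) set \<Rightarrow> (real ^ 'n \<Rightarrow> real) \<Rightarrow> (real ^ 'm \<Rightarrow> real)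
     \<Rightarrow> (real ^ 'n \<Rightarrow> (real ^ 'm) set) \<Rightarrow> real ^ 'n \<Rightarrow> real ^ 'm \<Rightarrow> ereal" where
  "rad_SR P N M F x0 y0 =
     Inf {lip N M h x0 | h. h \<in> P \<and> \<not> metrically_subregular N M (\<lambda>x. (\<lambda>y. y + h x) ` F x) x0 y0}"

end

theory Submission
  imports Defs
begin

text \<open>
  A set-valued map is compared with its perturbations \<open>F + h\<close>, and the four relations come from two
  implications: failure of subregularity of \<open>F + h\<close> produces elements of the primal-dual derivative
  whose size is controlled by \<open>h\<close>, and every element of the primal-dual derivative produces a
  perturbation that destroys subregularity. Limits and minimisation use Euclidean norms, to
  which the given norms \<open>N\<close> and \<open>M\<close> are equivalent; the given norms enter in the final bounds.

  Lower bounds. If \<open>F + h\<close> is not subregular at \<open>x0\<close> for \<open>y0\<close>, there are points \<open>x1\<close> close to \<open>x0\<close> whose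
  residual is much smaller than their distance to the solution set. The residual
  \<open>norm (y + h p - y0)\<close>, with a small multiple of \<open>norm (p - x1)\<close> and a large multiple of
  \<open>(norm (x - p))\<^sup>2\<close> added, is minimised over \<open>(x, y) \<in> gph F\<close> and \<open>p\<close>. The auxiliary point \<open>p\<close> separates
  the graph from the nonsmooth \<open>h\<close>: the function is smooth in \<open>(x, y)\<close> at the minimiser, so that its
  negative gradient there gives an exact normal vector \<open>(u', - v')\<close> to the graph, while optimality in \<open>p\<close> says that
  \<open>- u'\<close> is up to a small error majorised by the difference quotients of \<open>v' \<bullet> h\<close> at \<open>p\<close>
  (\<open>nonsubregular_approximation\<close>). Passing to the limit gives \<open>(u', v)\<close> in the derivative at \<open>(u, v')\<close>,
  where \<open>- v\<close> is the limit of the difference quotients of \<open>h\<close> in the direction \<open>u\<close>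
  (\<open>nonsubregular_limit\<close>). If \<open>h\<close> has Lipschitz modulus below \<open>K\<close> near \<open>x0\<close>, both \<open>u'\<close> (after scaling
  \<open>v'\<close> to dual norm one) and \<open>v\<close> are bounded by \<open>K\<close>, which is the bound by \<open>rg\<close>.

  For semismooth \<open>h\<close> the two bounds have to come from one matrix. The majorisation of \<open>- u'\<close> by
  difference quotients has to be turned into a statement about elements of the Clarke Jacobian, and
  for this Lipschitz functions need enough points of differentiability: Rademacher's theorem is
  proved, and with it the mean value inequality \<open>lipschitz_increment_le\<close>, in which only the points of
  differentiability count. Separation of convex sets then yields \<open>V\<close> in the Clarke Jacobian at \<open>p\<close>
  with \<open>transpose V *v v' + u'\<close> small (\<open>clarke_jacobian_adjoint\<close>). Semismoothness says that \<open>V *v u\<close>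
  tends to the same limit as the difference quotients of \<open>h\<close>, that is to \<open>- v\<close>
  (\<open>semismooth_directional_limit\<close>). A limit of the matrices \<open>- V\<close> is then admissible for \<open>rg_circ\<close>.

  Upper bounds. An element of the primal-dual derivative provides graph points
  \<open>(x0 + t a, y0 + t b)\<close> with small \<open>t\<close> and Frechet normals close to \<open>(u', - v')\<close>. The Frechet inequality
  says that, on a small ball around \<open>x0 + t a\<close>, the graph misses an affine piece with slope \<open>B\<close> whenever
  \<open>B\<close> has adjoint sending \<open>v'\<close> to \<open>u'\<close>, even though this piece comes close to the graph point
  (\<open>normal_probe\<close>). Hence, if \<open>y0 - h\<close> is that affine piece on a sequence of such balls, then \<open>F + h\<close> is not
  subregular (\<open>perturbation_not_subregular\<close>). For \<open>B\<close> with \<open>B *v u = v\<close> the linear map \<open>- B\<close> is already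
  correct up to terms that are small compared with \<open>t\<close>, and smooth bumps with summable gradients
  repair it: this gives a \<open>C\<^sup>1\<close> perturbation of modulus at most the norm of \<open>B\<close>. In general, one
  takes \<open>B x = (u' \<bullet> x) e\<close> with \<open>v' \<bullet> e = 1\<close> and glues disjoint Lipschitz bumps; reaching the value
  \<open>- t b\<close> costs the slope \<open>M v\<close> and following \<open>- B\<close> on the plateau costs the dual norm of \<open>u'\<close>.
\<close>

section \<open>Difference quotients of Lipschitz functions on the line\<close>

text \<open>
  The intervals with small slope form a Vitali family for \<open>S\<close>. A disjoint subfamily covers \<open>S\<close> up to a
  null set; its image has at most \<open>p\<close> times its length, and the remaining null set has a null image
  because \<open>g\<close> is Lipschitz. Both the given and the new covering set are open, so that the estimate can be
  iterated.
\<close>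

lemma lipschitz_slope_image_cover:
  fixes g :: "real \<Rightarrow> real"
  assumes lip: "L-lipschitz_on UNIV g" and mono: "strict_mono g" and p: "0 \<le> p"
    and small: "\<And>x d. \<lbrakk>x \<in> S; 0 < d\<rbrakk> \<Longrightarrow> \<exists>a b. a < b \<and> x \<in> {a..b} \<and> b - a < d \<and> g b - g a \<le> p * (b - a)"
    and U: "open U" "S \<subseteq> U" "emeasure lborel U \<le> ennreal c" and c: "0 \<le> c" and \<delta>: "0 < \<delta>"
  shows "\<exists>V. open V \<and> g ` S \<subseteq> V \<and> emeasure lborel V \<le> ennreal (p * c + \<delta>)"
proof -
  define K where "K = {(m, r). 0 < r \<and> cball m r \<subseteq> U \<and> g (m + r) - g (m - r) \<le> p * (2 * r)}"
  have cov: "\<exists>i. i \<in> K \<and> x \<in> cball (fst i) (snd i) \<and> snd i < d" if x: "x \<in> S" and d: "0 < d" for x d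
  proof -
    obtain e where e: "0 < e" "ball x e \<subseteq> U" using U x by (meson openE subsetD)
    obtain a b where ab: "a < b" "x \<in> {a..b}" "b - a < min d e" "g b - g a \<le> p * (b - a)"
      using small[OF x, of "min d e"] d e by auto
    have "cball ((a+b)/2) ((b-a)/2) = {a..b}"
      by (auto simp: cball_def dist_real_def abs_if field_simps split: if_splits)
    moreover have "{a..b} \<subseteq> ball x e" using ab by (auto simp: dist_real_def)
    ultimately have "((a+b)/2, (b-a)/2) \<in> K"
      using ab e unfolding K_def by (auto simp: field_simps)
    then show ?thesis using ab \<open>cball ((a+b)/2) ((b-a)/2) = {a..b}\<close>
      by (intro exI[of _ "((a+b)/2, (b-a)/2)"]) auto
  qed
  have rpos: "0 < snd i" if "i \<in> K" for i using that by (auto simp: K_def)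
  obtain C where C: "countable C" "C \<subseteq> K"
    "pairwise (\<lambda>i j. disjnt (cball (fst i) (snd i)) (cball (fst j) (snd j))) C"
    "negligible (S - (\<Union>i \<in> C. cball (fst i) (snd i)))"
    by (rule Vitali_covering_theorem_cballs[of K snd S fst, OF rpos cov]) blast+
  have incr: "g x \<le> g y \<longleftrightarrow> x \<le> y" for x y using mono by (simp add: strict_mono_less_eq)
  define J where "J i = {g (fst i - snd i)..g (fst i + snd i)}" for i :: "real \<times> real"
  have Jsub: "g ` cball (fst i) (snd i) \<subseteq> J i" for i
    by (auto simp: J_def dist_real_def incr)
  have contg: "continuous_on A g" for A
    using lip lipschitz_on_continuous_on lipschitz_on_subset by blast
  have Jeq: "J i \<subseteq> g ` cball (fst i) (snd i)" if "i \<in> C" for i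
  proof
    fix y assume y: "y \<in> J i"
    have "fst i - snd i \<le> fst i + snd i" using that C K_def by auto
    with y obtain x where "fst i - snd i \<le> x" "x \<le> fst i + snd i" "g x = y"
      using IVT'[of g "fst i - snd i" y "fst i + snd i"] contg unfolding J_def by auto
    then show "y \<in> g ` cball (fst i) (snd i)" by (intro image_eqI[of _ _ x]) (auto simp: dist_real_def)
  qed
  have disj: "disjoint_family_on (\<lambda>i. cball (fst i) (snd i)) C"
    using C(3) unfolding disjoint_family_on_def pairwise_def disjnt_def by auto
  have injg: "inj g" using mono by (simp add: strict_mono_imp_inj_on)
  have disjJ: "disjoint_family_on J C"
    unfolding disjoint_family_on_def
  proof (intro ballI impI)
    fix i j assume ij: "i \<in> C" "j \<in> C" "i \<noteq> j"
    have "J i \<inter> J j \<subseteq> g ` (cball (fst i) (snd i) \<inter> cball (fst j) (snd j))"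
      using Jeq[OF ij(1)] Jeq[OF ij(2)] injg by (auto simp: image_Int)
    then show "J i \<inter> J j = {}" using disj ij unfolding disjoint_family_on_def by auto
  qed
  have "emeasure lborel (\<Union>i\<in>C. J i) = (\<integral>\<^sup>+i. emeasure lborel (J i) \<partial>count_space C)"
    by (rule emeasure_UN_countable[OF _ C(1) disjJ]) (simp add: J_def)
  also have "\<dots> \<le> (\<integral>\<^sup>+i. ennreal p * emeasure lborel (cball (fst i) (snd i)) \<partial>count_space C)"
  proof (rule nn_integral_mono)
    fix i assume "i \<in> space (count_space C)"
    then have i: "i \<in> K" using C by auto
    obtain m r where ir: "i = (m, r)" by (cases i)
    have cb: "cball m r = {m - r..m + r}" by (auto simp: dist_real_def)
    have r: "0 < r" "g (m + r) - g (m - r) \<le> p * (2 * r)" using i ir by (auto simp: K_def)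
    have "emeasure lborel (J i) = ennreal (g (m + r) - g (m - r))"
      using r incr[of "m - r" "m + r"] by (simp add: J_def ir)
    also have "\<dots> \<le> ennreal (p * (2 * r))" using r by (intro ennreal_leI)
    also have "\<dots> = ennreal p * emeasure lborel (cball m r)"
      using r p by (simp add: cb ennreal_mult)
    finally show "emeasure lborel (J i) \<le> ennreal p * emeasure lborel (cball (fst i) (snd i))" by (simp add: ir)
  qed
  also have "\<dots> = ennreal p * (\<integral>\<^sup>+i. emeasure lborel (cball (fst i) (snd i)) \<partial>count_space C)"
    by (rule nn_integral_cmult) simp
  also have "(\<integral>\<^sup>+i. emeasure lborel (cball (fst i) (snd i)) \<partial>count_space C)
      = emeasure lborel (\<Union>i\<in>C. cball (fst i) (snd i))"
    by (rule emeasure_UN_countable[OF _ C(1) disj, symmetric]) simp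
  also have "emeasure lborel (\<Union>i\<in>C. cball (fst i) (snd i)) \<le> emeasure lborel U"
  proof (rule emeasure_mono)
    show "(\<Union>i\<in>C. cball (fst i) (snd i)) \<subseteq> U" using C(2) by (force simp: K_def)
  qed (use U in simp)
  also have "\<dots> \<le> ennreal c" by fact
  finally have m1: "emeasure lborel (\<Union>i\<in>C. J i) \<le> ennreal (p * c)"
    using p c by (simp add: ennreal_mult mult_left_mono)
  have neg: "negligible (g ` (S - (\<Union>i \<in> C. cball (fst i) (snd i))))"
  proof (rule negligible_locally_Lipschitz_image[OF _ C(4)])
    fix x
    have "open UNIV \<and> x \<in> UNIV \<and> (\<forall>y\<in>(S - (\<Union>i \<in> C. cball (fst i) (snd i))) \<inter> UNIV. norm (g y - g x) \<le> L * norm (y - x))"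
      using lipschitz_onD[OF lip] by (auto simp: dist_norm)
    then show "\<exists>T B. open T \<and> x \<in> T \<and> (\<forall>y\<in>(S - (\<Union>i \<in> C. cball (fst i) (snd i))) \<inter> T. norm (g y - g x) \<le> B * norm (y - x))"
      by blast
  qed simp
  define T where "T = (\<Union>i\<in>C. J i) \<union> g ` (S - (\<Union>i \<in> C. cball (fst i) (snd i)))"
  have bm: "(\<Union>i\<in>C. J i) \<in> sets borel" using C by (intro sets.countable_UN') (auto simp: J_def)
  have Tm: "T \<in> sets lebesgue" unfolding T_def
    using neg bm by (intro sets.Un) (auto simp: negligible_imp_sets)
  have eT: "emeasure lebesgue T = emeasure lebesgue (\<Union>i\<in>C. J i)"
    unfolding T_def using neg bm by (intro emeasure_Un_null_set) (auto simp: negligible_iff_null_sets)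
  obtain V where V: "open V" "T \<subseteq> V" "V - T \<in> lmeasurable" "emeasure lebesgue (V - T) < ennreal \<delta>"
    using sets_lebesgue_outer_open[OF Tm \<delta>] by metis
  have "emeasure lebesgue V = emeasure lebesgue (T \<union> (V - T))" using V by (simp add: Un_absorb1)
  also have "\<dots> \<le> emeasure lebesgue T + emeasure lebesgue (V - T)"
    using Tm V by (intro emeasure_subadditive) auto
  also have "\<dots> \<le> ennreal (p * c) + ennreal \<delta>"
    using V m1 eT bm by (intro add_mono) auto
  also have "\<dots> = ennreal (p * c + \<delta>)" using p c \<delta> by (simp add: ennreal_plus)
  finally have "emeasure lborel V \<le> ennreal (p * c + \<delta>)" using V by simp
  moreover have "g ` S \<subseteq> V"
  proof -
    have "g ` S \<subseteq> T" using Jsub unfolding T_def by blast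
    then show ?thesis using V by blast
  qed
  ultimately show ?thesis using V by blast
qed


text \<open>
  The points at which the lower derivative in the direction \<open>e\<close> is below \<open>p\<close> and the upper one above
  \<open>q\<close>, up to boundary cases. A Lipschitz function has a directional derivative outside the gaps with
  rational \<open>p < q\<close>.
\<close>

definition slope_gap :: "('a::real_normed_vector \<Rightarrow> real) \<Rightarrow> 'a \<Rightarrow> real \<Rightarrow> real \<Rightarrow> 'a set" where
  "slope_gap f e p q = {x. (\<exists>\<^sub>F s in at 0. (f (x + s *\<^sub>R e) - f x) / s < p) \<and>
                           (\<exists>\<^sub>F s in at 0. q < (f (x + s *\<^sub>R e) - f x) / s)}"

text \<open>
  Adding a linear function makes the slopes positive and bounded below, so that the function has a
  Lipschitz inverse. The covering estimate for this function contracts measure by the factor \<open>p'\<close>,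
  the one for its inverse by \<open>1 / q'\<close>. Composing them covers the same set with measure reduced by a
  factor below one, and iteration makes the measure arbitrarily small.
\<close>

lemma negligible_slope_gap_line:
  fixes f :: "real \<Rightarrow> real"
  assumes lip: "L-lipschitz_on UNIV f" and pq: "p < q"
  shows "negligible (slope_gap f 1 p q)"
proof (cases "slope_gap f 1 p q = {}")
  case False
  \<comment> \<open>All slopes of \<open>g\<close> lie between \<open>1\<close> and \<open>2 * L + 1\<close>.\<close>
  define g where "g x = f x + (L + 1) * x" for x
  have L: "0 \<le> L" using lip by (rule lipschitz_on_nonneg)
  have fl: "\<bar>f x - f y\<bar> \<le> L * \<bar>x - y\<bar>" for x y
    using lipschitz_onD[OF lip] by (simp add: dist_real_def)
  have glow: "y - x \<le> g y - g x" if "x \<le> y" for x y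
    using fl[of x y] that by (auto simp: g_def algebra_simps abs_if split: if_splits)
  have gup: "g y - g x \<le> (2 * L + 1) * (y - x)" if "x \<le> y" for x y
    using fl[of x y] that by (auto simp: g_def algebra_simps abs_if split: if_splits)
  have mono: "strict_mono g"
    by (rule strict_monoI) (use glow in \<open>smt (verit)\<close>)
  have glip: "(2 * L + 1)-lipschitz_on UNIV g"
  proof (rule lipschitz_onI)
    fix x y show "dist (g x) (g y) \<le> (2 * L + 1) * dist x y"
      using gup[of x y] gup[of y x] glow[of x y] glow[of y x]
      by (cases "x \<le> y") (auto simp: dist_real_def)
  qed (use L in auto)
  have contg: "continuous_on A g" for A
    using glip lipschitz_on_continuous_on lipschitz_on_subset by blast
  have surjg: "surj g"
  proof (rule surjI[of _ "\<lambda>y. SOME x. g x = y"], rule someI_ex)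
    fix y
    define r where "r = \<bar>y\<bar> + \<bar>g 0\<bar>"
    have "g (-r) \<le> y" "y \<le> g r" "-r \<le> r"
      using glow[of "-r" 0] glow[of 0 r] abs_ge_self[of y] abs_ge_minus_self[of y]
        abs_ge_self[of "g 0"] abs_ge_minus_self[of "g 0"] unfolding r_def by linarith+
    then show "\<exists>x. g x = y" using IVT'[of g "-r" y r, OF _ _ _ contg] by blast
  qed
  have injg: "inj g" using mono by (simp add: strict_mono_imp_inj_on)
  define k where "k = inv g"
  have kg: "k (g x) = x" for x by (simp add: k_def injg)
  have gk: "g (k y) = y" for y by (simp add: k_def surjg surj_f_inv_f)
  have kmono: "strict_mono k"
    by (rule strict_monoI) (metis gk mono strict_mono_less)
  have klip: "1-lipschitz_on UNIV k"
  proof (rule lipschitz_onI)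
    fix x y show "dist (k x) (k y) \<le> 1 * dist x y"
      using glow[of "k x" "k y"] glow[of "k y" "k x"] strict_mono_less_eq[OF kmono]
      by (cases "x \<le> y") (auto simp: dist_real_def gk)
  qed auto
  define p' q' where "p' = p + L + 1" and "q' = q + L + 1"
  have slope: "(g (x + s) - g x) / s = (f (x + s) - f x) / s + (L + 1)" if "s \<noteq> 0" for x s
    using that by (simp add: g_def field_simps)
  have lowfreq: "\<exists>a b. a < b \<and> x \<in> {a..b} \<and> b - a < d \<and> g b - g a < p' * (b - a)"
    if x: "x \<in> slope_gap f 1 p q" and d: "0 < d" for x d
  proof -
    have "\<exists>\<^sub>F s in at 0. (f (x + s) - f x) / s < p"
      using x by (simp add: slope_gap_def)
    then obtain s where s: "s \<noteq> 0" "\<bar>s\<bar> < d" "(f (x + s) - f x) / s < p"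
      unfolding frequently_at using d by (auto simp: dist_real_def)
    then have sl: "(g (x + s) - g x) / s < p'" using slope[of s x] by (simp add: p'_def)
    show ?thesis
    proof (cases "s > 0")
      case True
      then show ?thesis using s sl by (intro exI[of _ x] exI[of _ "x+s"]) (auto simp: field_simps)
    next
      case False
      then show ?thesis using s sl by (intro exI[of _ "x+s"] exI[of _ x]) (auto simp: field_simps)
    qed
  qed
  have upfreq: "\<exists>a b. a < b \<and> x \<in> {a..b} \<and> b - a < d \<and> q' * (b - a) < g b - g a"
    if x: "x \<in> slope_gap f 1 p q" and d: "0 < d" for x d
  proof -
    have "\<exists>\<^sub>F s in at 0. q < (f (x + s) - f x) / s"
      using x by (simp add: slope_gap_def)
    then obtain s where s: "s \<noteq> 0" "\<bar>s\<bar> < d" "q < (f (x + s) - f x) / s"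
      unfolding frequently_at using d by (auto simp: dist_real_def)
    then have sl: "q' < (g (x + s) - g x) / s" using slope[of s x] by (simp add: q'_def)
    show ?thesis
    proof (cases "s > 0")
      case True
      then show ?thesis using s sl by (intro exI[of _ x] exI[of _ "x+s"]) (auto simp: field_simps)
    next
      case False
      then show ?thesis using s sl by (intro exI[of _ "x+s"] exI[of _ x]) (auto simp: field_simps)
    qed
  qed
  obtain x0 where x0: "x0 \<in> slope_gap f 1 p q" using False by blast
  have p': "0 < p'"
  proof -
    obtain a b where ab: "a < b" "g b - g a < p' * (b - a)" using lowfreq[OF x0, of 1] by auto
    have "0 < p' * (b - a)" using glow[of a b] ab by linarith
    then show ?thesis using ab by (simp add: zero_less_mult_iff)
  qed
  have pq': "p' < q'" using pq by (simp add: p'_def q'_def)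
  have bdd: "negligible (slope_gap f 1 p q \<inter> ball 0 (real n))" for n :: nat
  proof -
    define S where "S = slope_gap f 1 p q \<inter> ball 0 (real n)"
    define P where "P c \<longleftrightarrow> (\<exists>U. open U \<and> S \<subseteq> U \<and> emeasure lborel U \<le> ennreal c)" for c
    define \<theta> where "\<theta> = (1 + p' / q') / 2"
    have \<theta>: "0 < \<theta>" "\<theta> < 1" "p' / q' < \<theta>" using p' pq' by (auto simp: \<theta>_def field_simps)
    have step: "P (\<theta> * c)" if "P c" "0 < c" for c
    proof -
      obtain U where U: "open U" "S \<subseteq> U" "emeasure lborel U \<le> ennreal c" using \<open>P c\<close> P_def by auto
      \<comment> \<open>The error \<open>\<delta>\<close> of both coverings together uses up the slack between \<open>p' / q'\<close> and \<open>\<theta>\<close>.\<close>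
      define \<delta> where "\<delta> = (\<theta> - p' / q') * c / (1 / q' + 1)"
      have \<delta>: "0 < \<delta>" using \<theta> that p' pq' by (auto simp: \<delta>_def intro!: divide_pos_pos add_pos_pos)
      have eq: "(1 / q') * (p' * c + \<delta>) + \<delta> = \<theta> * c"
      proof -
        have "\<delta> * (1 / q' + 1) = (\<theta> - p' / q') * c" unfolding \<delta>_def using p' pq'
          by (smt (verit) divide_pos_pos nonzero_eq_divide_eq)
        then show ?thesis by (simp add: algebra_simps)
      qed
      have exV: "\<exists>V. open V \<and> g ` S \<subseteq> V \<and> emeasure lborel V \<le> ennreal (p' * c + \<delta>)"
      proof (rule lipschitz_slope_image_cover[OF glip mono _ _ U _ \<delta>])
          fix x d :: real assume "x \<in> S" "0 < d"
          then show "\<exists>a b. a < b \<and> x \<in> {a..b} \<and> b - a < d \<and> g b - g a \<le> p' * (b - a)"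
            using lowfreq[of x d] unfolding S_def by (meson IntD1 less_imp_le)
      qed (use p' that in auto)
      then obtain V where V: "open V" "g ` S \<subseteq> V" "emeasure lborel V \<le> ennreal (p' * c + \<delta>)" by blast
      have sm: "\<exists>a b. a < b \<and> y \<in> {a..b} \<and> b - a < d \<and> k b - k a \<le> (1 / q') * (b - a)"
        if "y \<in> g ` S" "0 < d" for y d
      proof -
        obtain x where x: "x \<in> slope_gap f 1 p q" "y = g x" using \<open>y \<in> g ` S\<close> S_def by blast
        have "0 < d / (2 * L + 1)" using that L by auto
        from upfreq[OF x(1) this] obtain a b where ab: "a < b" "x \<in> {a..b}" "b - a < d / (2 * L + 1)"
          "q' * (b - a) < g b - g a" by blast
        have "g b - g a \<le> (2 * L + 1) * (b - a)" using gup[of a b] ab by auto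
        also have "\<dots> < d" using ab L by (simp add: field_simps)
        finally have "g b - g a < d" .
        moreover have "g a < g b" "y \<in> {g a..g b}" using ab mono x by (auto simp: strict_mono_less strict_mono_less_eq)
        moreover have "k (g b) - k (g a) \<le> (1 / q') * (g b - g a)"
          using ab p' pq' by (simp add: kg field_simps)
        ultimately show ?thesis by blast
      qed
      have kS: "k ` g ` S = S" by (simp add: image_image kg)
      have "\<exists>W. open W \<and> k ` g ` S \<subseteq> W \<and> emeasure lborel W \<le> ennreal ((1 / q') * (p' * c + \<delta>) + \<delta>)"
        by (rule lipschitz_slope_image_cover[OF klip kmono _ sm V _ \<delta>]) (use p' pq' \<delta> that in auto)
      then show ?thesis unfolding P_def eq kS .
    qed
    have P0: "P (2 * real n + 1)"
      unfolding P_def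
    proof (intro exI[of _ "ball 0 (real n)"] conjI)
      have "ball 0 (real n) = {- real n <..< real n}" by (auto simp: dist_real_def)
      moreover have "emeasure lborel {- real n <..< real n} = ennreal (2 * real n)"
        by (subst emeasure_lborel_Ioo) auto
      ultimately have "emeasure lborel (ball (0::real) (real n)) = ennreal (2 * real n)" by metis
      also have "\<dots> \<le> ennreal (2 * real n + 1)" by (rule ennreal_leI) simp
      finally show "emeasure lborel (ball (0::real) (real n)) \<le> ennreal (2 * real n + 1)" .
    qed (auto simp: S_def)
    have Pk: "P (\<theta> ^ j * (2 * real n + 1))" for j
    proof (induction j)
      case (Suc j)
      then show ?case using step[of "\<theta> ^ j * (2 * real n + 1)"] \<theta> by (simp add: mult.assoc)
    qed (use P0 in simp)
    show ?thesis
      unfolding S_def[symmetric] negligible_outer_le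
    proof (intro allI impI)
      fix e :: real assume e: "0 < e"
      obtain j where j: "\<theta> ^ j < e / (2 * real n + 1)"
        using real_arch_pow_inv[of "e / (2 * real n + 1)" \<theta>] e \<theta> by auto
      then have je: "\<theta> ^ j * (2 * real n + 1) \<le> e" by (simp add: field_simps)
      obtain U where U: "open U" "S \<subseteq> U" "emeasure lborel U \<le> ennreal (\<theta> ^ j * (2 * real n + 1))"
        using Pk[of j] P_def by auto
      have le: "emeasure lborel U \<le> ennreal e" using U je by (meson ennreal_leI order_trans)
      have "U \<in> lmeasurable" using U le by (intro fmeasurableI) (auto simp: top_unique less_top[symmetric])
      moreover have "measure lebesgue U \<le> e"
        using le U e by (simp add: measure_def enn2real_leI)
      ultimately show "\<exists>T. S \<subseteq> T \<and> T \<in> lmeasurable \<and> measure lebesgue T \<le> e" using U by blast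
    qed
  qed
  have "slope_gap f 1 p q = (\<Union>n. slope_gap f 1 p q \<inter> ball 0 (real n))"
    using reals_Archimedean2 by (auto simp: dist_real_def)
  moreover have "negligible (\<Union>n. slope_gap f 1 p q \<inter> ball 0 (real n))"
    by (rule negligible_Union_nat) (rule bdd)
  ultimately show ?thesis by metis
qed auto

section \<open>Null sets and their sections by parallel lines\<close>

lemma LIMSEQ_one_over_Suc: "(\<lambda>n. 1 / real (Suc n)) \<longlonglongrightarrow> 0"
  using LIMSEQ_inverse_real_of_nat by (simp add: inverse_eq_divide)

lemma borel_line_section:
  fixes Z :: "'a::euclidean_space set" and e :: 'a
  assumes "Z \<in> sets borel"
  shows "{s::real. x + s *\<^sub>R e \<in> Z} \<in> sets borel"
proof -
  have "(\<lambda>s::real. x + s *\<^sub>R e) \<in> borel_measurable borel" by measurable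
  from measurable_sets[OF this assms] show ?thesis by (simp add: vimage_def)
qed

text \<open>
  Tonelli's theorem for the shear \<open>(x, s) \<mapsto> x + s *\<^sub>R e\<close>, by translation invariance of Lebesgue measure.
  It replaces a splitting of the space into coordinates and works for every direction \<open>e\<close>.
\<close>

lemma nn_integral_line_sections:
  fixes Z :: "'a::euclidean_space set" and e :: 'a
  assumes Z: "Z \<in> sets borel"
  shows "(\<integral>\<^sup>+x. emeasure lborel {s::real. x + s *\<^sub>R e \<in> Z} \<partial>lborel) = \<infinity> * emeasure lborel Z"
proof -
  have meas: "(\<lambda>(s::real, x). indicator Z (x + s *\<^sub>R e) :: ennreal) \<in> borel_measurable (lborel \<Otimes>\<^sub>M lborel)"
  proof -
    have "(\<lambda>y::real \<times> 'a. snd y + fst y *\<^sub>R e) \<in> borel_measurable (borel \<Otimes>\<^sub>M borel)"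
      by measurable
    then have "(\<lambda>y::real \<times> 'a. indicator Z (snd y + fst y *\<^sub>R e) :: ennreal) \<in> borel_measurable (borel \<Otimes>\<^sub>M borel)"
      by (rule measurable_compose[of _ _ borel]) (use Z in simp)
    moreover have "sets (lborel \<Otimes>\<^sub>M lborel) = sets (borel \<Otimes>\<^sub>M (borel :: 'a measure) :: (real \<times> 'a) measure)"
      by (rule sets_pair_measure_cong) simp_all
    ultimately show ?thesis unfolding case_prod_beta'
      using measurable_cong_sets by blast
  qed
  have tr: "(\<integral>\<^sup>+x. indicator Z (x + s *\<^sub>R e) \<partial>lborel) = emeasure lborel Z" for s :: real
  proof -
    have "emeasure lborel Z = (\<integral>\<^sup>+y. indicator Z y \<partial>distr lborel borel ((+) (s *\<^sub>R e)))"
      using Z by (simp add: lborel_distr_plus)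
    also have "\<dots> = (\<integral>\<^sup>+x. indicator Z (s *\<^sub>R e + x) \<partial>lborel)"
      using Z by (subst nn_integral_distr) auto
    finally show ?thesis by (simp add: add.commute)
  qed
  have sec: "(\<integral>\<^sup>+s. indicator Z (x + s *\<^sub>R e) \<partial>lborel) = emeasure lborel {s::real. x + s *\<^sub>R e \<in> Z}" for x
  proof -
    have "{s::real. x + s *\<^sub>R e \<in> Z} \<in> sets borel" by (rule borel_line_section[OF Z])
    moreover have "(\<lambda>s::real. indicator Z (x + s *\<^sub>R e) :: ennreal) = indicator {s. x + s *\<^sub>R e \<in> Z}"
      by (auto simp: indicator_def)
    ultimately show ?thesis by simp
  qed
  have "(\<integral>\<^sup>+x. (\<integral>\<^sup>+s. indicator Z (x + s *\<^sub>R e) \<partial>lborel) \<partial>lborel)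
      = (\<integral>\<^sup>+s. (\<integral>\<^sup>+x. indicator Z (x + s *\<^sub>R e) \<partial>lborel) \<partial>lborel)"
    using lborel_pair.Fubini[OF meas] by simp
  then show ?thesis by (simp add: tr sec mult.commute)
qed

lemma negligible_if_line_sections:
  fixes Z :: "'a::euclidean_space set" and e :: 'a
  assumes Z: "Z \<in> sets borel" and "\<And>x. negligible {s::real. x + s *\<^sub>R e \<in> Z}"
  shows "negligible Z"
proof -
  have "{s::real. x + s *\<^sub>R e \<in> Z} \<in> sets borel" for x by (rule borel_line_section[OF Z])
  then have "emeasure lborel {s::real. x + s *\<^sub>R e \<in> Z} = 0" for x
    using assms(2)[of x] by (simp add: negligible_iff_emeasure0)
  then have "\<infinity> * emeasure lborel Z = 0"
    using nn_integral_line_sections[OF Z, of e] by simp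
  then show ?thesis using Z by (simp add: negligible_iff_emeasure0)
qed

lemma AE_negligible_line_sections:
  fixes Z :: "'a::euclidean_space set" and e :: 'a
  assumes "negligible Z"
  shows "AE x in lborel. negligible {s::real. x + s *\<^sub>R e \<in> Z}"
proof -
  obtain Y where Y: "Y \<in> null_sets lborel" "Z \<subseteq> Y"
    using assms by (auto simp: negligible_iff_null_sets null_sets_completion_iff2)
  then have Yb: "Y \<in> sets borel" by auto
  have m: "{s::real. x + s *\<^sub>R e \<in> Y} \<in> sets borel" for x by (rule borel_line_section[OF Yb])
  have "(\<integral>\<^sup>+x. emeasure lborel {s::real. x + s *\<^sub>R e \<in> Y} \<partial>lborel) = 0"
    using nn_integral_line_sections[OF Yb, of e] Y by auto
  moreover have "(\<lambda>x. emeasure lborel {s::real. x + s *\<^sub>R e \<in> Y}) \<in> borel_measurable lborel"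
  proof -
    have "(\<lambda>y::'a \<times> real. fst y + snd y *\<^sub>R e) \<in> borel_measurable (borel \<Otimes>\<^sub>M borel)"
      by measurable
    from measurable_sets[OF this Yb]
    have "{y::'a \<times> real. fst y + snd y *\<^sub>R e \<in> Y} \<in> sets (lborel \<Otimes>\<^sub>M lborel)"
      by (simp add: vimage_def space_pair_measure cong: sets_pair_measure_cong)
    from lborel.measurable_emeasure_Pair[OF this]
    show ?thesis by (simp add: vimage_def)
  qed
  ultimately have "AE x in lborel. emeasure lborel {s::real. x + s *\<^sub>R e \<in> Y} = 0"
    by (simp add: nn_integral_0_iff_AE)
  then show ?thesis
  proof (rule AE_mp, intro AE_I2 impI)
    fix x assume "emeasure lborel {s::real. x + s *\<^sub>R e \<in> Y} = 0"
    then have "negligible {s::real. x + s *\<^sub>R e \<in> Y}" using m[of x] by (simp add: negligible_iff_emeasure0)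
    then show "negligible {s::real. x + s *\<^sub>R e \<in> Z}"
      by (rule negligible_subset) (use Y in auto)
  qed
qed

section \<open>Rademacher's theorem\<close>

lemma borel_slope_gap:
  fixes f :: "'a::euclidean_space \<Rightarrow> real"
  assumes "continuous_on UNIV f"
  shows "slope_gap f e p q \<in> sets borel"
proof -
  have fq: "(\<exists>\<^sub>F s in at (0::real). P s) \<longleftrightarrow> (\<forall>n::nat. \<exists>s\<in>{s. s \<noteq> 0 \<and> \<bar>s\<bar> < 1 / Suc n}. P s)" for P
  proof
    assume "\<exists>\<^sub>F s in at (0::real). P s"
    then show "\<forall>n::nat. \<exists>s\<in>{s. s \<noteq> 0 \<and> \<bar>s\<bar> < 1 / Suc n}. P s"
      unfolding frequently_at by (auto simp: dist_real_def)
  next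
    assume A: "\<forall>n::nat. \<exists>s\<in>{s. s \<noteq> 0 \<and> \<bar>s\<bar> < 1 / Suc n}. P s"
    show "\<exists>\<^sub>F s in at (0::real). P s" unfolding frequently_at
    proof (intro allI impI)
      fix d :: real assume "0 < d"
      then obtain n where "inverse (real (Suc n)) < d" using reals_Archimedean by blast
      with A show "\<exists>x\<in>UNIV. x \<noteq> 0 \<and> dist x 0 < d \<and> P x"
        by (force simp: inverse_eq_divide dest: spec[of _ n])
    qed
  qed
  have c: "continuous_on UNIV (\<lambda>x. (f (x + s *\<^sub>R e) - f x) / s)" if "s \<noteq> 0" for s
    using that by (intro continuous_intros continuous_on_compose2[OF assms]) auto
  have "slope_gap f e p q = (\<Inter>n::nat. \<Union>s\<in>{s. s \<noteq> 0 \<and> \<bar>s\<bar> < 1 / Suc n}. {x. (f (x + s *\<^sub>R e) - f x) / s < p}) \<inter>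
       (\<Inter>n::nat. \<Union>s\<in>{s. s \<noteq> 0 \<and> \<bar>s\<bar> < 1 / Suc n}. {x. q < (f (x + s *\<^sub>R e) - f x) / s})"
    unfolding slope_gap_def fq by blast
  moreover have "open (\<Union>s\<in>{s. s \<noteq> 0 \<and> \<bar>s\<bar> < 1 / Suc n}. {x. (f (x + s *\<^sub>R e) - f x) / s < p})" for n :: nat
    by (intro open_UN ballI open_Collect_less c) auto
  moreover have "open (\<Union>s\<in>{s. s \<noteq> 0 \<and> \<bar>s\<bar> < 1 / Suc n}. {x. q < (f (x + s *\<^sub>R e) - f x) / s})" for n :: nat
    by (intro open_UN ballI open_Collect_less c) auto
  ultimately show ?thesis
    by (auto intro!: sets.Int sets.countable_INT borel_open)
qed

lemma negligible_slope_gap: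
  fixes f :: "'a::euclidean_space \<Rightarrow> real"
  assumes lip: "L-lipschitz_on UNIV f" and pq: "p < q"
  shows "negligible (slope_gap f e p q)"
proof (rule negligible_if_line_sections)
  show "slope_gap f e p q \<in> sets borel"
    using lip borel_slope_gap lipschitz_on_continuous_on by blast
  fix x
  have "(L * norm e)-lipschitz_on UNIV (\<lambda>s. f (x + s *\<^sub>R e))"
  proof (rule lipschitz_onI)
    fix s t :: real
    have "dist (f (x + s *\<^sub>R e)) (f (x + t *\<^sub>R e)) \<le> L * dist (x + s *\<^sub>R e) (x + t *\<^sub>R e)"
      by (rule lipschitz_onD[OF lip]) auto
    also have "dist (x + s *\<^sub>R e) (x + t *\<^sub>R e) = norm e * dist s t"
      by (simp add: dist_norm scaleR_left_diff_distrib[symmetric] mult.commute)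
    finally show "dist (f (x + s *\<^sub>R e)) (f (x + t *\<^sub>R e)) \<le> L * norm e * dist s t" by (simp add: mult.assoc)
  qed (use lipschitz_on_nonneg[OF lip] in simp)
  from negligible_slope_gap_line[OF this pq]
  show "negligible {s. x + s *\<^sub>R e \<in> slope_gap f e p q}"
    by (simp add: slope_gap_def algebra_simps)
qed

definition has_dir_deriv :: "('a::real_normed_vector \<Rightarrow> real) \<Rightarrow> 'a \<Rightarrow> 'a \<Rightarrow> real \<Rightarrow> bool" where
  "has_dir_deriv f x e l \<longleftrightarrow> ((\<lambda>s. (f (x + s *\<^sub>R e) - f x) / s) \<longlongrightarrow> l) (at 0)"

text \<open>
  The limit is the supremum of the numbers that are eventually below the difference quotient. If some
  larger number were frequently reached, two rational numbers in between would witness a gap.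
\<close>

lemma has_dir_deriv_outside_gaps:
  fixes f :: "'a::real_normed_vector \<Rightarrow> real"
  assumes lip: "L-lipschitz_on UNIV f"
    and x: "\<And>p q. \<lbrakk>p \<in> \<rat>; q \<in> \<rat>; p < q\<rbrakk> \<Longrightarrow> x \<notin> slope_gap f e p q"
  shows "\<exists>l. has_dir_deriv f x e l"
proof -
  define Q where "Q s = (f (x + s *\<^sub>R e) - f x) / s" for s
  define C where "C = L * norm e"
  have Q: "\<bar>Q s\<bar> \<le> C" for s
  proof (cases "s = 0")
    case False
    have "\<bar>f (x + s *\<^sub>R e) - f x\<bar> \<le> L * (\<bar>s\<bar> * norm e)"
      using lipschitz_onD[OF lip, of "x + s *\<^sub>R e" x] by (simp add: dist_norm)
    then show ?thesis using False by (simp add: Q_def C_def abs_divide field_simps)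
  qed (use lipschitz_on_nonneg[OF lip] in \<open>simp add: Q_def C_def\<close>)
  define A where "A = {a. \<forall>\<^sub>F s in at 0. a \<le> Q s}"
  have "- C \<in> A" using Q unfolding A_def by (auto intro!: always_eventually simp: abs_le_iff minus_le_iff)
  have Aup: "a \<le> C" if "a \<in> A" for a
  proof -
    have "\<forall>\<^sub>F s in at 0. a \<le> Q s" using that unfolding A_def by simp
    then have "\<exists>\<^sub>F s in at 0. a \<le> Q s" by (simp add: eventually_frequently)
    then obtain s where "a \<le> Q s" using frequently_ex by blast
    then show ?thesis using Q[of s] by linarith
  qed
  then have bdd: "bdd_above A" by (auto simp: bdd_above_def)
  define l where "l = Sup A"
  have "(Q \<longlongrightarrow> l) (at 0)"
  proof (rule order_tendstoI)
    fix a assume "a < l"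
    then obtain b where "b \<in> A" "a < b" using less_cSup_iff[of A a] bdd \<open>- C \<in> A\<close> unfolding l_def by blast
    then have "\<forall>\<^sub>F s in at 0. b \<le> Q s" unfolding A_def by simp
    then show "\<forall>\<^sub>F s in at 0. a < Q s" by (rule eventually_mono) (use \<open>a < b\<close> in simp)
  next
    fix a assume a: "l < a"
    show "\<forall>\<^sub>F s in at 0. Q s < a"
    proof (rule ccontr)
      assume "\<not> ?thesis"
      then have up: "\<exists>\<^sub>F s in at 0. a \<le> Q s" by (simp add: frequently_def not_le)
      obtain q where q: "q \<in> \<rat>" "l < q" "q < a" using Rats_dense_in_real[OF a] by blast
      obtain p where p: "p \<in> \<rat>" "l < p" "p < q" using Rats_dense_in_real[OF q(2)] by blast
      have "p \<notin> A" using p cSup_upper[OF _ bdd] unfolding l_def by force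
      then have lo: "\<exists>\<^sub>F s in at 0. Q s < p" by (simp add: A_def frequently_def not_less)
      have "\<exists>\<^sub>F s in at 0. q < Q s" using up by (rule frequently_mono[rotated]) (use q in auto)
      with lo have "x \<in> slope_gap f e p q" by (simp add: slope_gap_def Q_def)
      with x[of p q] p q show False by simp
    qed
  qed
  then show ?thesis unfolding has_dir_deriv_def Q_def by blast
qed


text \<open>
  The translates of the bad part of a compact piece of \<open>E\<close> by \<open>v / k\<close> stay in every neighbourhood of
  that piece for large \<open>k\<close>, yet they avoid the piece itself. Their common measure is therefore bounded
  by the measure of a neighbourhood minus the piece, which is arbitrarily small.
\<close>

lemma negligible_nonreturning:
  fixes E :: "'a::euclidean_space set"
  assumes E: "closed E"
  shows "negligible {x \<in> E. \<exists>k0. \<forall>k\<ge>k0. x + (1 / real (Suc k)) *\<^sub>R v \<notin> E}"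
proof -
  define Ec where "Ec n = E \<inter> cball 0 (real n)" for n
  define S where "S n k0 = {x \<in> Ec n. \<forall>k\<ge>k0. x + (1 / real (Suc k)) *\<^sub>R v \<notin> Ec n}" for n k0
  have neg: "negligible (S n k0)" for n k0
    unfolding negligible_outer_le
  proof (intro allI impI)
    fix \<epsilon> :: real assume \<epsilon>: "0 < \<epsilon>"
    have comp: "compact (Ec n)" unfolding Ec_def using E by (simp add: closed_Int_compact)
    then have "Ec n \<in> sets lebesgue" by (intro lmeasurable_compact fmeasurableD)
    then obtain W where W: "open W" "Ec n \<subseteq> W" "W - Ec n \<in> lmeasurable" "emeasure lebesgue (W - Ec n) < ennreal \<epsilon>"
      using sets_lebesgue_outer_open \<epsilon> by metis
    obtain d where d: "0 < d" "(\<Union>x\<in>Ec n. ball x d) \<subseteq> W"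
      using compact_subset_open_imp_ball_epsilon_subset[OF comp W(1,2)] by blast
    obtain k1 :: nat where k1: "norm v / d < real k1" using reals_Archimedean2 by blast
    define k where "k = max k0 k1"
    define s where "s = (1 / real (Suc k)) *\<^sub>R v"
    have "norm v / d < real (Suc k)" using k1 by (simp add: k_def)
    then have "norm s < d" using d by (simp add: s_def field_simps)
    have "S n k0 \<subseteq> (+) (- s) ` (W - Ec n)"
    proof
      fix x assume x: "x \<in> S n k0"
      have "x + s \<notin> Ec n" using x unfolding S_def s_def by (auto simp: k_def)
      moreover have "x + s \<in> ball x d" using \<open>norm s < d\<close> by (simp add: dist_norm)
      then have "x + s \<in> W" using d x S_def by blast
      ultimately have "x + s \<in> W - Ec n" by blast
      then show "x \<in> (+) (- s) ` (W - Ec n)" by (rule rev_image_eqI) simp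
    qed
    moreover have "(+) (- s) ` (W - Ec n) \<in> lmeasurable" by (rule measurable_translation[OF W(3)])
    moreover have "measure lebesgue ((+) (- s) ` (W - Ec n)) \<le> \<epsilon>"
      unfolding measure_translation using W(4) \<epsilon> by (simp add: measure_def enn2real_leI less_imp_le)
    ultimately show "\<exists>T. S n k0 \<subseteq> T \<and> T \<in> lmeasurable \<and> measure lebesgue T \<le> \<epsilon>" by blast
  qed
  have "{x \<in> E. \<exists>k0. \<forall>k\<ge>k0. x + (1 / real (Suc k)) *\<^sub>R v \<notin> E} \<subseteq> (\<Union>n. \<Union>k0. S n k0)"
  proof clarify
    fix x k0 assume x: "x \<in> E" and k0: "\<forall>k\<ge>k0. x + (1 / real (Suc k)) *\<^sub>R v \<notin> E"
    obtain n :: nat where "norm x \<le> real n" using real_arch_simple by blast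
    then have "x \<in> S n k0" using x k0 by (auto simp: S_def Ec_def)
    then show "x \<in> (\<Union>n. \<Union>k0. S n k0)" by blast
  qed
  then show ?thesis
    by (rule negligible_subset[rotated]) (intro negligible_Union_nat neg)
qed

lemma has_dir_deriv_along:
  assumes "has_dir_deriv f x e l" and "filterlim s (at 0) F"
  shows "((\<lambda>k. (f (x + s k *\<^sub>R e) - f x) / s k) \<longlongrightarrow> l) F"
  using assms unfolding has_dir_deriv_def by (rule filterlim_compose)

lemma filterlim_inverse_Suc_at_0: "filterlim (\<lambda>k. 1 / real (Suc k)) (at 0) sequentially"
proof (rule filterlim_atI)
  show "(\<lambda>k. 1 / real (Suc k)) \<longlonglongrightarrow> 0" by (rule LIMSEQ_one_over_Suc)
qed auto

text \<open>
  The difference quotient in the direction \<open>a + b\<close> at \<open>x\<close> is the one in the direction \<open>a\<close> at \<open>x\<close> plus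
  the one in the direction \<open>b\<close> at the displaced point \<open>x + s a\<close>. The latter has nearly the same value
  at \<open>x\<close> and at \<open>x + s a\<close> if both points lie in one of countably many closed sets on which the
  derivative in the direction \<open>b\<close> is approximated uniformly by a fixed rational number. By
  \<open>negligible_nonreturning\<close> almost every point of such a set returns to it along \<open>s = 1 / k\<close>. This idea
  of Nekvinda and Zajicek avoids integration by parts.
\<close>

lemma negligible_dir_deriv_nonadditive:
  fixes f :: "'a::euclidean_space \<Rightarrow> real"
  assumes lip: "L-lipschitz_on UNIV f"
  shows "negligible {x. \<exists>\<alpha> \<beta> \<gamma>. has_dir_deriv f x a \<alpha> \<and> has_dir_deriv f x b \<beta> \<and>
                           has_dir_deriv f x (a + b) \<gamma> \<and> \<gamma> \<noteq> \<alpha> + \<beta>}" (is "negligible ?B")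
proof -
  have contf: "continuous_on UNIV f" using lip lipschitz_on_continuous_on by blast
  define E where "E m r j = {x. \<forall>s. \<bar>s\<bar> \<le> 1 / real (Suc j) \<longrightarrow> \<bar>f (x + s *\<^sub>R b) - f x - s * r\<bar> \<le> \<bar>s\<bar> / real (Suc m)}"
    for m j :: nat and r :: real
  have closedE: "closed (E m r j)" for m r j
  proof -
    have "E m r j = (\<Inter>s\<in>{s. \<bar>s\<bar> \<le> 1 / real (Suc j)}. {x. \<bar>f (x + s *\<^sub>R b) - f x - s * r\<bar> \<le> \<bar>s\<bar> / real (Suc m)})"
      unfolding E_def by blast
    moreover have "closed {x. \<bar>f (x + s *\<^sub>R b) - f x - s * r\<bar> \<le> \<bar>s\<bar> / real (Suc m)}" for s
      by (intro closed_Collect_le continuous_intros continuous_on_compose2[OF contf]) auto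
    ultimately show ?thesis by (simp add: closed_INT)
  qed
  define N where "N m r j = {x \<in> E m r j. \<exists>k0. \<forall>k\<ge>k0. x + (1 / real (Suc k)) *\<^sub>R a \<notin> E m r j}" for m r j
  have negN: "negligible (\<Union>m. \<Union>j. \<Union>r\<in>\<rat>. N m r j)"
  proof (intro negligible_Union_nat)
    fix m j
    show "negligible (\<Union>r\<in>\<rat>. N m r j)"
      using negligible_nonreturning[OF closedE]
      by (intro negligible_countable_Union) (auto simp del: of_nat_Suc simp: N_def countable_rat)
  qed
  have "?B \<subseteq> (\<Union>m. \<Union>j. \<Union>r\<in>\<rat>. N m r j)"
  proof (rule subsetI, rule ccontr)
    fix x assume "x \<in> ?B" and nN: "x \<notin> (\<Union>m. \<Union>j. \<Union>r\<in>\<rat>. N m r j)"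
    then obtain \<alpha> \<beta> \<gamma> where d: "has_dir_deriv f x a \<alpha>" "has_dir_deriv f x b \<beta>"
      "has_dir_deriv f x (a + b) \<gamma>" "\<gamma> \<noteq> \<alpha> + \<beta>" by blast
    define \<eta> where "\<eta> = \<bar>\<gamma> - \<alpha> - \<beta>\<bar> / 2"
    have "0 < \<eta>" using d by (auto simp: \<eta>_def)
    then obtain m where m: "inverse (real (Suc m)) < \<eta>" using reals_Archimedean by blast
    define \<epsilon> where "\<epsilon> = 1 / real (Suc m)"
    have \<epsilon>: "0 < \<epsilon>" "\<epsilon> < \<eta>" using m by (auto simp: \<epsilon>_def inverse_eq_divide)
    obtain r where r: "r \<in> \<rat>" "\<beta> < r" "r < \<beta> + \<epsilon> / 2"
      using Rats_dense_in_real[of \<beta> "\<beta> + \<epsilon> / 2"] \<epsilon> by auto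
    have "\<forall>\<^sub>F s in at 0. \<bar>(f (x + s *\<^sub>R b) - f x) / s - \<beta>\<bar> < \<epsilon> / 2"
      using tendstoD[OF d(2)[unfolded has_dir_deriv_def], of "\<epsilon> / 2"] \<epsilon> by (simp add: dist_real_def)
    then obtain \<delta> where \<delta>: "0 < \<delta>" "\<And>s. s \<noteq> 0 \<Longrightarrow> \<bar>s\<bar> < \<delta> \<Longrightarrow> \<bar>(f (x + s *\<^sub>R b) - f x) / s - \<beta>\<bar> < \<epsilon> / 2"
      unfolding eventually_at by (auto simp: dist_real_def)
    obtain j where j: "inverse (real (Suc j)) < \<delta>" using reals_Archimedean \<delta> by blast
    have xE: "x \<in> E m r j" unfolding E_def
    proof (intro CollectI allI impI)
      fix s :: real assume s: "\<bar>s\<bar> \<le> 1 / real (Suc j)"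
      show "\<bar>f (x + s *\<^sub>R b) - f x - s * r\<bar> \<le> \<bar>s\<bar> / real (Suc m)"
      proof (cases "s = 0")
        case False
        have "\<bar>(f (x + s *\<^sub>R b) - f x) / s - \<beta>\<bar> < \<epsilon> / 2"
          using False s j \<delta> by (auto simp: inverse_eq_divide)
        then have "\<bar>(f (x + s *\<^sub>R b) - f x) / s - r\<bar> \<le> \<epsilon>" using r by linarith
        then have "\<bar>s\<bar> * \<bar>(f (x + s *\<^sub>R b) - f x) / s - r\<bar> \<le> \<bar>s\<bar> * \<epsilon>" by (intro mult_left_mono) auto
        moreover have "s * ((f (x + s *\<^sub>R b) - f x) / s - r) = f (x + s *\<^sub>R b) - f x - s * r"
          using False by (simp add: field_simps)
        ultimately show ?thesis by (simp add: \<epsilon>_def abs_mult[symmetric])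
      qed simp
    qed
    define \<sigma> where "\<sigma> k = 1 / real (Suc k)" for k
    have ret: "\<exists>\<^sub>F k in sequentially. x + \<sigma> k *\<^sub>R a \<in> E m r j"
    proof -
      have "x \<notin> N m r j" using nN r by blast
      then have "\<And>k0. \<exists>k\<ge>k0. x + \<sigma> k *\<^sub>R a \<in> E m r j" using xE unfolding N_def \<sigma>_def by blast
      then show ?thesis unfolding frequently_sequentially by blast
    qed
    define D where "D k = (f (x + \<sigma> k *\<^sub>R (a + b)) - f x) / \<sigma> k - (f (x + \<sigma> k *\<^sub>R a) - f x) / \<sigma> k" for k
    have \<sigma>0: "filterlim \<sigma> (at 0) sequentially" unfolding \<sigma>_def by (rule filterlim_inverse_Suc_at_0)
    have Dlim: "D \<longlonglongrightarrow> \<gamma> - \<alpha>" unfolding D_def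
      by (intro tendsto_diff has_dir_deriv_along[OF _ \<sigma>0] d)
    have ev: "\<forall>\<^sub>F k in sequentially. \<bar>D k - (\<gamma> - \<alpha>)\<bar> < \<epsilon> / 2 \<and> k \<ge> j"
      using tendstoD[OF Dlim, of "\<epsilon> / 2"] \<epsilon> eventually_ge_at_top[of j]
      unfolding dist_real_def by (intro eventually_conj) auto
    obtain k where k: "x + \<sigma> k *\<^sub>R a \<in> E m r j" "\<bar>D k - (\<gamma> - \<alpha>)\<bar> < \<epsilon> / 2" "k \<ge> j"
      using frequently_ex[OF frequently_eventually_conj[OF ret ev]] by blast
    have s: "0 < \<sigma> k" "\<bar>\<sigma> k\<bar> \<le> 1 / real (Suc j)" using k by (auto simp: \<sigma>_def frac_le)
    have "\<bar>f (x + \<sigma> k *\<^sub>R a + \<sigma> k *\<^sub>R b) - f (x + \<sigma> k *\<^sub>R a) - \<sigma> k * r\<bar> \<le> \<bar>\<sigma> k\<bar> * \<epsilon>"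
    proof -
      have "\<bar>s\<bar> \<le> 1 / real (Suc j) \<Longrightarrow> \<bar>f (x + \<sigma> k *\<^sub>R a + s *\<^sub>R b) - f (x + \<sigma> k *\<^sub>R a) - s * r\<bar> \<le> \<bar>s\<bar> / real (Suc m)" for s
        using k(1) unfolding E_def by blast
      from this[OF s(2)] show ?thesis by (simp add: \<epsilon>_def)
    qed
    moreover have "f (x + \<sigma> k *\<^sub>R a + \<sigma> k *\<^sub>R b) - f (x + \<sigma> k *\<^sub>R a) - \<sigma> k * r = \<sigma> k * (D k - r)"
      using s by (simp add: D_def field_simps scaleR_add_right)
    ultimately have "\<bar>D k - r\<bar> \<le> \<epsilon>" using s by (simp add: abs_mult)
    then have "\<bar>\<gamma> - \<alpha> - \<beta>\<bar> < 2 * \<epsilon>" using k(2) r by linarith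
    then show False using \<epsilon> by (simp add: \<eta>_def)
  qed
  then show ?thesis using negN negligible_subset by blast
qed

text \<open>
  Outside a null set the directional derivatives exist and are additive on the countable dense group
  \<open>D\<close> of rational combinations of basis vectors, hence they agree there with a linear map \<open>T\<close>.
  Finitely many directions of \<open>D\<close> approximate the whole unit sphere, and the Lipschitz condition carries the
  differentiability along them to all directions uniformly.
\<close>

lemma negligible_nondifferentiable_scalar:
  fixes f :: "'a::euclidean_space \<Rightarrow> real"
  assumes lip: "L-lipschitz_on UNIV f"
  shows "negligible {x. \<not> f differentiable (at x)}"
proof -
  have L: "0 \<le> L" using lip by (rule lipschitz_on_nonneg)
  have fl: "\<bar>f x - f y\<bar> \<le> L * norm (x - y)" for x y
    using lipschitz_onD[OF lip] by (simp add: dist_norm)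
  define D :: "'a set" where "D = (\<lambda>q. \<Sum>b\<in>Basis. q b *\<^sub>R b) ` (PiE Basis (\<lambda>_. \<rat>))"
  have countD: "countable D" unfolding D_def
    by (intro countable_image countable_PiE) (auto simp: countable_rat)
  have inD: "(\<Sum>b\<in>B. q b *\<^sub>R b) \<in> D" if "B \<subseteq> Basis" "\<And>b. b \<in> B \<Longrightarrow> q b \<in> \<rat>" for B q
  proof -
    define q' where "q' = (\<lambda>b\<in>Basis. if b \<in> B then q b else 0)"
    have "(\<Sum>b\<in>Basis. q' b *\<^sub>R b) = (\<Sum>b\<in>B. q b *\<^sub>R b)"
      by (rule sum.mono_neutral_cong_right) (use that in \<open>auto simp: q'_def\<close>)
    moreover have "q' \<in> PiE Basis (\<lambda>_. \<rat>)" using that by (auto simp: q'_def)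
    ultimately show ?thesis unfolding D_def by (intro image_eqI[of _ _ q']) auto
  qed
  have denseD: "\<exists>v\<in>D. norm (u - v) < \<epsilon>" if "0 < \<epsilon>" for u \<epsilon>
  proof -
    have "\<exists>r\<in>\<rat>. \<bar>u \<bullet> b - r\<bar> < \<epsilon> / (2 * DIM('a))" for b :: 'a
    proof -
      have pos: "0 < \<epsilon> / (2 * DIM('a))" using that by simp
      then obtain r where "r \<in> \<rat>" "u \<bullet> b - \<epsilon> / (2 * DIM('a)) < r" "r < u \<bullet> b"
        using Rats_dense_in_real[of "u \<bullet> b - \<epsilon> / (2 * DIM('a))" "u \<bullet> b"] by auto
      then have "\<bar>u \<bullet> b - r\<bar> < \<epsilon> / (2 * DIM('a))" by linarith
      with \<open>r \<in> \<rat>\<close> show ?thesis by blast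
    qed
    then obtain q where q: "\<And>b. q b \<in> \<rat>" "\<And>b. \<bar>u \<bullet> b - q b\<bar> < \<epsilon> / (2 * DIM('a))" by metis
    define v where "v = (\<Sum>b\<in>Basis. q b *\<^sub>R b)"
    have "norm (u - v) \<le> (\<Sum>b\<in>Basis. \<bar>(u - v) \<bullet> b\<bar>)" by (rule norm_le_l1)
    also have "\<dots> = (\<Sum>b\<in>Basis. \<bar>u \<bullet> b - q b\<bar>)"
      by (rule sum.cong) (auto simp: v_def inner_diff_left)
    also have "\<dots> \<le> (\<Sum>b\<in>(Basis::'a set). \<epsilon> / (2 * DIM('a)))" by (intro sum_mono less_imp_le q)
    also have "\<dots> < \<epsilon>" using that by simp
    finally show ?thesis using inD[of Basis q] q unfolding v_def by blast
  qed
  define G where "G = (\<Union>v\<in>D. \<Union>p\<in>\<rat>. \<Union>q\<in>{q\<in>\<rat>. p < q}. slope_gap f v p q)"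
  define A where "A v w = {x. \<exists>\<alpha> \<beta> \<gamma>. has_dir_deriv f x v \<alpha> \<and> has_dir_deriv f x w \<beta> \<and>
                           has_dir_deriv f x (v + w) \<gamma> \<and> \<gamma> \<noteq> \<alpha> + \<beta>}" for v w
  have cq: "countable {q\<in>\<rat>. p < q}" for p :: real by (rule countable_subset[OF _ countable_rat]) auto
  have UN: "negligible (\<Union>i\<in>I. X i)" if "countable I" "\<And>i. i \<in> I \<Longrightarrow> negligible (X i)"
    for I :: "'i set" and X :: "'i \<Rightarrow> 'a set"
    by (rule negligible_countable_Union) (use that in auto)
  have "negligible G" unfolding G_def
    by (rule UN[OF countD], rule UN[OF countable_rat], rule UN[OF cq], rule negligible_slope_gap[OF lip]) simp
  moreover have "negligible (\<Union>v\<in>D. \<Union>w\<in>D. A v w)"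
    unfolding A_def by (rule UN[OF countD], rule UN[OF countD], rule negligible_dir_deriv_nonadditive[OF lip])
  ultimately have neg: "negligible (G \<union> (\<Union>v\<in>D. \<Union>w\<in>D. A v w))" by (rule negligible_Un)
  have "f differentiable (at x)" if x: "x \<notin> G \<union> (\<Union>v\<in>D. \<Union>w\<in>D. A v w)" for x
  proof -
    have "\<exists>l. has_dir_deriv f x v l" if "v \<in> D" for v
      by (rule has_dir_deriv_outside_gaps[OF lip]) (use x that in \<open>auto simp: G_def\<close>)
    then obtain T0 where T0: "\<And>v. v \<in> D \<Longrightarrow> has_dir_deriv f x v (T0 v)" by metis
    have uniq: "l = l'" if "has_dir_deriv f x v l" "has_dir_deriv f x v l'" for v l l'
      using that unfolding has_dir_deriv_def by (intro tendsto_unique[of "at (0::real)"]) auto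
    have add: "T0 (v + w) = T0 v + T0 w" if "v \<in> D" "w \<in> D" "v + w \<in> D" for v w
    proof -
      have "x \<notin> A v w" using x that by auto
      then show ?thesis using T0[OF that(1)] T0[OF that(2)] T0[OF that(3)] unfolding A_def by blast
    qed
    have scale: "T0 (c *\<^sub>R v) = c * T0 v" if "v \<in> D" "c *\<^sub>R v \<in> D" for c v
    proof (cases "c = 0")
      case True
      have "has_dir_deriv f x (c *\<^sub>R v) 0" using True by (simp add: has_dir_deriv_def)
      then show ?thesis using uniq[OF T0[OF that(2)]] True by simp
    next
      case False
      have lim: "filterlim (\<lambda>s. c * s) (at 0) (at (0::real))"
        by (rule filterlim_atI) (use False in \<open>auto intro!: tendsto_eq_intros simp: eventually_at_filter\<close>)
      have "((\<lambda>s. c * ((f (x + (c * s) *\<^sub>R v) - f x) / (c * s))) \<longlongrightarrow> c * T0 v) (at 0)"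
        by (intro tendsto_mult_left has_dir_deriv_along[OF T0[OF that(1)] lim])
      then have "has_dir_deriv f x (c *\<^sub>R v) (c * T0 v)"
        unfolding has_dir_deriv_def using False
        by (simp add: mult.commute)
      then show ?thesis using uniq[OF T0[OF that(2)]] by simp
    qed
    define T where "T v = (\<Sum>b\<in>Basis. (v \<bullet> b) * T0 b)" for v
    have linT: "linear T" unfolding T_def
      by (rule linearI) (auto simp: inner_add_left sum.distrib algebra_simps sum_distrib_left)
    have basD: "b \<in> D" if "b \<in> Basis" for b
      using inD[of "{b}" "\<lambda>_. 1"] that by simp
    have partial: "T0 (\<Sum>b\<in>B. q b *\<^sub>R b) = (\<Sum>b\<in>B. q b * T0 b)"
      if "finite B" "B \<subseteq> Basis" "\<And>b. b \<in> Basis \<Longrightarrow> q b \<in> \<rat>" for B q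
      using that(1,2)
    proof (induction B)
      case empty
      have "0 \<in> D" using inD[of "{}"] by simp
      then show ?case using scale[of 0 0] by simp
    next
      case (insert c B)
      have m: "q c *\<^sub>R c \<in> D" "(\<Sum>b\<in>B. q b *\<^sub>R b) \<in> D" "(\<Sum>b\<in>insert c B. q b *\<^sub>R b) \<in> D"
        using inD[of "{c}" q] inD[of B q] inD[of "insert c B" q] insert that(3) by auto
      have "T0 (q c *\<^sub>R c + (\<Sum>b\<in>B. q b *\<^sub>R b)) = T0 (q c *\<^sub>R c) + T0 (\<Sum>b\<in>B. q b *\<^sub>R b)"
        by (rule add) (use m insert in auto)
      then show ?case using insert scale[OF basD m(1)] by simp
    qed
    have dT: "has_dir_deriv f x v (T v)" if vD: "v \<in> D" for v
    proof -
      obtain q where q: "q \<in> PiE Basis (\<lambda>_. \<rat>)" "v = (\<Sum>b\<in>Basis. q b *\<^sub>R b)"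
        using vD unfolding D_def by (rule imageE)
      have "T0 v = (\<Sum>b\<in>Basis. q b * T0 b)"
        unfolding q(2) by (rule partial) (use q in auto)
      also have "\<dots> = T v" unfolding T_def by (rule sum.cong) (auto simp: q(2))
      finally show ?thesis using T0[OF vD] by simp
    qed
    obtain C where C: "0 < C" "\<And>h. norm (T h) \<le> C * norm h"
      using linear_bounded_pos[OF linT] by blast
    have "(f has_derivative T) (at x)"
      unfolding has_derivative_at_alt
    proof (intro conjI allI impI)
      show "bounded_linear T" using linT by (rule linear_linear[THEN iffD2])
      fix e :: real assume e: "0 < e"
      define \<epsilon> where "\<epsilon> = e / (L + C + 1)"
      have \<epsilon>: "0 < \<epsilon>" using e L C by (simp add: \<epsilon>_def)
      have \<epsilon>e: "L * \<epsilon> + C * \<epsilon> + \<epsilon> = e" 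
      proof -
        have "\<epsilon> * (L + C + 1) = e" using L C by (simp add: \<epsilon>_def)
        then show ?thesis by (simp add: algebra_simps)
      qed
      have "sphere 0 1 \<subseteq> (\<Union>v\<in>D. ball v \<epsilon>)"
        using denseD[OF \<epsilon>] by (force simp: dist_norm norm_minus_commute)
      then obtain V where V: "V \<subseteq> D" "finite V" "sphere 0 1 \<subseteq> (\<Union>v\<in>V. ball v \<epsilon>)"
        by (rule compactE_image[OF compact_sphere, rotated]) auto
      have "\<forall>\<^sub>F s in at 0. \<forall>v\<in>V. \<bar>(f (x + s *\<^sub>R v) - f x) / s - T v\<bar> < \<epsilon>"
      proof (rule eventually_ball_finite[OF V(2)], rule ballI)
        fix v assume "v \<in> V"
        then have "has_dir_deriv f x v (T v)" using dT V by blast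
        from tendstoD[OF this[unfolded has_dir_deriv_def] \<epsilon>]
        show "\<forall>\<^sub>F s in at 0. \<bar>(f (x + s *\<^sub>R v) - f x) / s - T v\<bar> < \<epsilon>" by (simp add: dist_real_def)
      qed
      then obtain d where d: "0 < d"
        "\<And>s v. s \<noteq> 0 \<Longrightarrow> \<bar>s\<bar> < d \<Longrightarrow> v \<in> V \<Longrightarrow> \<bar>(f (x + s *\<^sub>R v) - f x) / s - T v\<bar> < \<epsilon>"
        unfolding eventually_at by (auto simp: dist_real_def)
      show "\<exists>d>0. \<forall>y. norm (y - x) < d \<longrightarrow> norm (f y - f x - T (y - x)) \<le> e * norm (y - x)"
      proof (intro exI[of _ d] conjI allI impI d(1))
        fix y assume y: "norm (y - x) < d"
        show "norm (f y - f x - T (y - x)) \<le> e * norm (y - x)"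
        proof (cases "y = x")
          case True then show ?thesis using linear_0[OF linT] by simp
        next
          case False
          define s where "s = norm (y - x)"
          have s: "0 < s" using False by (simp add: s_def)
          define u where "u = (1 / s) *\<^sub>R (y - x)"
          have u: "norm u = 1" "y = x + s *\<^sub>R u" using s by (auto simp: u_def s_def)
          then obtain v where v: "v \<in> V" "norm (u - v) < \<epsilon>"
            using V(3) by (force simp: dist_norm norm_minus_commute)
          have 1: "\<bar>f (x + s *\<^sub>R u) - f (x + s *\<^sub>R v)\<bar> \<le> s * (L * \<epsilon>)"
          proof -
            have "\<bar>f (x + s *\<^sub>R u) - f (x + s *\<^sub>R v)\<bar> \<le> L * norm (s *\<^sub>R (u - v))"
              using fl[of "x + s *\<^sub>R u" "x + s *\<^sub>R v"] by (simp add: scaleR_diff_right)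
            also have "\<dots> \<le> L * (s * \<epsilon>)" using s v L by (intro mult_left_mono) auto
            finally show ?thesis by (simp add: mult_ac)
          qed
          have 2: "\<bar>T (s *\<^sub>R u) - T (s *\<^sub>R v)\<bar> \<le> s * (C * \<epsilon>)"
          proof -
            have "\<bar>T (s *\<^sub>R u) - T (s *\<^sub>R v)\<bar> \<le> C * norm (s *\<^sub>R (u - v))"
              using C(2)[of "s *\<^sub>R (u - v)"] linear_diff[OF linT, of "s *\<^sub>R u" "s *\<^sub>R v"] by (simp add: scaleR_diff_right)
            also have "\<dots> \<le> C * (s * \<epsilon>)" using s v C(1) by (intro mult_left_mono) auto
            finally show ?thesis by (simp add: mult_ac)
          qed
          have 3: "\<bar>f (x + s *\<^sub>R v) - f x - T (s *\<^sub>R v)\<bar> \<le> s * \<epsilon>"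
          proof -
            have "\<bar>(f (x + s *\<^sub>R v) - f x) / s - T v\<bar> < \<epsilon>" using d(2)[of s v] s y v by (simp add: s_def)
            then have "s * \<bar>(f (x + s *\<^sub>R v) - f x) / s - T v\<bar> \<le> s * \<epsilon>" using s by simp
            moreover have "s * ((f (x + s *\<^sub>R v) - f x) / s - T v) = f (x + s *\<^sub>R v) - f x - T (s *\<^sub>R v)"
              using s linear_scale[OF linT, of s v] by (simp add: field_simps)
            ultimately show ?thesis using s by (metis abs_mult abs_of_pos)
          qed
          have yx: "y - x = s *\<^sub>R u" using u by simp
          have "\<bar>f y - f x - T (y - x)\<bar> \<le> s * (L * \<epsilon>) + s * (C * \<epsilon>) + s * \<epsilon>"
            unfolding yx unfolding u(2) using 1 2 3 by linarith
          also have "\<dots> = e * s" unfolding \<epsilon>e[symmetric] by (simp add: algebra_simps)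
          finally show ?thesis by (simp add: s_def)
        qed
      qed
    qed
    then show ?thesis by (rule differentiableI)
  qed
  then have "{x. \<not> f differentiable (at x)} \<subseteq> G \<union> (\<Union>v\<in>D. \<Union>w\<in>D. A v w)" by blast
  then show ?thesis using neg negligible_subset by blast
qed

theorem rademacher:
  fixes f :: "'a::euclidean_space \<Rightarrow> 'b::euclidean_space"
  assumes lip: "L-lipschitz_on UNIV f"
  shows "negligible {x. \<not> f differentiable (at x)}"
proof -
  have L: "0 \<le> L" using lip by (rule lipschitz_on_nonneg)
  have "L-lipschitz_on UNIV (\<lambda>x. f x \<bullet> b)" if "b \<in> Basis" for b
  proof (rule lipschitz_onI[OF _ L])
    fix x y
    have "\<bar>(f x - f y) \<bullet> b\<bar> \<le> norm (f x - f y)" using that by (rule Basis_le_norm)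
    also have "\<dots> \<le> L * dist x y" using lipschitz_onD[OF lip, of x y] by (simp add: dist_norm)
    finally show "dist (f x \<bullet> b) (f y \<bullet> b) \<le> L * dist x y" by (simp add: dist_real_def inner_diff_left)
  qed
  then have "negligible (\<Union>b\<in>Basis. {x. \<not> (\<lambda>x. f x \<bullet> b) differentiable (at x)})"
    by (intro negligible_Union) (auto intro: negligible_nondifferentiable_scalar)
  moreover have "{x. \<not> f differentiable (at x)} \<subseteq> (\<Union>b\<in>Basis. {x. \<not> (\<lambda>x. f x \<bullet> b) differentiable (at x)})"
    using differentiable_componentwise_within[of f _ UNIV] by auto
  ultimately show ?thesis using negligible_subset by blast
qed

section \<open>Increments of Lipschitz functions along segments\<close>

text \<open>
  After subtraction of a linear function with slope slightly above \<open>K\<close> the claim is that \<open>g\<close> does not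
  increase. Otherwise some level \<open>c\<close> between \<open>g a\<close> and \<open>g b\<close> is not a value on the null set \<open>Z\<close>, since \<open>g ` Z\<close> is
  null. At the last point at which \<open>g\<close> does not exceed \<open>c\<close> the derivative exists and is negative, but
  \<open>g\<close> is larger than \<open>c\<close> to the right of it.
\<close>

lemma lipschitz_increment_le_null:
  fixes \<phi> :: "real \<Rightarrow> real"
  assumes lip: "L-lipschitz_on UNIV \<phi>" and Z: "negligible Z" and ab: "a \<le> b"
    and der: "\<And>s. \<lbrakk>a < s; s < b; s \<notin> Z\<rbrakk> \<Longrightarrow> \<exists>D\<le>K. (\<phi> has_real_derivative D) (at s)"
  shows "\<phi> b - \<phi> a \<le> K * (b - a)"
proof (rule ccontr)
  assume "\<not> ?thesis"
  then have gt: "K * (b - a) < \<phi> b - \<phi> a" by simp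
  then have "a < b" using ab by (cases "a = b") auto
  define \<delta> where "\<delta> = (\<phi> b - \<phi> a - K * (b - a)) / (2 * (b - a))"
  have \<delta>: "0 < \<delta>" using gt \<open>a < b\<close> by (simp add: \<delta>_def)
  define g where "g s = \<phi> s - (K + \<delta>) * s" for s
  have "\<delta> * (2 * (b - a)) = \<phi> b - \<phi> a - K * (b - a)"
    by (rule iffD1[OF nonzero_eq_divide_eq \<delta>_def]) (use \<open>a < b\<close> in simp)
  moreover have "0 < \<delta> * (b - a)" using \<delta> \<open>a < b\<close> by simp
  ultimately have gab: "g a < g b" using gt by (simp add: g_def algebra_simps)
  have "negligible (g ` Z)"
  proof (rule negligible_locally_Lipschitz_image[OF _ Z])
    fix x assume "x \<in> Z"
    have "norm (g y - g x) \<le> (L + \<bar>K + \<delta>\<bar>) * norm (y - x)" for y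
    proof -
      have "g y - g x = (\<phi> y - \<phi> x) - (K + \<delta>) * (y - x)" by (simp add: g_def algebra_simps)
      then have "\<bar>g y - g x\<bar> \<le> \<bar>\<phi> y - \<phi> x\<bar> + \<bar>K + \<delta>\<bar> * \<bar>y - x\<bar>" by (simp add: abs_mult[symmetric])
      also have "\<bar>\<phi> y - \<phi> x\<bar> \<le> L * \<bar>y - x\<bar>" using lipschitz_onD[OF lip, of y x] by (simp add: dist_real_def)
      finally show ?thesis by (simp add: algebra_simps)
    qed
    then show "\<exists>T B. open T \<and> x \<in> T \<and> (\<forall>y\<in>Z \<inter> T. norm (g y - g x) \<le> B * norm (y - x))"
      using open_UNIV by blast
  qed simp
  moreover have "\<not> negligible {g a<..<g b}" using gab open_not_negligible[of "{g a<..<g b}"] by simp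
  ultimately obtain c where c: "g a < c" "c < g b" "c \<notin> g ` Z"
    using negligible_subset[of "g ` Z" "{g a<..<g b}"] by force
  have contg: "continuous_on UNIV g" unfolding g_def
    by (intro continuous_intros lipschitz_on_continuous_on[OF lip])
  define A where "A = {s \<in> {a..b}. g s \<le> c}"
  have clA: "closed A"
  proof -
    have "A = {a..b} \<inter> {s. g s \<le> c}" by (auto simp: A_def)
    moreover have "closed {s. g s \<le> c}" by (intro closed_Collect_le contg continuous_intros)
    ultimately show ?thesis by (simp add: closed_Int)
  qed
  have Ane: "a \<in> A" and bddA: "bdd_above A" using c ab unfolding A_def by auto
  define s where "s = Sup A"
  have sA: "s \<in> A" unfolding s_def using clA Ane bddA by (intro closed_contains_Sup) auto
  have above: "c < g t" if "s < t" "t \<le> b" for t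
  proof (rule ccontr)
    assume "\<not> c < g t"
    then have "t \<in> A" using that sA by (auto simp: A_def)
    then show False using cSup_upper[OF _ bddA, of t] that by (simp add: s_def)
  qed
  have sb: "s < b" using sA c by (cases "s = b") (auto simp: A_def)
  have gs: "g s = c"
  proof (rule ccontr)
    assume "g s \<noteq> c"
    then have "g s < c" using sA by (simp add: A_def)
    then obtain t where "s \<le> t" "t \<le> b" "g t = (g s + c) / 2"
      using IVT'[of g s "(g s + c) / 2" b] c sb continuous_on_subset[OF contg] by auto
    then show False using above[of t] \<open>g s < c\<close> by (cases "t = s") auto
  qed
  have "a < s" using gs c sA by (cases "a = s") (auto simp: A_def)
  moreover have "s \<notin> Z" using gs c by auto
  ultimately obtain D where D: "D \<le> K" "(\<phi> has_real_derivative D) (at s)" using der sb by blast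
  have "(g has_real_derivative (D - (K + \<delta>))) (at s)"
    unfolding g_def by (auto intro!: derivative_eq_intros D)
  from DERIV_neg_dec_right[OF this] obtain d where d: "0 < d" "\<And>h. 0 < h \<Longrightarrow> h < d \<Longrightarrow> g (s + h) < g s"
    using D \<delta> by auto
  define h where "h = min (d / 2) (b - s)"
  have "0 < h" "h < d" "s + h \<le> b" using d sb by (auto simp: h_def)
  then show False using d(2)[of h] above[of "s + h"] gs by auto
qed

text \<open>
  The segment itself may consist of points of nondifferentiability. Almost every parallel translate
  meets the exceptional null set of Rademacher's theorem in a null set only, and the inequality
  passes to the limit of such translates.
\<close>

lemma lipschitz_increment_le:
  fixes f :: "'a::euclidean_space \<Rightarrow> 'b::euclidean_space"
  assumes lip: "L-lipschitz_on UNIV f" and U: "open U" and \<tau>: "0 \<le> \<tau>"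
    and seg: "\<And>s. \<lbrakk>0 \<le> s; s \<le> \<tau>\<rbrakk> \<Longrightarrow> a + s *\<^sub>R e \<in> U"
    and der: "\<And>x. \<lbrakk>x \<in> U; f differentiable (at x)\<rbrakk> \<Longrightarrow> w \<bullet> frechet_derivative f (at x) e \<le> K"
  shows "w \<bullet> (f (a + \<tau> *\<^sub>R e) - f a) \<le> K * \<tau>"
proof (rule field_le_epsilon)
  fix \<eta> :: real assume \<eta>: "0 < \<eta>"
  have L: "0 \<le> L" using lip by (rule lipschitz_on_nonneg)
  have fl: "norm (f x - f y) \<le> L * norm (x - y)" for x y
    using lipschitz_onD[OF lip] by (simp add: dist_norm)
  define S where "S = (\<lambda>s. a + s *\<^sub>R e) ` {0..\<tau>}"
  have "compact S" unfolding S_def by (intro compact_continuous_image continuous_intros) auto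
  moreover have "S \<subseteq> U" using seg by (auto simp: S_def)
  ultimately obtain \<delta> where \<delta>: "0 < \<delta>" "(\<Union>x\<in>S. ball x \<delta>) \<subseteq> U"
    using compact_subset_open_imp_ball_epsilon_subset[OF _ U] by blast
  \<comment> \<open>A translation by less than \<open>\<epsilon>\<close> keeps the segment in \<open>U\<close> and changes both end values by at most \<open>\<eta> / 2\<close>.\<close>
  define \<epsilon> where "\<epsilon> = min \<delta> (\<eta> / (2 * L * norm w + 1))"
  have \<epsilon>: "0 < \<epsilon>" using \<delta> \<eta> L by (auto simp: \<epsilon>_def intro!: divide_pos_pos add_nonneg_pos mult_nonneg_nonneg)
  have "AE x in lborel. negligible {s::real. x + s *\<^sub>R e \<in> {x. \<not> f differentiable (at x)}}"
    by (rule AE_negligible_line_sections[OF rademacher[OF lip]])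
  then obtain Y where Y: "{x \<in> space lborel. \<not> negligible {s::real. x + s *\<^sub>R e \<in> {x. \<not> f differentiable (at x)}}} \<subseteq> Y"
    "emeasure lborel Y = 0" "Y \<in> sets lborel" by (rule AE_E)
  have "negligible Y" using Y by (simp add: negligible_iff_emeasure0)
  moreover have "\<not> negligible (ball a \<epsilon>)" using \<epsilon> by (simp add: open_not_negligible)
  ultimately obtain x where x: "x \<in> ball a \<epsilon>" "x \<notin> Y" using negligible_subset by blast
  define Z where "Z = {s::real. x + s *\<^sub>R e \<in> {x. \<not> f differentiable (at x)}}"
  have Z: "negligible Z" using x Y unfolding Z_def by auto
  define \<phi> where "\<phi> s = w \<bullet> f (x + s *\<^sub>R e)" for s
  have \<phi>lip: "(norm w * L * norm e)-lipschitz_on UNIV \<phi>"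
  proof (rule lipschitz_onI)
    fix s t :: real
    have "\<bar>\<phi> s - \<phi> t\<bar> \<le> norm w * norm (f (x + s *\<^sub>R e) - f (x + t *\<^sub>R e))"
      unfolding \<phi>_def inner_diff_right[symmetric] by (rule Cauchy_Schwarz_ineq2)
    also have "\<dots> \<le> norm w * (L * norm ((s - t) *\<^sub>R e))"
      using fl[of "x + s *\<^sub>R e" "x + t *\<^sub>R e"] by (intro mult_left_mono) (auto simp: scaleR_left_diff_distrib)
    finally show "dist (\<phi> s) (\<phi> t) \<le> norm w * L * norm e * dist s t" by (simp add: dist_real_def mult_ac)
  qed (use L in simp)
  have "\<phi> \<tau> - \<phi> 0 \<le> K * (\<tau> - 0)"
  proof (rule lipschitz_increment_le_null[OF \<phi>lip Z \<tau>])
    fix s assume s: "0 < s" "s < \<tau>" "s \<notin> Z"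
    define z where "z = x + s *\<^sub>R e"
    have dz: "f differentiable (at z)" using s by (simp add: Z_def z_def)
    have "z \<in> ball (a + s *\<^sub>R e) \<delta>" using x by (auto simp: z_def \<epsilon>_def dist_norm)
    then have zU: "z \<in> U" using \<delta> s unfolding S_def by force
    define f' where "f' = frechet_derivative f (at z)"
    have f': "(f has_derivative f') (at z)" using dz by (simp add: f'_def frechet_derivative_works)
    have "((\<lambda>s. x + s *\<^sub>R e) has_derivative (\<lambda>h. h *\<^sub>R e)) (at s)"
      by (auto intro!: derivative_eq_intros)
    then have "((\<lambda>s. f (x + s *\<^sub>R e)) has_derivative (\<lambda>h. f' (h *\<^sub>R e))) (at s)"
      using diff_chain_at[of "\<lambda>s. x + s *\<^sub>R e" _ s f f'] f' by (simp add: o_def z_def)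
    then have "(\<phi> has_derivative (\<lambda>h. w \<bullet> f' (h *\<^sub>R e))) (at s)"
      unfolding \<phi>_def by (rule has_derivative_inner_right)
    moreover have "w \<bullet> f' (h *\<^sub>R e) = (w \<bullet> f' e) * h" for h
      using linear_scale[OF has_derivative_linear[OF f']] by simp
    ultimately have "(\<phi> has_real_derivative (w \<bullet> f' e)) (at s)"
      by (simp add: has_field_derivative_def)
    then show "\<exists>D\<le>K. (\<phi> has_real_derivative D) (at s)" using der[OF zU dz] unfolding f'_def by blast
  qed
  then have 1: "w \<bullet> (f (x + \<tau> *\<^sub>R e) - f x) \<le> K * \<tau>" by (simp add: \<phi>_def inner_diff_right)
  have d: "\<bar>w \<bullet> (f (a + y) - f (x + y))\<bar> \<le> norm w * (L * \<epsilon>)" for y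
  proof -
    have "\<bar>w \<bullet> (f (a + y) - f (x + y))\<bar> \<le> norm w * norm (f (a + y) - f (x + y))" by (rule Cauchy_Schwarz_ineq2)
    also have "norm (f (a + y) - f (x + y)) \<le> L * norm (a - x)" using fl[of "a + y" "x + y"] by simp
    also have "norm (a - x) \<le> \<epsilon>" using x by (simp add: dist_norm)
    finally show ?thesis using L by (simp add: mult_left_mono)
  qed
  have "(2 * L * norm w + 1) * \<epsilon> \<le> (2 * L * norm w + 1) * (\<eta> / (2 * L * norm w + 1))"
    unfolding \<epsilon>_def using L by (intro mult_left_mono) auto
  also have "\<dots> = \<eta>" using L by (smt (verit) mult_nonneg_nonneg nonzero_mult_div_cancel_left norm_ge_zero times_divide_eq_right)
  finally have "2 * (norm w * (L * \<epsilon>)) \<le> \<eta>" using \<epsilon> by (simp add: algebra_simps)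
  then show "w \<bullet> (f (a + \<tau> *\<^sub>R e) - f a) \<le> K * \<tau> + \<eta>"
    using 1 d[of "\<tau> *\<^sub>R e"] d[of 0] by (simp add: inner_diff_right abs_le_iff)
qed

section \<open>Norms, dual norms and operator norms\<close>

locale vnorm =
  fixes N :: "'a::euclidean_space \<Rightarrow> real"
  assumes is_norm: "is_norm N"
begin

lemma eq0: "N x = 0 \<longleftrightarrow> x = 0"
  using is_norm unfolding is_norm_def by blast

lemma triangle: "N (x + y) \<le> N x + N y"
  using is_norm unfolding is_norm_def by blast

lemma scale: "N (c *\<^sub>R x) = \<bar>c\<bar> * N x"
  using is_norm unfolding is_norm_def by blast

lemma zero [simp]: "N 0 = 0"
  by (simp add: eq0)

lemma minus [simp]: "N (- x) = N x"
  using scale[of "-1" x] by simp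

lemma nonneg [simp]: "0 \<le> N x"
  using triangle[of x "-x"] by simp

lemma pos: "x \<noteq> 0 \<Longrightarrow> 0 < N x"
  using nonneg[of x] eq0[of x] by linarith

lemma minus_commute: "N (x - y) = N (y - x)"
  using minus[of "x - y"] by simp

lemma triangle_diff: "N (x - z) \<le> N (x - y) + N (y - z)"
  using triangle[of "x - y" "y - z"] by simp

lemma reverse_triangle: "\<bar>N x - N y\<bar> \<le> N (x - y)"
  using triangle[of "x - y" y] triangle[of "y - x" x] minus_commute[of x y] by simp

lemma sum_le: "finite A \<Longrightarrow> N (sum f A) \<le> (\<Sum>a\<in>A. N (f a))"
proof (induction A rule: finite_induct)
  case (insert a A)
  then show ?case using triangle[of "f a" "sum f A"] by simp
qed simp

lemma upper: obtains C where "0 < C" "\<And>x. N x \<le> C * norm x"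
proof
  define C where "C = (\<Sum>b\<in>Basis. N b) + 1"
  have S: "0 \<le> (\<Sum>b\<in>Basis. N b)" by (simp add: sum_nonneg)
  then show "0 < C" by (simp add: C_def)
  fix x
  have "N x = N (\<Sum>b\<in>Basis. (x \<bullet> b) *\<^sub>R b)" by (simp add: euclidean_representation)
  also have "\<dots> \<le> (\<Sum>b\<in>Basis. N ((x \<bullet> b) *\<^sub>R b))" by (rule sum_le) simp
  also have "\<dots> \<le> (\<Sum>b\<in>Basis. norm x * N b)"
    by (intro sum_mono) (auto simp: scale intro!: mult_right_mono Basis_le_norm)
  also have "\<dots> = norm x * (\<Sum>b\<in>Basis. N b)" by (simp add: sum_distrib_left)
  also have "\<dots> \<le> C * norm x" by (simp add: C_def algebra_simps)
  finally show "N x \<le> C * norm x" .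
qed

lemma tendsto: assumes "(f \<longlongrightarrow> l) F" shows "((\<lambda>x. N (f x)) \<longlongrightarrow> N l) F"
proof -
  obtain C where C: "0 < C" "\<And>x. N x \<le> C * norm x" using upper by blast
  have "((\<lambda>x. C * norm (f x - l)) \<longlongrightarrow> C * norm (l - l)) F"
    by (intro tendsto_intros assms)
  then have lim: "((\<lambda>x. C * norm (f x - l)) \<longlongrightarrow> 0) F" by simp
  have "((\<lambda>x. N (f x) - N l) \<longlongrightarrow> 0) F"
  proof (rule Lim_null_comparison[OF always_eventually lim], rule allI)
    fix x show "norm (N (f x) - N l) \<le> C * norm (f x - l)"
      using reverse_triangle[of "f x" l] C(2)[of "f x - l"] by simp
  qed
  then show ?thesis by (rule LIM_zero_cancel)
qed

lemma continuous_on: "continuous_on S N"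
  unfolding continuous_on_def by (auto intro!: tendsto)

lemma lower: obtains c where "0 < c" "\<And>x. norm x \<le> c * N x"
proof -
  have ne: "sphere (0::'a) 1 \<noteq> {}" by (simp add: sphere_eq_empty)
  obtain z where z: "z \<in> sphere 0 1" "\<And>x. x \<in> sphere 0 1 \<Longrightarrow> N z \<le> N x"
    using continuous_attains_inf[OF compact_sphere ne continuous_on] by blast
  have Nz: "0 < N z" using z by (intro pos) auto
  show ?thesis
  proof
    show "0 < 1 / N z" using Nz by simp
    fix x :: 'a
    show "norm x \<le> 1 / N z * N x"
    proof (cases "x = 0")
      case False
      have "N z \<le> N ((1 / norm x) *\<^sub>R x)" by (rule z) (use False in simp)
      then show ?thesis using False Nz by (simp add: scale field_simps)
    qed simp
  qed
qed

lemma compact_unit_ball: "compact {x. N x \<le> 1}"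
proof -
  obtain c where c: "0 < c" "\<And>x. norm x \<le> c * N x" using lower by blast
  have "bounded {x. N x \<le> 1}"
    unfolding bounded_iff
  proof (intro exI ballI)
    fix x assume "x \<in> {x. N x \<le> 1}"
    then have "c * N x \<le> c * 1" using c by (intro mult_left_mono) auto
    then show "norm x \<le> c" using c(2)[of x] by linarith
  qed
  moreover have "closed {x. N x \<le> 1}"
    by (intro closed_Collect_le continuous_on continuous_intros)
  ultimately show ?thesis by (simp add: compact_eq_bounded_closed)
qed

lemma dual_attained: obtains e where "N e \<le> 1" "v \<bullet> e = dual_norm N v"
proof -
  have "{x. N x \<le> 1} \<noteq> {}" using zero by (metis (mono_tags) empty_iff mem_Collect_eq zero_le_one)
  moreover have "continuous_on {x. N x \<le> 1} (\<lambda>x. v \<bullet> x)" by (intro continuous_intros)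
  ultimately obtain e where e: "e \<in> {x. N x \<le> 1}" "\<And>x. x \<in> {x. N x \<le> 1} \<Longrightarrow> v \<bullet> x \<le> v \<bullet> e"
    using continuous_attains_sup[OF compact_unit_ball] by blast
  have "dual_norm N v = v \<bullet> e" unfolding dual_norm_def
    by (rule cSup_eq_maximum) (use e in auto)
  then show ?thesis using that[of e] e by simp
qed

lemma inner_le_dual: "v \<bullet> x \<le> dual_norm N v * N x"
proof (cases "x = 0")
  case False
  then have Nx: "0 < N x" by (rule pos)
  have "bdd_above ((\<lambda>x. v \<bullet> x) ` {x. N x \<le> 1})"
    by (intro bounded_imp_bdd_above compact_imp_bounded compact_continuous_image
        continuous_intros compact_unit_ball)
  then have "v \<bullet> ((1 / N x) *\<^sub>R x) \<le> dual_norm N v"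
    unfolding dual_norm_def by (rule cSUP_upper[rotated]) (use Nx in \<open>simp add: scale\<close>)
  then show ?thesis using Nx by (simp add: field_simps)
qed simp

lemma dual_le:
  assumes "0 \<le> K" "\<And>x. v \<bullet> x \<le> K * N x"
  shows "dual_norm N v \<le> K"
proof -
  obtain e where e: "N e \<le> 1" "v \<bullet> e = dual_norm N v" using dual_attained by blast
  then show ?thesis using assms(2)[of e] mult_left_mono[OF e(1) assms(1)] by simp
qed

lemma dual_pos: assumes "v \<noteq> 0" shows "0 < dual_norm N v"
proof -
  have "0 < v \<bullet> v" using assms by simp
  then have "0 < dual_norm N v * N v" using inner_le_dual[of v v] by linarith
  then show ?thesis using nonneg[of v] by (simp add: zero_less_mult_iff)
qed

lemma dual_nonneg: "0 \<le> dual_norm N v"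
proof (cases "v = 0")
  case True
  obtain e where "v \<bullet> e = dual_norm N v" using dual_attained by blast
  then show ?thesis using True by simp
qed (simp add: dual_pos less_imp_le)

lemma dual_scale: assumes c: "0 < c" shows "dual_norm N (c *\<^sub>R v) = c * dual_norm N v"
proof (rule antisym)
  show "dual_norm N (c *\<^sub>R v) \<le> c * dual_norm N v"
    by (rule dual_le) (use c inner_le_dual[of v] dual_nonneg in \<open>auto simp: mult.assoc\<close>)
  have "dual_norm N v \<le> dual_norm N (c *\<^sub>R v) / c"
  proof (rule dual_le)
    fix x show "v \<bullet> x \<le> dual_norm N (c *\<^sub>R v) / c * N x"
      using inner_le_dual[of "c *\<^sub>R v" x] c by (simp add: field_simps)
  qed (use c dual_nonneg in simp)
  then show "c * dual_norm N v \<le> dual_norm N (c *\<^sub>R v)" using c by (simp add: field_simps)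
qed

end

lemma op_norm_upper:
  fixes N :: "real ^ 'n \<Rightarrow> real" and M :: "real ^ 'm \<Rightarrow> real"
  assumes "is_norm N" "is_norm M"
  shows "M (B *v x) \<le> op_norm N M B * N x"
proof -
  interpret N: vnorm N by standard fact
  interpret M: vnorm M by standard fact
  show ?thesis
  proof (cases "x = 0")
    case False
    then have Nx: "0 < N x" by (rule N.pos)
    have "continuous_on {x. N x \<le> 1} (\<lambda>x. M (B *v x))"
      using continuous_on_compose2[OF M.continuous_on[of UNIV] matrix_vector_mult_linear_continuous_on] by auto
    then have "bdd_above ((\<lambda>x. M (B *v x)) ` {x. N x \<le> 1})"
      by (intro bounded_imp_bdd_above compact_imp_bounded compact_continuous_image N.compact_unit_ball)
    then have "M (B *v ((1 / N x) *\<^sub>R x)) \<le> op_norm N M B"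
      unfolding op_norm_def by (rule cSUP_upper[rotated]) (use Nx in \<open>simp add: N.scale\<close>)
    then show ?thesis using Nx by (simp add: matrix_vector_mult_scaleR M.scale field_simps)
  qed simp
qed

lemma op_norm_le:
  fixes N :: "real ^ 'n \<Rightarrow> real" and M :: "real ^ 'm \<Rightarrow> real"
  assumes "is_norm N" "0 \<le> K" "\<And>x. M (B *v x) \<le> K * N x"
  shows "op_norm N M B \<le> K"
  unfolding op_norm_def
proof (rule cSUP_least)
  interpret N: vnorm N by standard fact
  show "{x. N x \<le> 1} \<noteq> {}" using N.zero by (metis (mono_tags) empty_iff mem_Collect_eq zero_le_one)
  fix x assume "x \<in> {x. N x \<le> 1}"
  then show "M (B *v x) \<le> K" using assms(3)[of x] mult_left_mono[of "N x" 1 K] assms(2) by simp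
qed

lemma op_norm_nonneg:
  fixes N :: "real ^ 'n \<Rightarrow> real" and M :: "real ^ 'm \<Rightarrow> real"
  assumes "is_norm N" "is_norm M"
  shows "0 \<le> op_norm N M B"
proof -
  interpret N: vnorm N by standard fact
  interpret M: vnorm M by standard fact
  obtain b :: "real ^ 'n" where "b \<noteq> 0" using vector_one_nth by (metis zero_index zero_neq_one)
  then have "0 < N b" by (rule N.pos)
  moreover have "0 \<le> op_norm N M B * N b" using op_norm_upper[OF assms, of B b] M.nonneg order_trans by blast
  ultimately show ?thesis by (simp add: zero_le_mult_iff)
qed

section \<open>Normal cones\<close>

text \<open>
  A quadratic error is of smaller order along every tangent direction. In this form the first-order
  condition at a constrained minimiser needs no derivative of the objective, only a quadratic upper
  bound.
\<close>

lemma proximal_imp_normal: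
  fixes A :: "'a::euclidean_space set"
  assumes z: "z \<in> A" and K: "\<And>z'. z' \<in> A \<Longrightarrow> \<zeta> \<bullet> (z' - z) \<le> K * (norm (z' - z))\<^sup>2"
  shows "\<zeta> \<in> normal_cone A z"
proof -
  have "\<zeta> \<bullet> w \<le> 0" if wT: "w \<in> tangent_cone A z" for w
  proof -
    obtain ws t where w: "ws \<longlonglongrightarrow> w" "\<And>i. (0::real) < t i" "t \<longlonglongrightarrow> 0" "\<And>i. z + t i *\<^sub>R ws i \<in> A"
      using wT unfolding tangent_cone_def by blast
    have "\<zeta> \<bullet> ws i \<le> K * t i * (norm (ws i))\<^sup>2" for i
    proof -
      have "t i * (\<zeta> \<bullet> ws i) \<le> t i * (K * t i * (norm (ws i))\<^sup>2)"
        using K[OF w(4)[of i]] w(2)[of i] by (simp add: power2_eq_square mult_ac)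
      then show ?thesis using w(2)[of i] by (simp add: mult_le_cancel_left_pos)
    qed
    moreover have "(\<lambda>i. K * t i * (norm (ws i))\<^sup>2) \<longlonglongrightarrow> K * 0 * (norm w)\<^sup>2"
      by (intro tendsto_intros w)
    moreover have "(\<lambda>i. \<zeta> \<bullet> ws i) \<longlonglongrightarrow> \<zeta> \<bullet> w" by (intro tendsto_intros w)
    ultimately have "\<zeta> \<bullet> w \<le> K * 0 * (norm w)\<^sup>2"
      by (intro LIMSEQ_le[of "\<lambda>i. \<zeta> \<bullet> ws i" _ "\<lambda>i. K * t i * (norm (ws i))\<^sup>2"]) auto
    then show ?thesis by simp
  qed
  then show ?thesis using z by (simp add: normal_cone_def)
qed

lemma normal_cone_scale:
  assumes "\<zeta> \<in> normal_cone A z" "0 \<le> c"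
  shows "c *\<^sub>R \<zeta> \<in> normal_cone A z"
  using assms by (auto simp: normal_cone_def mult_nonneg_nonpos split: if_splits)

lemma primal_dual_derivative_scale:
  assumes "(u', v) \<in> primal_dual_derivative F x y u v'" "0 \<le> c"
  shows "(c *\<^sub>R u', v) \<in> primal_dual_derivative F x y u (c *\<^sub>R v')"
proof -
  obtain t ws zs where h: "\<forall>i. (0::real) < t i" "t \<longlonglongrightarrow> 0" "ws \<longlonglongrightarrow> (u, v)" "zs \<longlonglongrightarrow> (u', - v')"
    "\<forall>i::nat. zs i \<in> normal_cone (gph F) ((x, y) + t i *\<^sub>R ws i)"
    using assms(1) unfolding primal_dual_derivative_def dir_lim_normal_cone_def by blast
  have "(\<lambda>i. c *\<^sub>R zs i) \<longlonglongrightarrow> c *\<^sub>R (u', - v')" by (intro tendsto_intros h)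
  moreover have "\<forall>i::nat. c *\<^sub>R zs i \<in> normal_cone (gph F) ((x, y) + t i *\<^sub>R ws i)"
    using h(5) normal_cone_scale assms(2) by blast
  ultimately show ?thesis using h(1-3)
    unfolding primal_dual_derivative_def dir_lim_normal_cone_def scaleR_Pair scaleR_minus_right
    by blast
qed

section \<open>Approximate normals where subregularity fails\<close>

text \<open>
  Subregularity fails with every constant, so the residual can be made smaller than any multiple of
  a positive lower bound \<open>d\<close> for the distance to the solution set. The constants that compare the
  norms are absorbed by the choice of \<open>\<kappa>\<close>.
\<close>

lemma not_subregular_witness:
  fixes N :: "'a::euclidean_space \<Rightarrow> real" and M :: "'b::euclidean_space \<Rightarrow> real"
  assumes "is_norm N" "is_norm M" and y0: "y0 \<in> G x0"
    and nsr: "\<not> metrically_subregular N M G x0 y0" and \<delta>: "0 < \<delta>"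
  obtains x y d where "norm (x - x0) < \<delta>" "y \<in> G x" "0 < d" "norm (y - y0) < \<delta> * d"
    "\<And>s. y0 \<in> G s \<Longrightarrow> d \<le> norm (x - s)"
proof -
  interpret N: vnorm N by standard fact
  interpret M: vnorm M by standard fact
  obtain C where C: "0 < C" "\<And>x. N x \<le> C * norm x" using N.upper by blast
  obtain c where c: "0 < c" "\<And>x. norm x \<le> c * M x" using M.lower by blast
  define \<kappa> where "\<kappa> = c * C / \<delta>"
  have \<kappa>: "0 < \<kappa>" using C c \<delta> by (simp add: \<kappa>_def)
  have "(x0, y0) \<in> gph G" using y0 by (simp add: gph_def)
  with nsr have "\<not> (\<exists>U. open U \<and> x0 \<in> U \<and>
        (\<forall>x\<in>U. norm_dist N x {x. y0 \<in> G x} \<le> ereal \<kappa> * norm_dist M y0 (G x)))"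
    using \<kappa> unfolding metrically_subregular_def by (meson less_imp_le)
  then obtain x where x: "x \<in> ball x0 \<delta>"
    "ereal \<kappa> * norm_dist M y0 (G x) < norm_dist N x {x. y0 \<in> G x}"
    using open_ball centre_in_ball \<delta> by (metis not_le)
  have "norm_dist M y0 (G x) < norm_dist N x {x. y0 \<in> G x} / ereal \<kappa>"
    using x(2) \<kappa> by (simp add: ereal_less_divide_pos)
  then obtain y where y: "y \<in> G x" "ereal (M (y0 - y)) < norm_dist N x {x. y0 \<in> G x} / ereal \<kappa>"
    unfolding norm_dist_def[of M] by (auto simp: INF_less_iff)
  then have "ereal (\<kappa> * M (y0 - y)) < norm_dist N x {x. y0 \<in> G x}"
    using \<kappa> by (simp add: ereal_less_divide_pos)
  then obtain T where T: "\<kappa> * M (y0 - y) < T" "ereal T < norm_dist N x {x. y0 \<in> G x}"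
    using ereal_dense2 by (metis ereal_less_ereal_Ex less_ereal.simps(1))
  have "0 \<le> \<kappa> * M (y0 - y)" using \<kappa> by simp
  then have Tpos: "0 < T" using T by linarith
  have TN: "T \<le> N (x - s)" if "y0 \<in> G s" for s
  proof -
    have "norm_dist N x {x. y0 \<in> G x} \<le> ereal (N (x - s))"
      unfolding norm_dist_def by (rule INF_lower) (use that in simp)
    then show ?thesis using T(2) by (metis ereal_less_eq(3) less_imp_le order_trans)
  qed
  show thesis
  proof (rule that[of x y "T / C"])
    show "norm (x - x0) < \<delta>" using x by (simp add: dist_norm norm_minus_commute)
    show "y \<in> G x" by fact
    show "0 < T / C" using Tpos C by simp
    have "norm (y - y0) \<le> c * M (y0 - y)" using c(2)[of "y - y0"] M.minus_commute[of y y0] by simp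
    also have "\<dots> < c * (T / \<kappa>)" using T(1) c \<kappa> by (simp add: field_simps)
    also have "\<dots> = \<delta> * (T / C)" using c C \<delta> by (simp add: \<kappa>_def field_simps)
    finally show "norm (y - y0) < \<delta> * (T / C)" .
    fix s assume "y0 \<in> G s"
    then have "T \<le> C * norm (x - s)" using TN C(2) order_trans by blast
    then show "T / C \<le> norm (x - s)" using C by (simp add: field_simps)
  qed
qed

text \<open>
  The quadratic upper bound for the Euclidean norm away from the origin, from
  \<open>2 * norm a * norm (a + d) \<le> (norm a)\<^sup>2 + (norm (a + d))\<^sup>2\<close>.
\<close>

lemma norm_le_tangent:
  fixes a d :: "'a::real_inner"
  assumes "a \<noteq> 0"
  shows "norm (a + d) - norm a \<le> (a /\<^sub>R norm a) \<bullet> d + (norm d)\<^sup>2 / (2 * norm a)"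
proof -
  have na: "0 < norm a" using assms by simp
  have "2 * norm a * norm (a + d) \<le> (norm (a + d))\<^sup>2 + (norm a)\<^sup>2"
    using zero_le_power2[of "norm (a + d) - norm a"] by (simp add: power2_eq_square algebra_simps)
  also have "(norm (a + d))\<^sup>2 = (norm a)\<^sup>2 + 2 * (a \<bullet> d) + (norm d)\<^sup>2"
    by (simp add: power2_norm_eq_inner inner_add_left inner_add_right inner_commute)
  finally have *: "2 * norm a * (norm (a + d) - norm a) \<le> 2 * (a \<bullet> d) + (norm d)\<^sup>2"
    by (simp add: power2_eq_square algebra_simps)
  have "norm (a + d) - norm a = (2 * norm a * (norm (a + d) - norm a)) / (2 * norm a)" using na by simp
  also have "\<dots> \<le> (2 * (a \<bullet> d) + (norm d)\<^sup>2) / (2 * norm a)" using * na by (intro divide_right_mono) auto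
  also have "\<dots> = (a /\<^sub>R norm a) \<bullet> d + (norm d)\<^sup>2 / (2 * norm a)"
    using na by (simp add: field_simps)
  finally show ?thesis .
qed

lemma eventually_ray_in_open:
  fixes p e :: "'a::real_normed_vector"
  assumes "open U" "p \<in> U"
  shows "\<forall>\<^sub>F \<tau> in at_right 0. p + \<tau> *\<^sub>R e \<in> U"
proof -
  have "((\<lambda>\<tau>. p + \<tau> *\<^sub>R e) \<longlongrightarrow> p + 0 *\<^sub>R e) (at_right 0)" by (intro tendsto_intros)
  from topological_tendstoD[OF this assms(1)] show ?thesis using assms(2) by simp
qed

text \<open>
  Let \<open>x1\<close> have residual below \<open>\<delta>\<^sup>2 * d\<close>, where no solution is closer to \<open>x1\<close> than \<open>d\<close>. The function
  \<open>\<Phi> ((x, y), p) = norm (y + h p - y0) + \<delta> * norm (p - x1) + \<rho> / 2 * (norm (x - p))\<^sup>2\<close> is minimised over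
  \<open>gph F\<close> times a ball. Its value is below \<open>\<delta>\<^sup>2 * d\<close>, so the minimiser has \<open>p\<close> within \<open>\<delta> * d\<close> of \<open>x1\<close>, and
  for large \<open>\<rho>\<close> also \<open>x\<close> is so close to \<open>p\<close> that the residual \<open>a\<close> cannot vanish. Therefore the norm is
  smooth at \<open>a\<close>; optimality in \<open>(x, y)\<close> gives the normal vector with \<open>v' = a / norm a\<close> and
  \<open>u' = \<rho> (p - x)\<close>, and optimality in \<open>p\<close> gives the last condition. Since \<open>d \<le> norm (x1 - x0)\<close>, all
  displacements are small compared with the distance to \<open>x0\<close>.
\<close>

lemma nonsubregular_approximation:
  fixes F :: "'a::euclidean_space \<Rightarrow> 'b::euclidean_space set" and N :: "'a \<Rightarrow> real" and M :: "'b \<Rightarrow> real"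
  assumes N: "is_norm N" and M: "is_norm M" and clF: "closed (gph F)" and F0: "(x0, y0) \<in> gph F"
    and r: "0 < r" and lip: "L-lipschitz_on (cball x0 r) h" and h0: "h x0 = 0"
    and nsr: "\<not> metrically_subregular N M (\<lambda>x. (\<lambda>y. y + h x) ` F x) x0 y0" and \<epsilon>: "0 < \<epsilon>"
  shows "\<exists>x y p u' v'. x \<noteq> x0 \<and> norm (x - x0) < \<epsilon> \<and> norm (x - p) \<le> \<epsilon> * norm (x - x0) \<and>
    norm (y - y0 + h p) \<le> \<epsilon> * norm (x - x0) \<and> norm v' = 1 \<and> norm (p - x0) < r \<and>
    (u', - v') \<in> normal_cone (gph F) (x, y) \<and>
    (\<forall>e. \<forall>\<eta>>0. \<forall>\<^sub>F \<tau> in at_right 0.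
       - ((\<epsilon> * norm e + \<eta>) * \<tau>) \<le> \<tau> * (u' \<bullet> e) + v' \<bullet> (h (p + \<tau> *\<^sub>R e) - h p))"
proof -
  define \<delta> where "\<delta> = Min {\<epsilon> / 4, 1 / 4, r / 4}"
  have \<delta>: "0 < \<delta>" "\<delta> \<le> \<epsilon> / 4" "\<delta> \<le> 1 / 4" "\<delta> \<le> r / 4" using \<epsilon> r by (auto simp: \<delta>_def)
  have \<delta>2: "\<delta>\<^sup>2 \<le> \<delta>" using \<delta> by (simp add: power2_eq_square mult_left_le_one_le)
  have \<delta>2': "0 < \<delta>\<^sup>2" using \<delta> by simp
  have y0G: "y0 \<in> (\<lambda>y. y + h x0) ` F x0" using F0 h0 by (auto simp: gph_def)
  obtain x1 b d where w: "norm (x1 - x0) < \<delta>\<^sup>2" "b \<in> (\<lambda>y. y + h x1) ` F x1" "0 < d" "norm (b - y0) < \<delta>\<^sup>2 * d"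
    "\<And>s. y0 \<in> (\<lambda>y. y + h s) ` F s \<Longrightarrow> d \<le> norm (x1 - s)"
    by (rule not_subregular_witness[OF N M _ nsr \<delta>2', OF y0G]) blast
  obtain y1 where y1: "y1 \<in> F x1" "b = y1 + h x1" using w(2) by blast
  define m where "m = norm (y1 + h x1 - y0)"
  have m: "m < \<delta>\<^sup>2 * d" using w(4) y1 by (simp add: m_def)
  define D where "D = norm (x1 - x0)"
  have dD: "d \<le> D" using w(5)[OF y0G] by (simp add: D_def)
  have D: "0 < D" "D < \<delta>" using dD w \<delta>2 by (auto simp: D_def)
  have \<delta>d: "\<delta> * d \<le> D / 4"
  proof -
    have "\<delta> * d \<le> 1 / 4 * d" using \<delta>(3) w(3) by (intro mult_right_mono) auto
    then show ?thesis using dD by simp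
  qed
  have \<delta>d0: "0 < \<delta> * d" using \<delta> w by simp
  have conth: "continuous_on (cball x0 r) h" using lip by (rule lipschitz_on_continuous_on)
  have subr: "cball x1 (\<delta> * d) \<subseteq> ball x0 r"
  proof
    fix p assume "p \<in> cball x1 (\<delta> * d)"
    then have "dist x0 p \<le> D + \<delta> * d" using dist_triangle[of x0 p x1] by (simp add: D_def dist_norm norm_minus_commute)
    then show "p \<in> ball x0 r" using \<delta>d D \<delta> r by simp
  qed
  \<comment> \<open>Points of the graph over a neighbourhood of \<open>p\<close> cannot cancel \<open>h p - y0\<close> exactly: otherwise closedness
    of the graph would give a solution within \<open>\<delta> * d < d\<close> of \<open>x1\<close>.\<close>
  have "\<exists>\<eta>>0. \<forall>x y p. y \<in> F x \<longrightarrow> p \<in> cball x1 (\<delta> * d) \<longrightarrow> norm (x - p) < \<eta> \<longrightarrow> y + h p \<noteq> y0"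
  proof (rule ccontr)
    assume "\<not> ?thesis"
    then have "\<forall>n::nat. \<exists>x p. y0 - h p \<in> F x \<and> p \<in> cball x1 (\<delta> * d) \<and> norm (x - p) < 1 / Suc n"
      by (metis add_diff_cancel_right' of_nat_0_less_iff zero_less_Suc zero_less_divide_1_iff)
    then obtain X P where XP: "\<And>n. y0 - h (P n) \<in> F (X n)" "\<And>n. P n \<in> cball x1 (\<delta> * d)"
      "\<And>n. norm (X n - P n) < 1 / Suc n" by metis
    obtain q \<sigma> where q: "q \<in> cball x1 (\<delta> * d)" "strict_mono (\<sigma>::nat \<Rightarrow> nat)" "(P \<circ> \<sigma>) \<longlonglongrightarrow> q"
      using compact_cball[of x1 "\<delta> * d"] XP(2) unfolding compact_def by metis
    have hP: "(\<lambda>n. h ((P \<circ> \<sigma>) n)) \<longlonglongrightarrow> h q"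
      by (rule continuous_on_tendsto_compose[OF conth q(3)]) (use subr q(1) XP(2) in \<open>auto intro!: always_eventually simp: subset_iff less_imp_le\<close>)
    have "(\<lambda>n. X n - P n) \<longlonglongrightarrow> 0"
    proof (rule Lim_null_comparison[OF always_eventually])
      show "(\<lambda>n. 1 / real (Suc n)) \<longlonglongrightarrow> 0" by (rule LIMSEQ_one_over_Suc)
    qed (use XP(3) less_imp_le in blast)
    then have "((\<lambda>n. X n - P n) \<circ> \<sigma>) \<longlonglongrightarrow> 0" by (rule LIMSEQ_subseq_LIMSEQ[OF _ q(2)])
    then have "(\<lambda>n. ((\<lambda>n. X n - P n) \<circ> \<sigma>) n + (P \<circ> \<sigma>) n) \<longlonglongrightarrow> 0 + q" by (intro tendsto_add q(3))
    then have "(\<lambda>n. X (\<sigma> n)) \<longlonglongrightarrow> q" by (simp add: o_def)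
    then have "(\<lambda>n. (X (\<sigma> n), y0 - h ((P \<circ> \<sigma>) n))) \<longlonglongrightarrow> (q, y0 - h q)"
      by (intro tendsto_Pair tendsto_intros hP)
    then have "(q, y0 - h q) \<in> gph F"
      by (rule closed_sequentially[OF clF, rotated]) (use XP(1) in \<open>auto simp: gph_def\<close>)
    then have "y0 \<in> (\<lambda>y. y + h q) ` F q" by (force simp: gph_def)
    then have "d \<le> norm (x1 - q)" by (rule w(5))
    also have "\<dots> \<le> \<delta> * d" using q(1) by (simp add: dist_norm)
    finally show False using \<delta>(3) w(3) by simp
  qed
  then obtain \<eta> where \<eta>: "0 < \<eta>"
    "\<And>x y p. \<lbrakk>y \<in> F x; p \<in> cball x1 (\<delta> * d); norm (x - p) < \<eta>\<rbrakk> \<Longrightarrow> y + h p \<noteq> y0" by blast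
  define \<mu> where "\<mu> = min \<eta> (\<delta> * d)"
  have \<mu>: "0 < \<mu>" "\<mu> \<le> \<eta>" "\<mu> \<le> \<delta> * d" using \<eta> \<delta>d0 by (auto simp: \<mu>_def)
  \<comment> \<open>With this weight, \<open>norm (x - p) \<ge> \<mu>\<close> alone would make \<open>\<Phi>\<close> at least \<open>\<delta>\<^sup>2 * d\<close>.\<close>
  define \<rho> where "\<rho> = 2 * (\<delta>\<^sup>2 * d) / \<mu>\<^sup>2"
  have \<rho>: "0 < \<rho>" using \<mu> \<delta> w by (simp add: \<rho>_def)
  define \<Phi> where "\<Phi> = (\<lambda>((x, y), p). norm (y + h p - y0) + \<delta> * norm (p - x1) + \<rho> / 2 * (norm (x - p))\<^sup>2)"
  have \<Phi>: "\<Phi> ((x, y), p) = norm (y + h p - y0) + \<delta> * norm (p - x1) + \<rho> / 2 * (norm (x - p))\<^sup>2" for x y p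
    by (simp add: \<Phi>_def)
  have \<Phi>small: "norm (x - p) < \<mu> \<and> norm (p - x1) < \<delta> * d \<and> norm (y + h p - y0) < \<delta>\<^sup>2 * d"
    if le: "\<Phi> ((x, y), p) \<le> m" for x y p
  proof -
    have nn: "0 \<le> \<delta> * norm (p - x1)" "0 \<le> \<rho> / 2 * (norm (x - p))\<^sup>2" using \<delta> \<rho> by auto
    have lt: "norm (y + h p - y0) + \<delta> * norm (p - x1) + \<rho> / 2 * (norm (x - p))\<^sup>2 < \<delta>\<^sup>2 * d"
      using le m unfolding \<Phi> by linarith
    have "\<delta> * norm (p - x1) < \<delta>\<^sup>2 * d" using lt nn norm_ge_zero[of "y + h p - y0"] by linarith
    then have "\<delta> * norm (p - x1) < \<delta> * (\<delta> * d)" by (simp add: power2_eq_square mult.assoc)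
    then have 1: "norm (p - x1) < \<delta> * d" using \<delta> by simp
    have "\<rho> / 2 * (norm (x - p))\<^sup>2 < \<delta>\<^sup>2 * d" using lt nn norm_ge_zero[of "y + h p - y0"] by linarith
    also have "\<delta>\<^sup>2 * d = \<rho> / 2 * \<mu>\<^sup>2" using \<mu> by (simp add: \<rho>_def)
    finally have "(norm (x - p))\<^sup>2 < \<mu>\<^sup>2" using \<rho> by simp
    then have 2: "norm (x - p) < \<mu>" using \<mu> by (meson less_imp_le power2_less_imp_less)
    show ?thesis using 1 2 lt nn by linarith
  qed
  have "compact (h ` cball x0 r)" by (intro compact_continuous_image conth compact_cball)
  then obtain H where H: "\<And>p. p \<in> cball x0 r \<Longrightarrow> norm (h p) \<le> H"
    using compact_imp_bounded[of "h ` cball x0 r"] unfolding bounded_iff by blast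
  \<comment> \<open>The sublevel set \<open>\<Phi> \<le> m\<close> lies in the compact set \<open>K\<close>, so a minimiser over \<open>K\<close> is a global one.\<close>
  define R where "R = (norm x0 + r + \<mu>) + (\<delta>\<^sup>2 * d + H + norm y0)"
  define K where "K = (gph F \<inter> cball 0 R) \<times> cball x0 r"
  have compK: "compact K" unfolding K_def
    by (intro compact_Times compact_cball closed_Int_compact clF)
  have inK: "((x, y), p) \<in> K" if h: "y \<in> F x" "p \<in> cball x0 r" "\<Phi> ((x, y), p) \<le> m" for x y p
  proof -
    note s = \<Phi>small[OF h(3)]
    have "norm p \<le> norm x0 + r" using h(2) norm_triangle_sub[of p x0] by (simp add: dist_norm norm_minus_commute)
    then have "norm x \<le> norm x0 + r + \<mu>" using s norm_triangle_sub[of x p] by simp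
    moreover have "norm y \<le> \<delta>\<^sup>2 * d + H + norm y0"
    proof -
      have "y = (y + h p - y0) + (y0 - h p)" by simp
      then have "norm y \<le> norm (y + h p - y0) + norm (y0 - h p)" by (metis norm_triangle_ineq)
      also have "norm (y0 - h p) \<le> norm y0 + norm (h p)" by (rule norm_triangle_ineq4)
      finally show ?thesis using s H[OF h(2)] by simp
    qed
    ultimately have "norm (x, y) \<le> R" using norm_Pair_le[of x y] by (simp add: R_def)
    then show ?thesis using h by (simp add: K_def gph_def)
  qed
  have \<Phi>1: "\<Phi> ((x1, y1), x1) = m" by (simp add: \<Phi> m_def)
  have x1r: "x1 \<in> cball x0 r" using subsetD[OF subr, of x1] \<delta>d0 by (simp add: less_imp_le)
  have K1: "((x1, y1), x1) \<in> K" using inK[OF y1(1) x1r] \<Phi>1 by simp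
  have cont\<Phi>: "continuous_on K \<Phi>"
  proof -
    have "continuous_on K (\<lambda>z. h (snd z))"
    proof (rule continuous_on_compose2[OF conth])
      show "continuous_on K snd" by (intro continuous_on_snd continuous_on_id)
      show "snd ` K \<subseteq> cball x0 r" unfolding K_def by (simp add: image_subset_iff)
    qed
    then have "continuous_on K (\<lambda>z. norm (snd (fst z) + h (snd z) - y0) + \<delta> * norm (snd z - x1) + \<rho> / 2 * (norm (fst (fst z) - snd z))\<^sup>2)"
      by (intro continuous_intros)
    then show ?thesis by (simp add: \<Phi>_def case_prod_beta')
  qed
  obtain z where z: "z \<in> K" "\<And>z'. z' \<in> K \<Longrightarrow> \<Phi> z \<le> \<Phi> z'"
    using continuous_attains_inf[OF compK _ cont\<Phi>] K1 by blast
  obtain x y p where xyp: "z = ((x, y), p)" by (metis surj_pair)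
  have zm: "\<Phi> ((x, y), p) \<le> m" using z(2)[OF K1] \<Phi>1 xyp by simp
  have minz: "\<Phi> ((x, y), p) \<le> \<Phi> ((x', y'), p')" if h: "y' \<in> F x'" "p' \<in> cball x0 r" for x' y' p'
  proof (cases "\<Phi> ((x', y'), p') \<le> m")
    case True
    then show ?thesis using z(2)[OF inK[OF h]] xyp by simp
  qed (use zm in linarith)
  have yF: "y \<in> F x" and pr: "p \<in> cball x0 r" using z(1) xyp by (auto simp: K_def gph_def)
  note s = \<Phi>small[OF zm]
  have px1: "p \<in> cball x1 (\<delta> * d)" using s by (simp add: dist_norm norm_minus_commute)
  have pr': "norm (p - x0) < r" using subsetD[OF subr px1] by (simp add: dist_norm norm_minus_commute)
  define a where "a = y + h p - y0"
  have "norm (x - p) < \<eta>" using s \<mu> by linarith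
  then have a: "a \<noteq> 0" using \<eta>(2)[OF yF px1] by (simp add: a_def)
  have na: "0 < norm a" using a by simp
  define v' where "v' = a /\<^sub>R norm a"
  define u' where "u' = \<rho> *\<^sub>R (p - x)"
  have "(u', - v') \<in> normal_cone (gph F) (x, y)"
  proof (rule proximal_imp_normal)
    show "(x, y) \<in> gph F" using yF by (simp add: gph_def)
    fix z' assume z': "z' \<in> gph F"
    obtain x' y' where xy': "z' = (x', y')" by (cases z')
    have yF': "y' \<in> F x'" using z' xy' by (simp add: gph_def)
    define dx dy where "dx = x' - x" and "dy = y' - y"
    have "0 \<le> \<Phi> ((x', y'), p) - \<Phi> ((x, y), p)" using minz[OF yF' pr] by simp
    also have "\<dots> = (norm (a + dy) - norm a) + \<rho> / 2 * ((norm ((x - p) + dx))\<^sup>2 - (norm (x - p))\<^sup>2)"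
      by (simp add: \<Phi> a_def dx_def dy_def algebra_simps)
    also have "(norm ((x - p) + dx))\<^sup>2 - (norm (x - p))\<^sup>2 = 2 * ((x - p) \<bullet> dx) + (norm dx)\<^sup>2"
      by (simp add: power2_norm_eq_inner inner_add_left inner_add_right inner_commute)
    also have "(norm (a + dy) - norm a) \<le> v' \<bullet> dy + (norm dy)\<^sup>2 / (2 * norm a)"
      unfolding v'_def by (rule norm_le_tangent[OF a])
    finally have "(u', - v') \<bullet> (z' - (x, y)) \<le> 1 / (2 * norm a) * (norm dy)\<^sup>2 + \<rho> / 2 * (norm dx)\<^sup>2"
      by (simp add: xy' u'_def dx_def dy_def inner_diff_left inner_diff_right algebra_simps)
    also have "\<dots> \<le> 1 / (2 * norm a) * (norm (z' - (x, y)))\<^sup>2 + \<rho> / 2 * (norm (z' - (x, y)))\<^sup>2"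
      using na \<rho> unfolding xy' dx_def dy_def
      by (intro add_mono mult_left_mono) (auto simp: norm_Pair)
    finally show "(u', - v') \<bullet> (z' - (x, y)) \<le> (1 / (2 * norm a) + \<rho> / 2) * (norm (z' - (x, y)))\<^sup>2"
      by (simp add: algebra_simps)
  qed
  moreover have "\<forall>\<^sub>F \<tau> in at_right 0.
       - ((\<epsilon> * norm e + \<eta>') * \<tau>) \<le> \<tau> * (u' \<bullet> e) + v' \<bullet> (h (p + \<tau> *\<^sub>R e) - h p)" if \<eta>': "0 < \<eta>'" for e \<eta>'
  proof -
    define Q where "Q = (L * norm e)\<^sup>2 / (2 * norm a) + \<rho> / 2 * (norm e)\<^sup>2"
    have Q: "0 \<le> Q" using na \<rho> by (simp add: Q_def)
    have ev1: "\<forall>\<^sub>F \<tau> in at_right 0. p + \<tau> *\<^sub>R e \<in> ball x0 r"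
      by (rule eventually_ray_in_open) (use pr' in \<open>auto simp: dist_norm norm_minus_commute\<close>)
    have ev2: "\<forall>\<^sub>F \<tau> in at_right 0. \<tau> * Q < \<eta>'"
    proof -
      have "((\<lambda>\<tau>. \<tau> * Q) \<longlongrightarrow> 0 * Q) (at_right 0)" by (intro tendsto_intros)
      then show ?thesis using \<eta>' by (intro order_tendstoD(2)[of _ "0 * Q"]) auto
    qed
    show ?thesis using ev1 ev2 eventually_at_right_less[of "0::real"]
    proof eventually_elim
      case (elim \<tau>)
      define \<Delta> where "\<Delta> = h (p + \<tau> *\<^sub>R e) - h p"
      have pe: "p + \<tau> *\<^sub>R e \<in> cball x0 r" using elim(1) by (simp add: less_imp_le)
      have n\<Delta>: "norm \<Delta> \<le> \<tau> * (L * norm e)"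
        using lipschitz_onD[OF lip pe pr] elim(3) by (simp add: \<Delta>_def dist_norm mult_ac)
      have "0 \<le> \<Phi> ((x, y), p + \<tau> *\<^sub>R e) - \<Phi> ((x, y), p)" using minz[OF yF pe] by simp
      also have "\<dots> = (norm (a + \<Delta>) - norm a) + \<delta> * (norm ((p - x1) + \<tau> *\<^sub>R e) - norm (p - x1))
          + \<rho> / 2 * ((norm ((x - p) - \<tau> *\<^sub>R e))\<^sup>2 - (norm (x - p))\<^sup>2)"
        by (simp add: \<Phi> a_def \<Delta>_def algebra_simps)
      finally have g0: "0 \<le> (norm (a + \<Delta>) - norm a) + \<delta> * (norm ((p - x1) + \<tau> *\<^sub>R e) - norm (p - x1))
          + \<rho> / 2 * ((norm ((x - p) - \<tau> *\<^sub>R e))\<^sup>2 - (norm (x - p))\<^sup>2)" .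
      have g1: "(norm ((x - p) - \<tau> *\<^sub>R e))\<^sup>2 - (norm (x - p))\<^sup>2 = - 2 * \<tau> * ((x - p) \<bullet> e) + \<tau>\<^sup>2 * (norm e)\<^sup>2"
        by (simp add: power2_norm_eq_inner inner_diff_left inner_diff_right inner_commute)
          (simp add: power2_eq_square algebra_simps)
      have g2: "norm (a + \<Delta>) - norm a \<le> v' \<bullet> \<Delta> + (norm \<Delta>)\<^sup>2 / (2 * norm a)"
        unfolding v'_def by (rule norm_le_tangent[OF a])
      have g3: "(norm \<Delta>)\<^sup>2 / (2 * norm a) \<le> (\<tau> * (L * norm e))\<^sup>2 / (2 * norm a)"
        using n\<Delta> na by (intro divide_right_mono power_mono) auto
      have "norm ((p - x1) + \<tau> *\<^sub>R e) - norm (p - x1) \<le> \<tau> * norm e"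
        using norm_triangle_ineq[of "p - x1" "\<tau> *\<^sub>R e"] elim(3) by simp
      then have g4: "\<delta> * (norm ((p - x1) + \<tau> *\<^sub>R e) - norm (p - x1)) \<le> \<delta> * (\<tau> * norm e)"
        using \<delta>(1) by (intro mult_left_mono) auto
      have "0 \<le> v' \<bullet> \<Delta> + (\<tau> * (L * norm e))\<^sup>2 / (2 * norm a) + \<delta> * (\<tau> * norm e)
          + \<rho> / 2 * (- 2 * \<tau> * ((x - p) \<bullet> e) + \<tau>\<^sup>2 * (norm e)\<^sup>2)"
        using g0 g2 g3 g4 unfolding g1 by linarith
      also have "\<dots> = v' \<bullet> \<Delta> + \<tau> * (u' \<bullet> e) + \<delta> * norm e * \<tau> + (\<tau> * Q) * \<tau>"
        by (simp add: Q_def u'_def power2_eq_square inner_diff_left inner_diff_right algebra_simps add_divide_distrib)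
      finally have g5: "0 \<le> v' \<bullet> \<Delta> + \<tau> * (u' \<bullet> e) + \<delta> * norm e * \<tau> + (\<tau> * Q) * \<tau>" .
      have g6: "\<delta> * norm e * \<tau> \<le> \<epsilon> * norm e * \<tau>" using \<delta> elim(3) \<epsilon> by (intro mult_right_mono) auto
      have g7: "(\<tau> * Q) * \<tau> \<le> \<eta>' * \<tau>" using elim by (intro mult_right_mono) auto
      have "- ((\<epsilon> * norm e + \<eta>') * \<tau>) = - (\<epsilon> * norm e * \<tau>) - \<eta>' * \<tau>" by (simp add: algebra_simps)
      then show ?case using g5 g6 g7 unfolding \<Delta>_def by linarith
    qed
  qed
  moreover have "norm v' = 1" using a by (simp add: v'_def)
  moreover have big: "D / 2 \<le> norm (x - x0)"
  proof -
    have "D \<le> norm (x - x0) + norm (x - p) + norm (p - x1)"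
      unfolding D_def using norm_triangle_ineq4[of "x - x0" "x - x1"] norm_triangle_ineq[of "x - p" "p - x1"]
      by (simp add: norm_minus_commute)
    then show ?thesis using s \<mu> \<delta>d by linarith
  qed
  moreover have "x \<noteq> x0" using big D by auto
  moreover have "norm (x - x0) < \<epsilon>"
  proof -
    have "norm (x - x0) \<le> D + norm (x - p) + norm (p - x1)"
      unfolding D_def using norm_triangle_ineq[of "x - x1" "x1 - x0"] norm_triangle_ineq[of "x - p" "p - x1"]
      by simp
    then show ?thesis using s \<mu> \<delta>d D \<delta> by linarith
  qed
  moreover have d2: "d \<le> 2 * norm (x - x0)" using big dD by linarith
  moreover have "norm (x - p) \<le> \<epsilon> * norm (x - x0)"
  proof -
    have "norm (x - p) \<le> \<delta> * d" using s \<mu> by linarith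
    also have "\<dots> \<le> (\<epsilon> / 4) * (2 * norm (x - x0))" using d2 \<delta> w \<epsilon> by (intro mult_mono) auto
    also have "\<dots> \<le> \<epsilon> * norm (x - x0)" using \<epsilon> by simp
    finally show ?thesis .
  qed
  moreover have "norm (y - y0 + h p) \<le> \<epsilon> * norm (x - x0)"
  proof -
    have "norm (y - y0 + h p) \<le> \<delta>\<^sup>2 * d" using s by (simp add: algebra_simps)
    also have "\<dots> \<le> (\<epsilon> / 4) * (2 * norm (x - x0))" using d2 \<delta> \<delta>2 w \<epsilon> by (intro mult_mono) auto
    also have "\<dots> \<le> \<epsilon> * norm (x - x0)" using \<epsilon> by simp
    finally show ?thesis .
  qed
  ultimately show ?thesis using pr' by blast
qed


text \<open>
  The approximate normals for \<open>\<epsilon> = 1 / (n + 1)\<close>, with the displacements divided by \<open>t = N (x - x0)\<close>, form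
  a bounded sequence: the last condition of \<open>nonsubregular_approximation\<close> in the direction \<open>- u'\<close> bounds
  \<open>u'\<close> by the Lipschitz constant. A convergent subsequence gives the element of the primal-dual derivative.
  The points \<open>p\<close> are recorded instead of \<open>x\<close> because the conditions on \<open>h\<close> hold at \<open>p\<close>.
\<close>

lemma nonsubregular_limit:
  fixes F :: "'a::euclidean_space \<Rightarrow> 'b::euclidean_space set" and N :: "'a \<Rightarrow> real" and M :: "'b \<Rightarrow> real"
  assumes N: "is_norm N" and M: "is_norm M" and clF: "closed (gph F)" and F0: "(x0, y0) \<in> gph F"
    and r: "0 < r" and lip: "L-lipschitz_on (cball x0 r) h" and h0: "h x0 = 0"
    and nsr: "\<not> metrically_subregular N M (\<lambda>x. (\<lambda>y. y + h x) ` F x) x0 y0"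
  obtains t :: "nat \<Rightarrow> real" and p U V E u v u' v' where
    "\<And>k. 0 < t k" "t \<longlonglongrightarrow> 0" "p \<longlonglongrightarrow> u" "N u = 1" "U \<longlonglongrightarrow> u'" "V \<longlonglongrightarrow> v'" "norm v' = 1"
    "(u', v) \<in> primal_dual_derivative F x0 y0 u v'" "E \<longlonglongrightarrow> 0"
    "(\<lambda>k. h (x0 + t k *\<^sub>R p k) /\<^sub>R t k) \<longlonglongrightarrow> - v" "\<And>k. x0 + t k *\<^sub>R p k \<in> ball x0 r"
    "\<And>k e \<eta>. 0 < \<eta> \<Longrightarrow> \<forall>\<^sub>F \<tau> in at_right 0. - ((E k * norm e + \<eta>) * \<tau>) \<le>
       \<tau> * (U k \<bullet> e) + V k \<bullet> (h (x0 + t k *\<^sub>R p k + \<tau> *\<^sub>R e) - h (x0 + t k *\<^sub>R p k))"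
proof -
  interpret N: vnorm N by standard fact
  interpret M: vnorm M by standard fact
  obtain C where C: "0 < C" "\<And>x. N x \<le> C * norm x" using N.upper by blast
  obtain c where c: "0 < c" "\<And>x. norm x \<le> c * N x" using N.lower by blast
  have L: "0 \<le> L" using lip by (rule lipschitz_on_nonneg)
  define E where "E n = 1 / real (Suc n)" for n
  have E: "0 < E n" "E n \<le> 1" for n by (auto simp: E_def)
  define good where "good n x y p u' v' \<longleftrightarrow> x \<noteq> x0 \<and> norm (x - x0) < E n \<and> norm (x - p) \<le> E n * norm (x - x0) \<and>
    norm (y - y0 + h p) \<le> E n * norm (x - x0) \<and> norm v' = 1 \<and> norm (p - x0) < r \<and>
    (u', - v') \<in> normal_cone (gph F) (x, y) \<and>
    (\<forall>e. \<forall>\<eta>>0. \<forall>\<^sub>F \<tau> in at_right 0.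
       - ((E n * norm e + \<eta>) * \<tau>) \<le> \<tau> * (u' \<bullet> e) + v' \<bullet> (h (p + \<tau> *\<^sub>R e) - h p))" for n x y p u' v'
  have "\<forall>n. \<exists>x y p u' v'. good n x y p u' v'"
    unfolding good_def using nonsubregular_approximation[OF N M clF F0 r lip h0 nsr] E(1) by blast
  then obtain X Y P U V where good: "\<And>n. good n (X n) (Y n) (P n) (U n) (V n)" by metis
  have XY: "X n \<noteq> x0" "norm (X n - x0) < E n" "norm (X n - P n) \<le> E n * norm (X n - x0)"
    "norm (Y n - y0 + h (P n)) \<le> E n * norm (X n - x0)" "norm (V n) = 1" "norm (P n - x0) < r"
    "(U n, - V n) \<in> normal_cone (gph F) (X n, Y n)"
    "0 < \<eta> \<Longrightarrow> \<forall>\<^sub>F \<tau> in at_right 0.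
       - ((E n * norm e + \<eta>) * \<tau>) \<le> \<tau> * (U n \<bullet> e) + V n \<bullet> (h (P n + \<tau> *\<^sub>R e) - h (P n))" for n e \<eta>
    using good[of n] unfolding good_def by blast+
  define t where "t n = N (X n - x0)" for n
  have t: "0 < t n" for n using XY(1)[of n] by (simp add: t_def N.pos)
  have Xt: "norm (X n - x0) \<le> c * t n" for n by (simp add: t_def c)
  define a b where "a n = (X n - x0) /\<^sub>R t n" and "b n = (Y n - y0) /\<^sub>R t n" for n
  have div: "norm (z /\<^sub>R t n) \<le> K" if "norm z \<le> K * t n" for z :: "'z::real_normed_vector" and n K
    using that t[of n] by (simp add: field_simps)
  have na: "norm (a n) \<le> c" for n unfolding a_def by (rule div) (rule Xt)
  have Px: "norm (P n - x0) \<le> 2 * c * t n" for n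
  proof -
    have "norm (P n - x0) \<le> norm (X n - P n) + norm (X n - x0)"
      using norm_triangle_ineq4[of "X n - x0" "X n - P n"] by simp
    also have "norm (X n - P n) \<le> 1 * norm (X n - x0)"
      using XY(3)[of n] E[of n] by (meson mult_right_mono norm_ge_zero order_trans)
    finally show ?thesis using Xt[of n] by simp
  qed
  have Pc: "P n \<in> cball x0 r" for n using XY(6)[of n] by (simp add: dist_norm norm_minus_commute)
  have hP: "norm (h (P n)) \<le> L * (2 * c * t n)" for n
  proof -
    have "norm (h (P n)) \<le> L * norm (P n - x0)"
      using lipschitz_onD[OF lip Pc[of n], of x0] r h0 by (simp add: dist_norm)
    also have "\<dots> \<le> L * (2 * c * t n)" using L Px by (intro mult_left_mono)
    finally show ?thesis .
  qed
  have nb: "norm (b n) \<le> c + L * (2 * c)" for n unfolding b_def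
  proof (rule div)
    have "norm (Y n - y0) \<le> norm (Y n - y0 + h (P n)) + norm (h (P n))"
      using norm_triangle_ineq4[of "Y n - y0 + h (P n)" "h (P n)"] by simp
    also have "norm (Y n - y0 + h (P n)) \<le> 1 * norm (X n - x0)"
      using XY(4)[of n] E[of n] by (meson mult_right_mono norm_ge_zero order_trans)
    finally show "norm (Y n - y0) \<le> (c + L * (2 * c)) * t n"
      using Xt[of n] hP[of n] by (simp add: algebra_simps)
  qed
  have nU: "norm (U n) \<le> 1 + L" for n
  proof -
    have "norm (U n) * norm (U n) \<le> (1 + L) * norm (U n)"
    proof (rule field_le_epsilon)
      fix \<eta> :: real assume \<eta>: "0 < \<eta>"
      define e where "e = - U n"
      have "\<forall>\<^sub>F \<tau> in at_right 0. P n + \<tau> *\<^sub>R e \<in> ball x0 r"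
        by (rule eventually_ray_in_open) (use XY(6)[of n] in \<open>auto simp: dist_norm norm_minus_commute\<close>)
      then have "\<forall>\<^sub>F \<tau> in at_right 0. 0 < \<tau> \<and> P n + \<tau> *\<^sub>R e \<in> ball x0 r \<and>
          - ((E n * norm e + \<eta>) * \<tau>) \<le> \<tau> * (U n \<bullet> e) + V n \<bullet> (h (P n + \<tau> *\<^sub>R e) - h (P n))"
        by (intro eventually_conj eventually_at_right_less XY(8) \<eta>)
      then obtain \<tau> where \<tau>: "0 < \<tau>" "P n + \<tau> *\<^sub>R e \<in> ball x0 r"
          "- ((E n * norm e + \<eta>) * \<tau>) \<le> \<tau> * (U n \<bullet> e) + V n \<bullet> (h (P n + \<tau> *\<^sub>R e) - h (P n))"
        using eventually_happens'[OF trivial_limit_at_right_real] by blast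
      have "V n \<bullet> (h (P n + \<tau> *\<^sub>R e) - h (P n)) \<le> norm (V n) * norm (h (P n + \<tau> *\<^sub>R e) - h (P n))"
        by (rule norm_cauchy_schwarz)
      also have "\<dots> \<le> L * (\<tau> * norm e)"
        using lipschitz_onD[OF lip, of "P n + \<tau> *\<^sub>R e" "P n"] \<tau> Pc[of n] XY(5)[of n]
        by (simp add: dist_norm less_imp_le)
      finally have "\<tau> * (norm (U n) * norm (U n)) \<le> \<tau> * ((E n + L) * norm (U n) + \<eta>)"
        using \<tau>(3) by (simp add: e_def algebra_simps power2_norm_eq_inner[symmetric] power2_eq_square)
      then have "norm (U n) * norm (U n) \<le> (E n + L) * norm (U n) + \<eta>" using \<tau>(1) by simp
      also have "(E n + L) * norm (U n) \<le> (1 + L) * norm (U n)" using E[of n] by (intro mult_right_mono) auto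
      finally show "norm (U n) * norm (U n) \<le> (1 + L) * norm (U n) + \<eta>" by simp
    qed
    then show ?thesis using L by (cases "U n = 0") auto
  qed
  have "bounded (range (\<lambda>n. (a n, b n, U n, V n)))"
    unfolding bounded_iff
  proof (intro exI ballI)
    fix z assume "z \<in> range (\<lambda>n. (a n, b n, U n, V n))"
    then obtain n where z: "z = (a n, b n, U n, V n)" by blast
    have "norm (a n, b n, U n, V n) \<le> norm (a n) + (norm (b n) + (norm (U n) + norm (V n)))"
      using norm_Pair_le[of "a n" "(b n, U n, V n)"] norm_Pair_le[of "b n" "(U n, V n)"] norm_Pair_le[of "U n" "V n"]
      by linarith
    then show "norm z \<le> c + ((c + L * (2 * c)) + ((1 + L) + 1))"
      unfolding z using na[of n] nb[of n] nU[of n] XY(5)[of n] by linarith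
  qed
  then obtain l \<sigma> where l: "strict_mono (\<sigma>::nat \<Rightarrow> nat)" "((\<lambda>n. (a n, b n, U n, V n)) \<circ> \<sigma>) \<longlonglongrightarrow> l"
    using bounded_imp_convergent_subsequence by blast
  obtain u v u' v' where luv: "l = (u, v, u', v')" by (metis surj_pair)
  have lim: "(\<lambda>n. (a (\<sigma> n), b (\<sigma> n), U (\<sigma> n), V (\<sigma> n))) \<longlonglongrightarrow> (u, v, u', v')"
    using l(2) luv by (simp add: o_def)
  have la: "(\<lambda>n. a (\<sigma> n)) \<longlonglongrightarrow> u" using tendsto_fst[OF lim] by simp
  have lb: "(\<lambda>n. b (\<sigma> n)) \<longlonglongrightarrow> v" using tendsto_fst[OF tendsto_snd[OF lim]] by simp
  have lU: "(\<lambda>n. U (\<sigma> n)) \<longlonglongrightarrow> u'" using tendsto_fst[OF tendsto_snd[OF tendsto_snd[OF lim]]] by simp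
  have lV: "(\<lambda>n. V (\<sigma> n)) \<longlonglongrightarrow> v'" using tendsto_snd[OF tendsto_snd[OF tendsto_snd[OF lim]]] by simp
  have E0: "E \<longlonglongrightarrow> 0" unfolding E_def by (rule LIMSEQ_one_over_Suc)
  have E\<sigma>: "(\<lambda>n. E (\<sigma> n)) \<longlonglongrightarrow> 0" using LIMSEQ_subseq_LIMSEQ[OF E0 l(1)] by (simp add: o_def)
  have cE: "(\<lambda>n. c * E (\<sigma> n)) \<longlonglongrightarrow> 0" using tendsto_mult_left[OF E\<sigma>, of c] by simp
  have CE: "(\<lambda>n. C * E (\<sigma> n)) \<longlonglongrightarrow> 0" using tendsto_mult_left[OF E\<sigma>, of C] by simp
  have tC: "t n \<le> C * E n" for n
  proof -
    have "t n \<le> C * norm (X n - x0)" unfolding t_def by (rule C)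
    also have "\<dots> \<le> C * E n" using C XY(2)[of n] by simp
    finally show ?thesis .
  qed
  have lt: "(\<lambda>n. t (\<sigma> n)) \<longlonglongrightarrow> 0"
    by (rule Lim_null_comparison[OF always_eventually CE]) (use tC t less_imp_le in \<open>simp add: abs_of_pos\<close>)
  define p where "p n = (P n - x0) /\<^sub>R t n" for n
  have xp: "x0 + t n *\<^sub>R p n = P n" for n using t[of n] by (simp add: p_def)
  have cEt: "E n * norm (X n - x0) \<le> (c * E n) * t n" for n
    using mult_left_mono[OF Xt[of n], of "E n"] E[of n] by (simp add: mult_ac)
  have lp: "(\<lambda>n. p (\<sigma> n)) \<longlonglongrightarrow> u"
  proof -
    have "norm (p n - a n) \<le> c * E n" for n
    proof -
      have "p n - a n = (P n - X n) /\<^sub>R t n" by (simp add: p_def a_def scaleR_diff_right)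
      then show ?thesis using div[of "P n - X n" "c * E n" n] XY(3)[of n] cEt[of n] by (simp add: norm_minus_commute)
    qed
    then have "(\<lambda>n. p (\<sigma> n) - a (\<sigma> n)) \<longlonglongrightarrow> 0"
      by (intro Lim_null_comparison[OF always_eventually cE]) auto
    from tendsto_add[OF this la] show ?thesis by simp
  qed
  have lh: "(\<lambda>n. h (x0 + t (\<sigma> n) *\<^sub>R p (\<sigma> n)) /\<^sub>R t (\<sigma> n)) \<longlonglongrightarrow> - v"
  proof -
    have "norm (h (P n) /\<^sub>R t n + b n) \<le> c * E n" for n
    proof -
      have "h (P n) /\<^sub>R t n + b n = (Y n - y0 + h (P n)) /\<^sub>R t n" by (simp add: b_def scaleR_add_right)
      then show ?thesis using div[of "Y n - y0 + h (P n)" "c * E n" n] XY(4)[of n] cEt[of n] by simp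
    qed
    then have "(\<lambda>n. h (P (\<sigma> n)) /\<^sub>R t (\<sigma> n) + b (\<sigma> n)) \<longlonglongrightarrow> 0"
      by (intro Lim_null_comparison[OF always_eventually cE]) auto
    from tendsto_diff[OF this lb] show ?thesis by (simp add: xp)
  qed
  have "N (a n) = 1" for n using t[of n] unfolding a_def N.scale by (simp add: t_def[symmetric])
  then have Nu: "N u = 1" using LIMSEQ_unique[OF N.tendsto[OF la]] by simp
  have nv: "norm v' = 1" using LIMSEQ_unique[OF tendsto_norm[OF lV]] XY(5) by simp
  have pdd: "(u', v) \<in> primal_dual_derivative F x0 y0 u v'"
    unfolding primal_dual_derivative_def dir_lim_normal_cone_def
  proof (clarify, intro exI conjI)
    show "\<forall>i. 0 < t (\<sigma> i)" using t by blast
    show "(\<lambda>i. t (\<sigma> i)) \<longlonglongrightarrow> 0" by (rule lt)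
    show "(\<lambda>i. (a (\<sigma> i), b (\<sigma> i))) \<longlonglongrightarrow> (u, v)" by (intro tendsto_Pair la lb)
    show "(\<lambda>i. (U (\<sigma> i), - V (\<sigma> i))) \<longlonglongrightarrow> (u', - v')" by (intro tendsto_Pair tendsto_minus lU lV)
    have "(x0, y0) + t n *\<^sub>R (a n, b n) = (X n, Y n)" for n using t[of n] by (simp add: a_def b_def)
    then show "\<forall>i. (U (\<sigma> i), - V (\<sigma> i)) \<in> normal_cone (gph F) ((x0, y0) + t (\<sigma> i) *\<^sub>R (a (\<sigma> i), b (\<sigma> i)))"
      using XY(7) by metis
  qed
  have Pb: "P n \<in> ball x0 r" for n using XY(6)[of n] by (simp add: dist_norm norm_minus_commute)
  show thesis
  proof (rule that[of "\<lambda>n. t (\<sigma> n)" "\<lambda>n. p (\<sigma> n)" u "\<lambda>n. U (\<sigma> n)" u' "\<lambda>n. V (\<sigma> n)" v' v "\<lambda>n. E (\<sigma> n)"])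
    show "\<forall>\<^sub>F \<tau> in at_right 0. - ((E (\<sigma> k) * norm e + \<eta>) * \<tau>) \<le> \<tau> * (U (\<sigma> k) \<bullet> e) +
       V (\<sigma> k) \<bullet> (h (x0 + t (\<sigma> k) *\<^sub>R p (\<sigma> k) + \<tau> *\<^sub>R e) - h (x0 + t (\<sigma> k) *\<^sub>R p (\<sigma> k)))"
      if "0 < \<eta>" for k e \<eta> unfolding xp using XY(8)[OF that] by blast
  qed (use t lt lp Nu lU lV nv pdd E\<sigma> lh Pb in \<open>auto simp: xp simp del: mem_ball\<close>)
qed

text \<open>
  The vector \<open>v'\<close> has Euclidean length one, and the cone property of the primal-dual derivative allows
  to rescale it to dual norm one afterwards.
\<close>

lemma rg_le_of_nonsubregular:
  fixes F :: "'a::euclidean_space \<Rightarrow> 'b::euclidean_space set" and N :: "'a \<Rightarrow> real" and M :: "'b \<Rightarrow> real"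
  assumes N: "is_norm N" and M: "is_norm M" and clF: "closed (gph F)" and F0: "(x0, y0) \<in> gph F"
    and r: "0 < r" and lip: "L-lipschitz_on (cball x0 r) h" and h0: "h x0 = 0"
    and nsr: "\<not> metrically_subregular N M (\<lambda>x. (\<lambda>y. y + h x) ` F x) x0 y0"
    and K: "0 \<le> K" "\<And>x x'. \<lbrakk>x \<in> ball x0 r; x' \<in> ball x0 r\<rbrakk> \<Longrightarrow> M (h x - h x') \<le> K * N (x - x')"
  shows "rg N M F x0 y0 \<le> ereal K"
proof -
  interpret N: vnorm N by standard fact
  interpret M: vnorm M by standard fact
  have L: "0 \<le> L" using lip by (rule lipschitz_on_nonneg)
  obtain t :: "nat \<Rightarrow> real" and p U V E u v u' v' where
    t: "\<And>k. 0 < t k" "t \<longlonglongrightarrow> 0" and p: "p \<longlonglongrightarrow> u" "N u = 1" and U: "U \<longlonglongrightarrow> u'" and V: "V \<longlonglongrightarrow> v'" "norm v' = 1" and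
    pdd: "(u', v) \<in> primal_dual_derivative F x0 y0 u v'" and E: "E \<longlonglongrightarrow> 0" and
    hv: "(\<lambda>k. h (x0 + t k *\<^sub>R p k) /\<^sub>R t k) \<longlonglongrightarrow> - v" and ball: "\<And>k. x0 + t k *\<^sub>R p k \<in> ball x0 r" and
    first: "\<And>k e \<eta>. 0 < \<eta> \<Longrightarrow> \<forall>\<^sub>F \<tau> in at_right 0. - ((E k * norm e + \<eta>) * \<tau>) \<le>
       \<tau> * (U k \<bullet> e) + V k \<bullet> (h (x0 + t k *\<^sub>R p k + \<tau> *\<^sub>R e) - h (x0 + t k *\<^sub>R p k))"
    by (rule nonsubregular_limit[OF N M clF F0 r lip h0 nsr]) blast
  have Mv: "M v \<le> K"
  proof -
    have "M (h (x0 + t k *\<^sub>R p k) /\<^sub>R t k) \<le> K * N (p k)" for k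
    proof -
      have "M (h (x0 + t k *\<^sub>R p k)) \<le> K * N (t k *\<^sub>R p k)"
        using K(2)[OF ball[of k], of x0] r h0 by simp
      then show ?thesis using t(1)[of k] by (simp add: M.scale N.scale field_simps)
    qed
    moreover have "(\<lambda>k. M (h (x0 + t k *\<^sub>R p k) /\<^sub>R t k)) \<longlonglongrightarrow> M (- v)" by (rule M.tendsto[OF hv])
    moreover have "(\<lambda>k. K * N (p k)) \<longlonglongrightarrow> K * N u" by (intro tendsto_mult_left N.tendsto p)
    ultimately have "M (- v) \<le> K * N u" by (intro LIMSEQ_le) auto
    then show ?thesis using p by simp
  qed
  define m where "m = dual_norm M v'"
  have m: "0 < m" unfolding m_def using V by (intro M.dual_pos) auto
  have u'e: "- u' \<bullet> e \<le> m * K * N e" for e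
  proof -
    have step: "- U k \<bullet> e \<le> m * K * N e + norm (V k - v') * (L * norm e) + E k * norm e" for k
    proof (rule field_le_epsilon)
      fix \<eta> :: real assume \<eta>: "0 < \<eta>"
      define q where "q = x0 + t k *\<^sub>R p k"
      have qb: "q \<in> ball x0 r" using ball by (simp add: q_def)
      from eventually_ray_in_open[OF open_ball qb]
      have "\<forall>\<^sub>F \<tau> in at_right 0. 0 < \<tau> \<and> q + \<tau> *\<^sub>R e \<in> ball x0 r \<and>
         - ((E k * norm e + \<eta>) * \<tau>) \<le> \<tau> * (U k \<bullet> e) + V k \<bullet> (h (q + \<tau> *\<^sub>R e) - h q)"
        unfolding q_def by (intro eventually_conj eventually_at_right_less first \<eta>)
      then obtain \<tau> where \<tau>: "0 < \<tau>" "q + \<tau> *\<^sub>R e \<in> ball x0 r"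
         "- ((E k * norm e + \<eta>) * \<tau>) \<le> \<tau> * (U k \<bullet> e) + V k \<bullet> (h (q + \<tau> *\<^sub>R e) - h q)"
        using eventually_happens'[OF trivial_limit_at_right_real] by blast
      define \<Delta> where "\<Delta> = h (q + \<tau> *\<^sub>R e) - h q"
      \<comment> \<open>The dual norm is evaluated at the limit \<open>v'\<close> only; the error \<open>V k - v'\<close> is estimated in the Euclidean norm.\<close>
      have "V k \<bullet> \<Delta> = v' \<bullet> \<Delta> + (V k - v') \<bullet> \<Delta>" by (simp add: inner_diff_left)
      moreover have "v' \<bullet> \<Delta> \<le> m * M \<Delta>" unfolding m_def by (rule M.inner_le_dual)
      moreover have "m * M \<Delta> \<le> m * (K * N (\<tau> *\<^sub>R e))"
        using K(2)[OF \<tau>(2) qb] m by (intro mult_left_mono) (auto simp: \<Delta>_def)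
      moreover have "(V k - v') \<bullet> \<Delta> \<le> norm (V k - v') * norm \<Delta>" by (rule norm_cauchy_schwarz)
      moreover have "norm (V k - v') * norm \<Delta> \<le> norm (V k - v') * (L * (\<tau> * norm e))"
        using lipschitz_onD[OF lip, of "q + \<tau> *\<^sub>R e" q] \<tau> qb
        by (intro mult_left_mono) (auto simp: dist_norm \<Delta>_def less_imp_le)
      ultimately have "V k \<bullet> \<Delta> \<le> m * (K * N (\<tau> *\<^sub>R e)) + norm (V k - v') * (L * (\<tau> * norm e))" by linarith
      then have "V k \<bullet> \<Delta> \<le> \<tau> * (m * K * N e + norm (V k - v') * (L * norm e))"
        using \<tau>(1) by (simp add: N.scale algebra_simps)
      then have "\<tau> * (- U k \<bullet> e) \<le> \<tau> * (m * K * N e + norm (V k - v') * (L * norm e) + E k * norm e + \<eta>)"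
        using \<tau>(3) by (simp add: \<Delta>_def algebra_simps)
      then show "- U k \<bullet> e \<le> m * K * N e + norm (V k - v') * (L * norm e) + E k * norm e + \<eta>"
        by (rule iffD1[OF mult_le_cancel_left_pos[OF \<tau>(1)]])
    qed
    have "(\<lambda>k. m * K * N e + norm (V k - v') * (L * norm e) + E k * norm e)
        \<longlonglongrightarrow> m * K * N e + norm (v' - v') * (L * norm e) + 0 * norm e"
      by (intro tendsto_intros V E)
    moreover have "(\<lambda>k. - U k \<bullet> e) \<longlonglongrightarrow> - u' \<bullet> e" by (intro tendsto_intros U)
    ultimately have "- u' \<bullet> e \<le> m * K * N e + norm (v' - v') * (L * norm e) + 0 * norm e"
      using step by (intro LIMSEQ_le) auto
    then show ?thesis by simp
  qed
  have "dual_norm N u' \<le> m * K"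
  proof (rule N.dual_le)
    fix x show "u' \<bullet> x \<le> m * K * N x" using u'e[of "- x"] by simp
  qed (use m K in simp)
  then have 1: "dual_norm N (u' /\<^sub>R m) \<le> K"
    using m by (simp add: N.dual_scale field_simps)
  have "(u' /\<^sub>R m, v) \<in> primal_dual_derivative F x0 y0 u (v' /\<^sub>R m)"
    by (rule primal_dual_derivative_scale[OF pdd]) (use m in simp)
  moreover have "dual_norm M (v' /\<^sub>R m) = 1" using m by (simp add: M.dual_scale m_def[symmetric])
  ultimately have "rg N M F x0 y0 \<le> ereal (max (dual_norm N (u' /\<^sub>R m)) (M v))"
    unfolding rg_def using p(2) by (intro Inf_lower) blast
  also have "\<dots> \<le> ereal K" using 1 Mv by simp
  finally show ?thesis .
qed

section \<open>Derivatives of Lipschitz functions and the Clarke Jacobian\<close>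

lemma is_norm_norm: "is_norm (norm :: 'a::real_normed_vector \<Rightarrow> real)"
  by (auto simp: is_norm_def norm_triangle_ineq)

lemma norm_matrix_le:
  fixes A :: "real ^ 'n ^ 'm"
  assumes "\<And>x. norm (A *v x) \<le> K * norm x"
  shows "norm A \<le> real CARD('m) * (real CARD('n) * K)"
proof -
  have e: "\<bar>A $ i $ j\<bar> \<le> K" for i j
  proof -
    have "\<bar>(A *v axis j 1) $ i\<bar> \<le> norm (A *v axis j 1)" by (rule component_le_norm_cart)
    also have "\<dots> \<le> K" using assms[of "axis j 1"] by (simp add: norm_axis_1)
    finally show ?thesis by (simp add: matrix_vector_mult_basis column_def)
  qed
  have "norm A \<le> (\<Sum>i\<in>UNIV. norm (A $ i))"
    unfolding norm_vec_def[of A] by (rule L2_set_le_sum) simp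
  also have "\<dots> \<le> (\<Sum>i\<in>(UNIV::'m set). real CARD('n) * K)"
  proof (rule sum_mono)
    fix i
    have "norm (A $ i) \<le> (\<Sum>j\<in>UNIV. \<bar>A $ i $ j\<bar>)" by (rule norm_le_l1_cart)
    also have "\<dots> \<le> (\<Sum>j\<in>(UNIV::'n set). K)" by (intro sum_mono e)
    finally show "norm (A $ i) \<le> real CARD('n) * K" by simp
  qed
  finally show ?thesis by simp
qed

lemma tendsto_matrix_vector_mult:
  fixes A :: "'c \<Rightarrow> real ^ 'n ^ 'm"
  assumes "(A \<longlongrightarrow> B) F" "(x \<longlongrightarrow> y) F"
  shows "((\<lambda>k. A k *v x k) \<longlongrightarrow> B *v y) F"
proof (rule vec_tendstoI)
  fix i
  show "((\<lambda>k. (A k *v x k) $ i) \<longlongrightarrow> (B *v y) $ i) F"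
    unfolding matrix_vector_mult_def vec_lambda_beta
    by (intro tendsto_sum tendsto_mult tendsto_vec_nth assms)
qed

lemma tendsto_transpose:
  fixes A :: "'c \<Rightarrow> real ^ 'n ^ 'm"
  assumes "(A \<longlongrightarrow> B) F"
  shows "((\<lambda>k. transpose (A k)) \<longlongrightarrow> transpose B) F"
proof (rule vec_tendstoI, rule vec_tendstoI)
  fix i j
  show "((\<lambda>k. transpose (A k) $ i $ j) \<longlongrightarrow> transpose B $ i $ j) F"
    unfolding transpose_def vec_lambda_beta by (intro tendsto_vec_nth assms)
qed

lemma inner_transpose:
  fixes A :: "real ^ 'n ^ 'm"
  shows "(transpose A *v w) \<bullet> x = w \<bullet> (A *v x)"
  by (simp only: transpose_matrix_vector dot_lmul_matrix)

lemma jacobian_has_derivative: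
  fixes h :: "real ^ 'n \<Rightarrow> real ^ 'm"
  assumes "h differentiable (at x)"
  shows "(h has_derivative (*v) (jacobian h (at x))) (at x)"
  using assms unfolding jacobian_works .

lemma derivative_norm_bound:
  fixes N :: "'a::euclidean_space \<Rightarrow> real" and M :: "'b::euclidean_space \<Rightarrow> real"
  assumes N: "is_norm N" and M: "is_norm M" and U: "open U" "x \<in> U"
    and K: "\<And>y. y \<in> U \<Longrightarrow> M (h y - h x) \<le> K * N (y - x)"
    and der: "(h has_derivative h') (at x)"
  shows "M (h' e) \<le> K * N e"
proof -
  interpret N: vnorm N by standard fact
  interpret M: vnorm M by standard fact
  have lin: "linear h'" using der by (rule has_derivative_linear)
  have line: "((\<lambda>\<tau>. x + \<tau> *\<^sub>R e) has_derivative (\<lambda>\<tau>. \<tau> *\<^sub>R e)) (at (0::real))"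
    by (auto intro!: derivative_eq_intros)
  have "((\<lambda>\<tau>. h (x + \<tau> *\<^sub>R e)) has_derivative (\<lambda>\<tau>. h' (\<tau> *\<^sub>R e))) (at (0::real))"
    using diff_chain_at[OF line, of h h'] der by (simp add: o_def)
  then have lim0: "((\<lambda>\<tau>. norm (h (x + \<tau> *\<^sub>R e) - h x - h' (\<tau> *\<^sub>R e)) / norm \<tau>) \<longlongrightarrow> 0) (at 0)"
    unfolding has_derivative_at by simp
  have "norm (h (x + \<tau> *\<^sub>R e) - h x - h' (\<tau> *\<^sub>R e)) / norm \<tau>
      = norm ((h (x + \<tau> *\<^sub>R e) - h x) /\<^sub>R \<tau> - h' e)" if "\<tau> \<noteq> 0" for \<tau> :: real
  proof -
    have "(h (x + \<tau> *\<^sub>R e) - h x) /\<^sub>R \<tau> - h' e = (h (x + \<tau> *\<^sub>R e) - h x - h' (\<tau> *\<^sub>R e)) /\<^sub>R \<tau>"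
      using that by (simp add: linear_scale[OF lin] scaleR_diff_right)
    then show ?thesis by (simp add: divide_inverse mult.commute)
  qed
  then have "\<forall>\<^sub>F \<tau> in at (0::real). norm (h (x + \<tau> *\<^sub>R e) - h x - h' (\<tau> *\<^sub>R e)) / norm \<tau>
      = norm ((h (x + \<tau> *\<^sub>R e) - h x) /\<^sub>R \<tau> - h' e)"
    unfolding eventually_at_filter by (intro always_eventually) blast
  then have "((\<lambda>\<tau>. norm ((h (x + \<tau> *\<^sub>R e) - h x) /\<^sub>R \<tau> - h' e)) \<longlongrightarrow> 0) (at 0)"
    by (rule Lim_transform_eventually[OF lim0])
  then have "((\<lambda>\<tau>. (h (x + \<tau> *\<^sub>R e) - h x) /\<^sub>R \<tau>) \<longlongrightarrow> h' e) (at 0)"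
    by (rule LIM_zero_cancel[OF tendsto_norm_zero_cancel])
  then have lim: "((\<lambda>\<tau>. (h (x + \<tau> *\<^sub>R e) - h x) /\<^sub>R \<tau>) \<longlongrightarrow> h' e) (at_right 0)"
    by (rule tendsto_within_subset) simp
  from eventually_ray_in_open[OF U, of e] eventually_at_right_less[of "0::real"]
  have "\<forall>\<^sub>F \<tau> in at_right 0. M ((h (x + \<tau> *\<^sub>R e) - h x) /\<^sub>R \<tau>) \<le> K * N e"
  proof eventually_elim
    case (elim \<tau>)
    then have "M (h (x + \<tau> *\<^sub>R e) - h x) \<le> K * (\<tau> * N e)"
      using K[of "x + \<tau> *\<^sub>R e"] by (simp add: N.scale)
    then show ?case using elim unfolding M.scale by (simp add: field_simps)
  qed
  then show ?thesis
    by (rule tendsto_upperbound[OF M.tendsto[OF lim]]) simp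
qed

text \<open>
  The extension is the composition with the nearest-point projection, which is nonexpansive.
\<close>

lemma lipschitz_extension_from_cball:
  fixes h :: "'a::euclidean_space \<Rightarrow> 'b::euclidean_space"
  assumes r: "0 < r" and lip: "L-lipschitz_on (cball x0 r) h"
  obtains f where "L-lipschitz_on UNIV f" "\<And>x. x \<in> cball x0 r \<Longrightarrow> f x = h x"
    "\<And>x h'. x \<in> ball x0 r \<Longrightarrow> (f has_derivative h') (at x) \<longleftrightarrow> (h has_derivative h') (at x)"
proof -
  define f where "f = (\<lambda>x. h (closest_point (cball x0 r) x))"
  have ne: "cball x0 r \<noteq> {}" using r by simp
  have in_c: "closest_point (cball x0 r) x \<in> cball x0 r" for x
    by (rule closest_point_in_set[OF closed_cball ne])
  have eq: "f x = h x" if "x \<in> cball x0 r" for x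
    using closest_point_self[OF that] by (simp add: f_def)
  have "L-lipschitz_on UNIV f"
  proof (rule lipschitz_onI[OF _ lipschitz_on_nonneg[OF lip]])
    fix x y
    have "dist (f x) (f y) \<le> L * dist (closest_point (cball x0 r) x) (closest_point (cball x0 r) y)"
      unfolding f_def by (rule lipschitz_onD[OF lip in_c in_c])
    also have "\<dots> \<le> L * dist x y"
      by (rule mult_left_mono[OF closest_point_lipschitz[OF convex_cball closed_cball ne] lipschitz_on_nonneg[OF lip]])
    finally show "dist (f x) (f y) \<le> L * dist x y" .
  qed
  moreover have "(f has_derivative h') (at x) \<longleftrightarrow> (h has_derivative h') (at x)" if x: "x \<in> ball x0 r" for x h'
    using has_derivative_transform_within_open[OF _ open_ball x, of f h' UNIV h]
      has_derivative_transform_within_open[OF _ open_ball x, of h h' UNIV f] eq by auto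
  ultimately show thesis using that eq by blast
qed

lemma jacobian_derivative:
  fixes h :: "real ^ 'n \<Rightarrow> real ^ 'm"
  assumes "(h has_derivative h') (at x)"
  shows "jacobian h (at x) *v e = h' e"
proof -
  have "h differentiable (at x)" using assms by (rule differentiableI)
  then have "(h has_derivative (\<lambda>v. jacobian h (at x) *v v)) (at x)" by (simp add: jacobian_works)
  from has_derivative_unique[OF this assms] show ?thesis by metis
qed

text \<open>
  The limits of Jacobians of which \<open>clarke_jacobian\<close> is the convex hull.
\<close>

definition jacobian_limits :: "(real ^ 'n \<Rightarrow> real ^ 'm) \<Rightarrow> real ^ 'n \<Rightarrow> (real ^ 'n ^ 'm) set" where
  "jacobian_limits h x = {V. \<exists>xs::nat \<Rightarrow> real ^ 'n. xs \<longlonglongrightarrow> x \<and> (\<forall>k. h differentiable (at (xs k))) \<and>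
       (\<lambda>k. jacobian h (at (xs k))) \<longlonglongrightarrow> V}"

lemma clarke_jacobian_hull: "clarke_jacobian h x = convex hull (jacobian_limits h x)"
  by (simp add: clarke_jacobian_def jacobian_limits_def)

lemma clarke_jacobian_bound:
  fixes h :: "real ^ 'n \<Rightarrow> real ^ 'm"
  assumes N: "is_norm N" and M: "is_norm M" and q: "q \<in> ball x0 r"
    and K: "\<And>x x'. \<lbrakk>x \<in> ball x0 r; x' \<in> ball x0 r\<rbrakk> \<Longrightarrow> M (h x - h x') \<le> K * N (x - x')"
    and V: "V \<in> clarke_jacobian h q"
  shows "M (V *v e) \<le> K * N e"
proof -
  interpret N: vnorm N by standard fact
  interpret M: vnorm M by standard fact
  have "M (V *v e) \<le> K * N e" if VJ: "V \<in> jacobian_limits h q" for V e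
  proof -
    obtain xs where xs: "xs \<longlonglongrightarrow> q" "\<And>k. h differentiable (at (xs k))" "(\<lambda>k. jacobian h (at (xs k))) \<longlonglongrightarrow> V"
      using VJ unfolding jacobian_limits_def by blast
    have "\<forall>\<^sub>F k in sequentially. M (jacobian h (at (xs k)) *v e) \<le> K * N e"
      using topological_tendstoD[OF xs(1) open_ball q]
    proof eventually_elim
      case (elim k)
      show ?case
        by (rule derivative_norm_bound[OF N M open_ball elim]) (use K elim in \<open>auto intro: jacobian_has_derivative[OF xs(2)]\<close>)
    qed
    moreover have "(\<lambda>k. M (jacobian h (at (xs k)) *v e)) \<longlonglongrightarrow> M (V *v e)"
      by (intro M.tendsto tendsto_matrix_vector_mult xs tendsto_const)
    ultimately show ?thesis by (intro tendsto_upperbound) auto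
  qed
  then have "jacobian_limits h q \<subseteq> {V. \<forall>e. M (V *v e) \<le> K * N e}" by blast
  moreover have "convex {V :: real ^ 'n ^ 'm. \<forall>e. M (V *v e) \<le> K * N e}"
    unfolding convex_def
  proof clarify
    fix A B :: "real ^ 'n ^ 'm" and a b :: real and e
    assume A: "\<forall>e. M (A *v e) \<le> K * N e" and B: "\<forall>e. M (B *v e) \<le> K * N e" and ab: "0 \<le> a" "0 \<le> b" "a + b = 1"
    have "M ((a *\<^sub>R A + b *\<^sub>R B) *v e) = M (a *\<^sub>R (A *v e) + b *\<^sub>R (B *v e))"
      by (simp add: matrix_vector_mult_add_rdistrib scaleR_matrix_vector_assoc)
    also have "\<dots> \<le> a * M (A *v e) + b * M (B *v e)"
      using M.triangle[of "a *\<^sub>R (A *v e)" "b *\<^sub>R (B *v e)"] ab by (simp add: M.scale)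
    also have "\<dots> \<le> a * (K * N e) + b * (K * N e)" using A B ab by (intro add_mono mult_left_mono) auto
    also have "\<dots> = K * N e" using ab by (simp add: distrib_right[symmetric])
    finally show "M ((a *\<^sub>R A + b *\<^sub>R B) *v e) \<le> K * N e" .
  qed
  ultimately have "clarke_jacobian h q \<subseteq> {V. \<forall>e. M (V *v e) \<le> K * N e}"
    unfolding clarke_jacobian_hull by (rule hull_minimal)
  then show ?thesis using V by blast
qed

text \<open>
  If every Jacobian near \<open>q\<close> had \<open>w \<bullet> (V *v e)\<close> clearly below \<open>\<kappa>\<close>, then \<open>lipschitz_increment_le\<close> would
  contradict the growth of \<open>w \<bullet> h\<close> along \<open>e\<close>. So there are points of differentiability
  arbitrarily close to \<open>q\<close> with almost the required value, and their bounded Jacobians accumulate.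
\<close>

lemma clarke_jacobian_direction:
  fixes h :: "real ^ 'n \<Rightarrow> real ^ 'm"
  assumes r: "0 < r" and lip: "L-lipschitz_on (cball x0 r) h" and q: "q \<in> ball x0 r"
    and growth: "\<And>\<eta>. 0 < \<eta> \<Longrightarrow> \<forall>\<^sub>F \<tau> in at_right 0. \<tau> * (\<kappa> - \<eta>) \<le> w \<bullet> (h (q + \<tau> *\<^sub>R e) - h q)"
  shows "\<exists>V\<in>clarke_jacobian h q. \<kappa> \<le> w \<bullet> (V *v e)"
proof -
  obtain f where f: "L-lipschitz_on UNIV f" "\<And>x. x \<in> cball x0 r \<Longrightarrow> f x = h x"
    "\<And>x h'. x \<in> ball x0 r \<Longrightarrow> (f has_derivative h') (at x) \<longleftrightarrow> (h has_derivative h') (at x)"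
    by (rule lipschitz_extension_from_cball[OF r lip]) blast
  have "\<exists>x. x \<in> ball x0 r \<and> dist x q < 1 / Suc n \<and> h differentiable (at x) \<and>
      \<kappa> - 2 / Suc n < w \<bullet> (jacobian h (at x) *v e)" for n
  proof (rule ccontr)
    assume contra: "\<not> ?thesis"
    define \<eta> where "\<eta> = 1 / real (Suc n)"
    have \<eta>: "0 < \<eta>" by (simp add: \<eta>_def)
    define W where "W = ball x0 r \<inter> ball q \<eta>"
    have W: "open W" "q \<in> W" using q \<eta> by (auto simp: W_def)
    then obtain s where s: "0 < s" "ball q s \<subseteq> W" by (meson openE)
    have "((\<lambda>\<tau>. \<tau> * norm e) \<longlongrightarrow> 0 * norm e) (at_right 0)" by (intro tendsto_intros)
    then have "\<forall>\<^sub>F \<tau> in at_right 0. \<tau> * norm e < s" using s by (intro order_tendstoD(2)[of _ "0 * norm e"]) auto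
    then have "\<forall>\<^sub>F \<tau> in at_right 0. 0 < \<tau> \<and> \<tau> * norm e < s \<and> \<tau> * (\<kappa> - \<eta>) \<le> w \<bullet> (h (q + \<tau> *\<^sub>R e) - h q)"
      by (intro eventually_conj eventually_at_right_less growth \<eta>)
    then obtain \<tau> where \<tau>: "0 < \<tau>" "\<tau> * norm e < s" "\<tau> * (\<kappa> - \<eta>) \<le> w \<bullet> (h (q + \<tau> *\<^sub>R e) - h q)"
      using eventually_happens'[OF trivial_limit_at_right_real] by blast
    have seg: "q + \<sigma> *\<^sub>R e \<in> W" if "0 \<le> \<sigma>" "\<sigma> \<le> \<tau>" for \<sigma>
    proof -
      have "\<sigma> * norm e \<le> \<tau> * norm e" using that by (intro mult_right_mono) auto
      then have "q + \<sigma> *\<^sub>R e \<in> ball q s" using \<tau> that by (simp add: dist_norm)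
      then show ?thesis using s by blast
    qed
    have "w \<bullet> (f (q + \<tau> *\<^sub>R e) - f q) \<le> (\<kappa> - 2 * \<eta>) * \<tau>"
    proof (rule lipschitz_increment_le[OF f(1) W(1) _ seg])
      fix x assume x: "x \<in> W" "f differentiable (at x)"
      have "(f has_derivative frechet_derivative f (at x)) (at x)" using x by (simp add: frechet_derivative_works)
      then have hd: "(h has_derivative frechet_derivative f (at x)) (at x)" using f(3)[of x] x by (simp add: W_def)
      have "\<not> \<kappa> - 2 * \<eta> < w \<bullet> (jacobian h (at x) *v e)"
        using contra x hd unfolding W_def \<eta>_def by (auto simp: dist_commute differentiableI simp del: of_nat_Suc)
      then show "w \<bullet> frechet_derivative f (at x) e \<le> \<kappa> - 2 * \<eta>" using jacobian_derivative[OF hd] by simp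
    qed (use \<tau> in auto)
    moreover have "f (q + \<tau> *\<^sub>R e) = h (q + \<tau> *\<^sub>R e)" "f q = h q"
      using seg[of \<tau>] q \<tau>(1) f(2) by (auto simp: W_def less_imp_le)
    ultimately have "\<tau> * (\<kappa> - \<eta>) \<le> (\<kappa> - 2 * \<eta>) * \<tau>" using \<tau>(3) by simp
    then have "\<tau> * \<eta> \<le> 0" by (simp add: algebra_simps)
    then show False using \<tau>(1) \<eta> by (simp add: mult_le_0_iff)
  qed
  then obtain X where X: "\<And>n. X n \<in> ball x0 r" "\<And>n. dist (X n) q < 1 / Suc n" "\<And>n. h differentiable (at (X n))"
    "\<And>n. \<kappa> - 2 / Suc n < w \<bullet> (jacobian h (at (X n)) *v e)" by metis
  have X1c: "X n \<in> cball x0 r" for n using X(1)[of n] by (simp add: less_imp_le)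
  have Jb: "norm (jacobian h (at (X n)) *v x) \<le> L * norm x" for n x
    by (rule derivative_norm_bound[OF is_norm_norm is_norm_norm open_ball X(1)[of n], of h])
      (use lipschitz_onD[OF lip _ X1c] X1c in \<open>auto intro: jacobian_has_derivative[OF X(3)] simp: dist_norm less_imp_le\<close>)
  have "bounded (range (\<lambda>n. jacobian h (at (X n))))"
    unfolding bounded_iff using norm_matrix_le[OF Jb] by blast
  then obtain V \<sigma> where V: "strict_mono (\<sigma>::nat \<Rightarrow> nat)" "((\<lambda>n. jacobian h (at (X n))) \<circ> \<sigma>) \<longlonglongrightarrow> V"
    using bounded_imp_convergent_subsequence by blast
  have "(\<lambda>n. X n - q) \<longlonglongrightarrow> 0"
    by (rule Lim_null_comparison[OF always_eventually LIMSEQ_one_over_Suc]) (use X(2) less_imp_le in \<open>auto simp: dist_norm\<close>)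
  then have "X \<longlonglongrightarrow> q" by (rule LIM_zero_cancel)
  then have "(X \<circ> \<sigma>) \<longlonglongrightarrow> q" using V(1) by (rule LIMSEQ_subseq_LIMSEQ)
  then have "V \<in> jacobian_limits h q"
    unfolding jacobian_limits_def using V(2) X(3) by (auto simp: o_def intro!: exI[of _ "X \<circ> \<sigma>"])
  then have VC: "V \<in> clarke_jacobian h q" unfolding clarke_jacobian_hull by (rule hull_inc)
  have "(\<lambda>n. \<kappa> - 2 * (1 / real (Suc (\<sigma> n)))) \<longlonglongrightarrow> \<kappa> - 2 * 0"
    using LIMSEQ_subseq_LIMSEQ[OF LIMSEQ_one_over_Suc V(1)] by (intro tendsto_intros) (simp add: o_def)
  moreover have "(\<lambda>n. w \<bullet> (jacobian h (at (X (\<sigma> n))) *v e)) \<longlonglongrightarrow> w \<bullet> (V *v e)"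
    using V(2) by (intro tendsto_inner tendsto_matrix_vector_mult tendsto_const) (simp add: o_def)
  ultimately have "\<kappa> - 2 * 0 \<le> w \<bullet> (V *v e)"
    using X(4) by (intro LIMSEQ_le) (auto intro!: exI[of _ 0] less_imp_le)
  then show ?thesis using VC by auto
qed

text \<open>
  The hypothesis provides a matrix for each direction \<open>e\<close> separately, the conclusion one matrix for
  all directions. If the convex set of vectors \<open>transpose V *v w + u\<close> missed the ball of radius \<open>\<epsilon>'\<close>, a
  separating hyperplane would give a direction that contradicts the hypothesis.
\<close>

lemma clarke_jacobian_adjoint:
  fixes h :: "real ^ 'n \<Rightarrow> real ^ 'm"
  assumes \<epsilon>: "0 \<le> \<epsilon>" "\<epsilon> < \<epsilon>'"
    and dir: "\<And>e. \<exists>V\<in>clarke_jacobian h q. - (u \<bullet> e) - \<epsilon> * norm e \<le> w \<bullet> (V *v e)"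
  shows "\<exists>V\<in>clarke_jacobian h q. norm (transpose V *v w + u) \<le> \<epsilon>'"
proof (rule ccontr)
  assume contra: "\<not> ?thesis"
  define T where "T = (\<lambda>V. transpose V *v w + u) ` clarke_jacobian h q"
  have "convex (clarke_jacobian h q)" unfolding clarke_jacobian_hull by (rule convex_convex_hull)
  moreover have "linear (\<lambda>V :: real ^ 'n ^ 'm. transpose V *v w)"
    by (rule linearI) (simp_all add: vec_eq_iff matrix_vector_mult_def transpose_def sum.distrib sum_distrib_left algebra_simps)
  ultimately have "convex ((\<lambda>V. transpose V *v w) ` clarke_jacobian h q)" by (intro convex_linear_image)
  then have "convex ((\<lambda>x. u + x) ` ((\<lambda>V. transpose V *v w) ` clarke_jacobian h q))" by (rule convex_translation)
  then have "convex T" by (simp add: T_def image_image add.commute)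
  moreover have "T \<noteq> {}" using dir[of 0] by (auto simp: T_def)
  moreover have "T \<inter> cball 0 \<epsilon>' = {}" using contra by (auto simp: T_def)
  moreover have "cball (0 :: real ^ 'n) \<epsilon>' \<noteq> {}" using \<epsilon> by simp
  ultimately have "\<exists>a b. a \<noteq> 0 \<and> (\<forall>x\<in>T. a \<bullet> x \<le> b) \<and> (\<forall>x\<in>cball 0 \<epsilon>'. b \<le> a \<bullet> x)"
    using separating_hyperplane_sets[OF _ convex_cball] by blast
  then obtain a b where ab: "a \<noteq> 0" "\<And>x. x \<in> T \<Longrightarrow> a \<bullet> x \<le> b" "\<And>x. x \<in> cball 0 \<epsilon>' \<Longrightarrow> b \<le> a \<bullet> x"
    by blast
  have "b \<le> a \<bullet> ((- \<epsilon>' / norm a) *\<^sub>R a)" by (rule ab(3)) (use ab(1) \<epsilon> in simp)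
  also have "\<dots> = - \<epsilon>' * norm a" using ab(1) by (simp add: power2_norm_eq_inner[symmetric] power2_eq_square)
  finally have b: "b \<le> - \<epsilon>' * norm a" .
  obtain V where V: "V \<in> clarke_jacobian h q" "- (u \<bullet> a) - \<epsilon> * norm a \<le> w \<bullet> (V *v a)" using dir by blast
  have "a \<bullet> (transpose V *v w + u) \<le> b" by (rule ab(2)) (use V in \<open>simp add: T_def\<close>)
  then have "w \<bullet> (V *v a) + u \<bullet> a \<le> - \<epsilon>' * norm a"
    using b inner_transpose[of V w a] by (simp add: inner_add_right inner_commute)
  then have "\<epsilon>' * norm a \<le> \<epsilon> * norm a" using V(2) by linarith
  then show False using ab(1) \<epsilon> by simp
qed

section \<open>Semismooth perturbations\<close>

text \<open>
  Near the ray from \<open>x0\<close> in the direction \<open>u\<close> all Jacobians send vectors close to \<open>u\<close> to vectors close to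
  \<open>l\<close>. The mean value inequality along the segments from near \<open>x0\<close> to \<open>x0 + t k *\<^sub>R p k\<close>, which lie in
  an open cone around the ray, transfers this to the difference quotients.
\<close>

lemma semismooth_directional_limit:
  fixes h :: "real ^ 'n \<Rightarrow> real ^ 'm"
  assumes r: "0 < r" and lip: "L-lipschitz_on (cball x0 r) h" and h0: "h x0 = 0"
    and l: "\<And>\<epsilon>. 0 < \<epsilon> \<Longrightarrow> \<forall>\<^sub>F (u', t) in nhds u \<times>\<^sub>F at_right (0::real).
        \<forall>V\<in>clarke_jacobian h (x0 + t *\<^sub>R u'). dist (V *v u') l < \<epsilon>"
    and t: "\<And>k. 0 < t k" "t \<longlonglongrightarrow> (0::real)" and p: "p \<longlonglongrightarrow> u"
  shows "(\<lambda>k. h (x0 + t k *\<^sub>R p k) /\<^sub>R t k) \<longlonglongrightarrow> l"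
proof (rule LIMSEQ_I)
  fix \<epsilon>0 :: real assume \<epsilon>0: "0 < \<epsilon>0"
  define \<epsilon> where "\<epsilon> = \<epsilon>0 / 4"
  have \<epsilon>: "0 < \<epsilon>" using \<epsilon>0 by (simp add: \<epsilon>_def)
  have L: "0 \<le> L" using lip by (rule lipschitz_on_nonneg)
  obtain f where f: "L-lipschitz_on UNIV f" "\<And>x. x \<in> cball x0 r \<Longrightarrow> f x = h x"
    "\<And>x h'. x \<in> ball x0 r \<Longrightarrow> (f has_derivative h') (at x) \<longleftrightarrow> (h has_derivative h') (at x)"
    by (rule lipschitz_extension_from_cball[OF r lip]) blast
  obtain Pf Pg where PP: "eventually Pf (nhds u)" "eventually Pg (at_right (0::real))"
    "\<And>u' t. Pf u' \<Longrightarrow> Pg t \<Longrightarrow> \<forall>V\<in>clarke_jacobian h (x0 + t *\<^sub>R u'). dist (V *v u') l < \<epsilon>"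
    using l[OF \<epsilon>] unfolding eventually_prod_filter by auto
  obtain \<delta>1 where \<delta>1: "0 < \<delta>1" "\<And>u'. dist u' u < \<delta>1 \<Longrightarrow> Pf u'"
    using PP(1) unfolding eventually_nhds_metric by blast
  obtain \<delta>2 where \<delta>2: "0 < \<delta>2" "\<And>s. 0 < s \<Longrightarrow> s < \<delta>2 \<Longrightarrow> Pg s"
    using PP(2) unfolding eventually_at_right_field by blast
  define \<delta> where "\<delta> = min \<delta>1 (\<epsilon> / (2 * L + 1))"
  have \<delta>: "0 < \<delta>" "\<delta> \<le> \<delta>1" "2 * L * \<delta> \<le> \<epsilon>"
  proof -
    show "0 < \<delta>" "\<delta> \<le> \<delta>1" using \<delta>1 \<epsilon> L by (auto simp: \<delta>_def)
    have "2 * L * \<delta> \<le> 2 * L * (\<epsilon> / (2 * L + 1))" using L by (intro mult_left_mono) (auto simp: \<delta>_def)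
    also have "\<dots> \<le> \<epsilon>" using L \<epsilon> by (simp add: field_simps)
    finally show "2 * L * \<delta> \<le> \<epsilon>" .
  qed
  \<comment> \<open>The open cone excludes the apex \<open>x0\<close>, where nothing is known about Jacobians; segments start at \<open>s > 0\<close> and \<open>s\<close> tends to \<open>0\<close>.\<close>
  define W where "W = (\<Union>s\<in>{0<..<\<delta>2}. ball (x0 + s *\<^sub>R u) (s * \<delta>)) \<inter> ball x0 r"
  have W: "open W" by (auto simp: W_def)
  have Wder: "w \<bullet> (frechet_derivative f (at x) e) \<le> w \<bullet> l + 2 * \<epsilon> * norm w"
    if x: "x \<in> W" "f differentiable (at x)" and e: "dist e u < \<delta>" for x w e
  proof -
    obtain s where s: "0 < s" "s < \<delta>2" "x \<in> ball (x0 + s *\<^sub>R u) (s * \<delta>)" and xr: "x \<in> ball x0 r"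
      using x(1) by (auto simp: W_def simp del: mem_ball)
    define u' where "u' = (x - x0) /\<^sub>R s"
    have xu: "x = x0 + s *\<^sub>R u'" using s by (simp add: u'_def)
    have "s * norm (u' - u) < s * \<delta>"
      using s by (simp add: xu dist_norm scaleR_diff_right[symmetric] norm_minus_commute)
    then have uu: "norm (u' - u) < \<delta>" using s by simp
    have "(f has_derivative frechet_derivative f (at x)) (at x)" using x by (simp add: frechet_derivative_works)
    then have hd: "(h has_derivative frechet_derivative f (at x)) (at x)" using f(3)[OF xr] by simp
    define J where "J = jacobian h (at x)"
    have "J \<in> jacobian_limits h x"
      unfolding jacobian_limits_def J_def using hd by (auto intro!: exI[of _ "\<lambda>_. x"] simp: differentiableI)
    then have "J \<in> clarke_jacobian h (x0 + s *\<^sub>R u')"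
      unfolding clarke_jacobian_hull xu[symmetric] by (rule hull_inc)
    then have Jl: "norm (J *v u' - l) < \<epsilon>"
      using PP(3)[OF \<delta>1(2) \<delta>2(2), of u' s] uu \<delta> s by (auto simp: dist_norm)
    have "norm (J *v (e - u')) \<le> L * norm (e - u')"
      unfolding J_def
      by (rule derivative_norm_bound[OF is_norm_norm is_norm_norm open_ball xr, of h])
        (use lipschitz_onD[OF lip, of _ x] xr in \<open>auto intro!: jacobian_has_derivative differentiableI[OF hd] simp: dist_norm less_imp_le\<close>)
    also have "\<dots> \<le> L * (2 * \<delta>)"
    proof (rule mult_left_mono[OF _ L])
      show "norm (e - u') \<le> 2 * \<delta>"
        using norm_triangle_ineq4[of "e - u" "u' - u"] uu e by (simp add: dist_norm)
    qed
    finally have Jeu: "norm (J *v (e - u')) \<le> \<epsilon>" using \<delta>(3) by simp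
    have eq: "J *v e - l = J *v (e - u') + (J *v u' - l)" by (simp add: matrix_vector_mult_diff_distrib)
    have "norm (J *v e - l) \<le> norm (J *v (e - u')) + norm (J *v u' - l)"
      unfolding eq by (rule norm_triangle_ineq)
    then have "norm (J *v e - l) \<le> 2 * \<epsilon>" using Jeu Jl by linarith
    then have "w \<bullet> (J *v e - l) \<le> norm w * (2 * \<epsilon>)"
      using norm_cauchy_schwarz[of w "J *v e - l"] mult_left_mono[of "norm (J *v e - l)" "2 * \<epsilon>" "norm w"] by simp
    then show ?thesis using jacobian_derivative[OF hd, of e] by (simp add: J_def inner_diff_right mult_ac)
  qed
  have est: "norm (h (x0 + \<tau> *\<^sub>R e) /\<^sub>R \<tau> - l) \<le> 2 * \<epsilon>"
    if e: "dist e u < \<delta>" and \<tau>: "0 < \<tau>" "\<tau> < \<delta>2" "\<tau> * norm e < r" for e \<tau>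
  proof -
    have inb: "x0 + s *\<^sub>R e \<in> ball x0 r" if "0 \<le> s" "s \<le> \<tau>" for s
    proof -
      have "s * norm e \<le> \<tau> * norm e" using that by (intro mult_right_mono) auto
      then show ?thesis using that \<tau> by (simp add: dist_norm)
    qed
    have main: "w \<bullet> h (x0 + \<tau> *\<^sub>R e) \<le> (w \<bullet> l + 2 * \<epsilon> * norm w) * \<tau>" for w
    proof -
      have inc: "w \<bullet> (f (x0 + \<tau> *\<^sub>R e) - f (x0 + s *\<^sub>R e)) \<le> (w \<bullet> l + 2 * \<epsilon> * norm w) * (\<tau> - s)"
        if s: "0 < s" "s < \<tau>" for s
      proof -
        have "w \<bullet> (f ((x0 + s *\<^sub>R e) + (\<tau> - s) *\<^sub>R e) - f (x0 + s *\<^sub>R e)) \<le> (w \<bullet> l + 2 * \<epsilon> * norm w) * (\<tau> - s)"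
        proof (rule lipschitz_increment_le[OF f(1) W])
          fix \<sigma> assume \<sigma>: "0 \<le> \<sigma>" "\<sigma> \<le> \<tau> - s"
          have "dist (x0 + (s + \<sigma>) *\<^sub>R u) (x0 + (s + \<sigma>) *\<^sub>R e) = (s + \<sigma>) * dist e u"
            using s \<sigma> by (simp add: dist_norm scaleR_diff_right[symmetric] norm_minus_commute)
          also have "\<dots> < (s + \<sigma>) * \<delta>" using s \<sigma> e by (intro mult_strict_left_mono) auto
          finally have "x0 + (s + \<sigma>) *\<^sub>R e \<in> ball (x0 + (s + \<sigma>) *\<^sub>R u) ((s + \<sigma>) * \<delta>)" by simp
          moreover have "s + \<sigma> \<in> {0<..<\<delta>2}" using s \<sigma> \<tau> by simp
          moreover have "x0 + (s + \<sigma>) *\<^sub>R e \<in> ball x0 r" using s \<sigma> by (intro inb) auto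
          ultimately have "x0 + (s + \<sigma>) *\<^sub>R e \<in> W" unfolding W_def by blast
          then show "x0 + s *\<^sub>R e + \<sigma> *\<^sub>R e \<in> W" by (simp add: scaleR_left_distrib add.assoc)
        qed (use s Wder e in auto)
        then show ?thesis by (simp add: scaleR_left_diff_distrib)
      qed
      have "((\<lambda>s. w \<bullet> (f (x0 + \<tau> *\<^sub>R e) - f (x0 + s *\<^sub>R e))) \<longlongrightarrow> w \<bullet> (f (x0 + \<tau> *\<^sub>R e) - f (x0 + 0 *\<^sub>R e))) (at_right 0)"
      proof -
        have "isCont f (x0 + 0 *\<^sub>R e)" using lipschitz_on_continuous_on[OF f(1)] by (simp add: continuous_on_eq_continuous_at)
        moreover have "((\<lambda>s. x0 + s *\<^sub>R e) \<longlongrightarrow> x0 + 0 *\<^sub>R e) (at_right 0)" by (intro tendsto_intros)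
        ultimately have "((\<lambda>s. f (x0 + s *\<^sub>R e)) \<longlongrightarrow> f (x0 + 0 *\<^sub>R e)) (at_right 0)"
          by (rule isCont_tendsto_compose)
        then show ?thesis by (intro tendsto_intros)
      qed
      moreover have "((\<lambda>s. (w \<bullet> l + 2 * \<epsilon> * norm w) * (\<tau> - s)) \<longlongrightarrow> (w \<bullet> l + 2 * \<epsilon> * norm w) * (\<tau> - 0)) (at_right 0)"
        by (intro tendsto_intros)
      moreover have "\<forall>\<^sub>F s in at_right 0. w \<bullet> (f (x0 + \<tau> *\<^sub>R e) - f (x0 + s *\<^sub>R e)) \<le> (w \<bullet> l + 2 * \<epsilon> * norm w) * (\<tau> - s)"
        using eventually_at_right_less[of 0] eventually_at_right_real[OF \<tau>(1)]
        by eventually_elim (use inc in auto)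
      ultimately have "w \<bullet> (f (x0 + \<tau> *\<^sub>R e) - f (x0 + 0 *\<^sub>R e)) \<le> (w \<bullet> l + 2 * \<epsilon> * norm w) * (\<tau> - 0)"
        by (intro tendsto_le[OF trivial_limit_at_right_real])
      moreover have "f (x0 + \<tau> *\<^sub>R e) = h (x0 + \<tau> *\<^sub>R e)" "f x0 = 0"
        using inb[of \<tau>] \<tau>(1) f(2) r h0 by (auto simp: less_imp_le)
      ultimately show ?thesis by simp
    qed
    \<comment> \<open>Testing \<open>main\<close> with the error itself turns the one-sided bounds into a bound for its norm.\<close>
    define w where "w = h (x0 + \<tau> *\<^sub>R e) /\<^sub>R \<tau> - l"
    have hw: "h (x0 + \<tau> *\<^sub>R e) = \<tau> *\<^sub>R (w + l)" using \<tau> by (simp add: w_def)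
    have "\<tau> * (w \<bullet> (w + l)) \<le> \<tau> * (w \<bullet> l + 2 * \<epsilon> * norm w)" using main[of w] unfolding hw by (simp add: mult.commute)
    then have "w \<bullet> w \<le> 2 * \<epsilon> * norm w" using \<tau>(1) by (simp add: inner_add_right)
    then have "norm w * norm w \<le> 2 * \<epsilon> * norm w" by (simp add: power2_norm_eq_inner[symmetric] power2_eq_square)
    then have "norm w \<le> 2 * \<epsilon>" using \<epsilon> by (cases "w = 0") auto
    then show ?thesis by (simp add: w_def)
  qed
  have "(\<lambda>k. t k * norm (p k)) \<longlonglongrightarrow> 0 * norm u" by (intro tendsto_intros t p)
  then have "\<forall>\<^sub>F k in sequentially. t k * norm (p k) < r" using r by (intro order_tendstoD(2)[of _ "0 * norm u"]) auto
  moreover have "\<forall>\<^sub>F k in sequentially. t k < \<delta>2" using t(2) \<delta>2(1) by (rule order_tendstoD(2))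
  moreover have "\<forall>\<^sub>F k in sequentially. dist (p k) u < \<delta>" using p \<delta>(1) by (rule tendstoD)
  ultimately have "\<forall>\<^sub>F k in sequentially. norm (h (x0 + t k *\<^sub>R p k) /\<^sub>R t k - l) < \<epsilon>0"
  proof eventually_elim
    case (elim k)
    have "norm (h (x0 + t k *\<^sub>R p k) /\<^sub>R t k - l) \<le> 2 * \<epsilon>" using est elim t(1) by blast
    then show ?case using \<epsilon>0 by (simp add: \<epsilon>_def)
  qed
  then show "\<exists>no. \<forall>n\<ge>no. norm (h (x0 + t n *\<^sub>R p n) /\<^sub>R t n - l) < \<epsilon>0" by (simp add: eventually_sequentially)
qed

text \<open>
  The limit \<open>B\<close> of Clarke matrices satisfies \<open>transpose B *v v' = - u'\<close> and, by semismoothness,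
  \<open>B *v u = - v\<close>. Thus \<open>- B\<close> is a competitor for \<open>rg_circ\<close>, and it inherits the bound \<open>K\<close> from the
  Jacobians of \<open>h\<close>.
\<close>

lemma rg_circ_le_of_nonsubregular:
  fixes F :: "real ^ 'n \<Rightarrow> (real ^ 'm) set" and N :: "real ^ 'n \<Rightarrow> real" and M :: "real ^ 'm \<Rightarrow> real"
  assumes N: "is_norm N" and M: "is_norm M" and clF: "closed (gph F)" and F0: "(x0, y0) \<in> gph F"
    and r: "0 < r" and lip: "L-lipschitz_on (cball x0 r) h" and h0: "h x0 = 0"
    and nsr: "\<not> metrically_subregular N M (\<lambda>x. (\<lambda>y. y + h x) ` F x) x0 y0"
    and K: "0 \<le> K" "\<And>x x'. \<lbrakk>x \<in> ball x0 r; x' \<in> ball x0 r\<rbrakk> \<Longrightarrow> M (h x - h x') \<le> K * N (x - x')"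
    and ss: "\<And>u. \<exists>l. \<forall>\<epsilon>>0. \<forall>\<^sub>F (u', t) in nhds u \<times>\<^sub>F at_right (0::real).
        \<forall>V\<in>clarke_jacobian h (x0 + t *\<^sub>R u'). dist (V *v u') l < \<epsilon>"
  shows "rg_circ N M F x0 y0 \<le> ereal K"
proof -
  interpret N: vnorm N by standard fact
  interpret M: vnorm M by standard fact
  obtain t :: "nat \<Rightarrow> real" and p U V E u v u' v' where
    t: "\<And>k. 0 < t k" "t \<longlonglongrightarrow> 0" and p: "p \<longlonglongrightarrow> u" "N u = 1" and U: "U \<longlonglongrightarrow> u'" and V: "V \<longlonglongrightarrow> v'" "norm v' = 1" and
    pdd: "(u', v) \<in> primal_dual_derivative F x0 y0 u v'" and E: "E \<longlonglongrightarrow> 0" and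
    hv: "(\<lambda>k. h (x0 + t k *\<^sub>R p k) /\<^sub>R t k) \<longlonglongrightarrow> - v" and ball: "\<And>k. x0 + t k *\<^sub>R p k \<in> ball x0 r" and
    first: "\<And>k e \<eta>. 0 < \<eta> \<Longrightarrow> \<forall>\<^sub>F \<tau> in at_right 0. - ((E k * norm e + \<eta>) * \<tau>) \<le>
       \<tau> * (U k \<bullet> e) + V k \<bullet> (h (x0 + t k *\<^sub>R p k + \<tau> *\<^sub>R e) - h (x0 + t k *\<^sub>R p k))"
    by (rule nonsubregular_limit[OF N M clF F0 r lip h0 nsr]) blast
  define q where "q k = x0 + t k *\<^sub>R p k" for k
  \<comment> \<open>The summand \<open>t k\<close> provides the strict inequality needed for separation.\<close>
  define \<epsilon> where "\<epsilon> k = \<bar>E k\<bar> + t k" for k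
  have "\<exists>A\<in>clarke_jacobian h (q k). norm (transpose A *v V k + U k) \<le> \<epsilon> k" for k
  proof (rule clarke_jacobian_adjoint)
    show "0 \<le> \<bar>E k\<bar>" "\<bar>E k\<bar> < \<epsilon> k" using t(1)[of k] by (auto simp: \<epsilon>_def)
    fix e
    have "\<exists>A\<in>clarke_jacobian h (q k). - (U k \<bullet> e) - E k * norm e \<le> V k \<bullet> (A *v e)"
    proof (rule clarke_jacobian_direction[OF r lip])
      show "q k \<in> ball x0 r" using ball by (simp add: q_def)
      fix \<eta> :: real assume \<eta>: "0 < \<eta>"
      show "\<forall>\<^sub>F \<tau> in at_right 0. \<tau> * (- (U k \<bullet> e) - E k * norm e - \<eta>) \<le> V k \<bullet> (h (q k + \<tau> *\<^sub>R e) - h (q k))"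
        using first[OF \<eta>, where k = k and e = e] unfolding q_def[symmetric]
        by eventually_elim (simp add: algebra_simps)
    qed
    moreover have "E k * norm e \<le> \<bar>E k\<bar> * norm e" by (intro mult_right_mono) auto
    ultimately show "\<exists>A\<in>clarke_jacobian h (q k). - (U k \<bullet> e) - \<bar>E k\<bar> * norm e \<le> V k \<bullet> (A *v e)" by force
  qed
  then obtain A where A: "\<And>k. A k \<in> clarke_jacobian h (q k)" "\<And>k. norm (transpose (A k) *v V k + U k) \<le> \<epsilon> k" by metis
  obtain cM where cM: "0 < cM" "\<And>x. norm x \<le> cM * M x" using M.lower by blast
  obtain CN where CN: "0 < CN" "\<And>x. N x \<le> CN * norm x" using N.upper by blast
  have AK: "M (A k *v e) \<le> K * N e" for k e
    by (rule clarke_jacobian_bound[OF N M _ K(2) A(1)]) (use ball in \<open>auto simp: q_def\<close>)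
  have An: "norm (A k *v x) \<le> (cM * K * CN) * norm x" for k x
  proof -
    have "norm (A k *v x) \<le> cM * M (A k *v x)" by (rule cM)
    also have "\<dots> \<le> cM * (K * N x)" using AK cM by (intro mult_left_mono) auto
    also have "\<dots> \<le> cM * (K * (CN * norm x))" using CN(2) K(1) cM by (intro mult_left_mono) auto
    finally show ?thesis by (simp add: mult_ac)
  qed
  have "bounded (range A)" unfolding bounded_iff using norm_matrix_le[OF An] by blast
  then obtain B \<sigma> where B: "strict_mono (\<sigma>::nat \<Rightarrow> nat)" "(A \<circ> \<sigma>) \<longlonglongrightarrow> B"
    using bounded_imp_convergent_subsequence by blast
  have B': "(\<lambda>k. A (\<sigma> k)) \<longlonglongrightarrow> B" using B(2) by (simp add: o_def)
  have sub: "(\<lambda>k. X (\<sigma> k)) \<longlonglongrightarrow> x" if "X \<longlonglongrightarrow> x" for X :: "nat \<Rightarrow> 'z::topological_space" and x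
    using LIMSEQ_subseq_LIMSEQ[OF that B(1)] by (simp add: o_def)
  have BK: "M (B *v e) \<le> K * N e" for e
    by (rule tendsto_upperbound[OF M.tendsto[OF tendsto_matrix_vector_mult[OF B' tendsto_const]]]) (use AK in auto)
  have "\<epsilon> \<longlonglongrightarrow> \<bar>0\<bar> + 0" unfolding \<epsilon>_def by (intro tendsto_intros E t)
  then have \<epsilon>0: "(\<lambda>k. \<epsilon> (\<sigma> k)) \<longlonglongrightarrow> 0" by (intro sub) simp
  have "(\<lambda>k. transpose (A (\<sigma> k)) *v V (\<sigma> k) + U (\<sigma> k)) \<longlonglongrightarrow> transpose B *v v' + u'"
    by (intro tendsto_add tendsto_matrix_vector_mult tendsto_transpose B' sub V U)
  moreover have "(\<lambda>k. transpose (A (\<sigma> k)) *v V (\<sigma> k) + U (\<sigma> k)) \<longlonglongrightarrow> 0"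
    by (rule Lim_null_comparison[OF always_eventually \<epsilon>0]) (use A(2) in blast)
  ultimately have Bt: "transpose B *v v' + u' = 0" using LIMSEQ_unique by blast
  obtain l where l: "\<And>\<epsilon>. 0 < \<epsilon> \<Longrightarrow> \<forall>\<^sub>F (u', t) in nhds u \<times>\<^sub>F at_right (0::real).
        \<forall>V\<in>clarke_jacobian h (x0 + t *\<^sub>R u'). dist (V *v u') l < \<epsilon>" using ss by blast
  have lv: "l = - v"
    using LIMSEQ_unique[OF semismooth_directional_limit[OF r lip h0 l t p(1)] hv] by simp
  have "(\<lambda>k. A k *v p k) \<longlonglongrightarrow> l"
  proof (rule tendstoI)
    fix \<epsilon> :: real assume "0 < \<epsilon>"
    have "filterlim t (at_right 0) sequentially"
      by (rule tendsto_imp_filterlim_at_right[OF t(2)]) (use t(1) in auto)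
    then have "filterlim (\<lambda>k. (p k, t k)) (nhds u \<times>\<^sub>F at_right 0) sequentially" using p(1) by (intro filterlim_Pair)
    from eventually_compose_filterlim[OF l[OF \<open>0 < \<epsilon>\<close>] this]
    show "\<forall>\<^sub>F k in sequentially. dist (A k *v p k) l < \<epsilon>"
      by eventually_elim (use A(1) in \<open>auto simp: q_def\<close>)
  qed
  then have "(\<lambda>k. A (\<sigma> k) *v p (\<sigma> k)) \<longlonglongrightarrow> l" by (rule sub)
  moreover have "(\<lambda>k. A (\<sigma> k) *v p (\<sigma> k)) \<longlonglongrightarrow> B *v u" by (intro tendsto_matrix_vector_mult B' sub p)
  ultimately have Bu: "B *v u = - v" using LIMSEQ_unique lv by blast
  define m where "m = dual_norm M v'"
  have m: "0 < m" unfolding m_def using V by (intro M.dual_pos) auto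
  define C where "C = - B"
  have Cv: "C *v x = - (B *v x)" for x by (simp add: C_def vec_eq_iff matrix_vector_mult_def sum_negf)
  have Cu: "C *v u = v" using Bu by (simp add: Cv)
  have Ct: "transpose C *v (v' /\<^sub>R m) = u' /\<^sub>R m"
  proof -
    have "transpose C *v x = - (transpose B *v x)" for x
      by (simp add: C_def vec_eq_iff matrix_vector_mult_def transpose_def sum_negf)
    then show ?thesis using Bt by (simp add: matrix_vector_mult_scaleR add_eq_0_iff2)
  qed
  have "(u' /\<^sub>R m, v) \<in> primal_dual_derivative F x0 y0 u (v' /\<^sub>R m)"
    by (rule primal_dual_derivative_scale[OF pdd]) (use m in simp)
  moreover have "dual_norm M (v' /\<^sub>R m) = 1" using m by (simp add: M.dual_scale m_def[symmetric])
  ultimately have "rg_circ N M F x0 y0 \<le> ereal (op_norm N M C)"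
    unfolding rg_circ_def using p(2) Cu Ct by (intro Inf_lower CollectI exI[of _ C] conjI exI[of _ u] exI[of _ "v' /\<^sub>R m"]) auto
  also have "op_norm N M C \<le> K" by (rule op_norm_le[OF N K(1)]) (use BK in \<open>simp add: Cv\<close>)
  finally show ?thesis by simp
qed

section \<open>Continuously differentiable functions and Lipschitz moduli\<close>

lemma norm_matrix_vector_mult_le:
  fixes A :: "real ^ 'n ^ 'm"
  shows "norm (A *v v) \<le> real CARD('m) * norm A * norm v"
proof -
  have "norm (A *v v) \<le> (\<Sum>i\<in>UNIV. \<bar>(A *v v) $ i\<bar>)" by (rule norm_le_l1_cart)
  also have "\<dots> \<le> (\<Sum>i\<in>(UNIV::'m set). norm A * norm v)"
  proof (rule sum_mono)
    fix i
    have "(A *v v) $ i = A $ i \<bullet> v" by (simp add: matrix_vector_mult_def inner_vec_def)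
    then have "\<bar>(A *v v) $ i\<bar> \<le> norm (A $ i) * norm v" by (simp add: Cauchy_Schwarz_ineq2)
    also have "\<dots> \<le> norm A * norm v" by (intro mult_right_mono Finite_Cartesian_Product.norm_nth_le) auto
    finally show "\<bar>(A *v v) $ i\<bar> \<le> norm A * norm v" .
  qed
  finally show ?thesis by simp
qed

text \<open>
  The function minus its linearisation at \<open>x0\<close> has small derivatives near \<open>x0\<close>, hence a small Lipschitz
  constant there, so the modulus is at most the operator norm of the Jacobian.
\<close>

lemma C1_lipschitz:
  fixes h :: "real ^ 'n \<Rightarrow> real ^ 'm"
  assumes "C1_around h x0" and "is_norm N" and "is_norm M" and \<epsilon>: "0 < \<epsilon>"
  shows "\<exists>r>0. \<forall>x\<in>ball x0 r. \<forall>x'\<in>ball x0 r.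
     M (h x - h x') \<le> (op_norm N M (jacobian h (at x0)) + \<epsilon>) * N (x - x')"
proof -
  interpret N: vnorm N by standard fact
  interpret M: vnorm M by standard fact
  obtain U where U: "open U" "x0 \<in> U" "\<And>x. x \<in> U \<Longrightarrow> h differentiable (at x)"
    "continuous_on U (\<lambda>x. jacobian h (at x))" using assms(1) unfolding C1_around_def by blast
  define J where "J = jacobian h (at x0)"
  obtain CM where CM: "0 < CM" "\<And>x. M x \<le> CM * norm x" using M.upper by blast
  obtain cN where cN: "0 < cN" "\<And>x. norm x \<le> cN * N x" using N.lower by blast
  define \<eta> where "\<eta> = \<epsilon> / (CM * cN)"
  have \<eta>: "0 < \<eta>" using \<epsilon> CM cN by (simp add: \<eta>_def)
  have "(\<lambda>x. jacobian h (at x)) \<midarrow>x0\<rightarrow> J"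
    using U(1,2,4) unfolding J_def by (simp add: continuous_on_eq_continuous_at isCont_def)
  define D where "D x = (\<lambda>v. (jacobian h (at x) - J) *v v)" for x
  obtain r0 where r0: "0 < r0" "ball x0 r0 \<subseteq> U" using U by (meson openE)
  have "\<forall>\<^sub>F x in at x0. dist (jacobian h (at x)) J < \<eta> / real CARD('m)"
    using \<open>(\<lambda>x. jacobian h (at x)) \<midarrow>x0\<rightarrow> J\<close> \<eta> by (intro tendstoD) auto
  then obtain r1 where r1: "0 < r1" "\<And>x. x \<noteq> x0 \<Longrightarrow> dist x x0 < r1 \<Longrightarrow> dist (jacobian h (at x)) J < \<eta> / real CARD('m)"
    unfolding eventually_at by blast
  define r where "r = min r0 r1"
  have r: "0 < r" "ball x0 r \<subseteq> U" using r0 r1 by (auto simp: r_def)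
  have Jd: "norm ((jacobian h (at x) - J) *v v) \<le> \<eta> * norm v" if x: "x \<in> ball x0 r" for x v
  proof -
    have "norm (jacobian h (at x) - J) \<le> \<eta> / real CARD('m)"
    proof (cases "x = x0")
      case False
      then show ?thesis using r1(2)[of x] x by (simp add: r_def dist_norm norm_minus_commute less_imp_le)
    qed (use \<eta> in \<open>simp add: J_def\<close>)
    then have "real CARD('m) * norm (jacobian h (at x) - J) \<le> \<eta>" by (simp add: field_simps)
    then show ?thesis using norm_matrix_vector_mult_le[of "jacobian h (at x) - J" v] by (meson mult_right_mono norm_ge_zero order_trans)
  qed
  have key: "norm ((h x - J *v x) - (h y - J *v y)) \<le> \<eta> * norm (x - y)" if xy: "x \<in> ball x0 r" "y \<in> ball x0 r" for x y
  proof (rule differentiable_bound[OF convex_ball _ _ xy])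
    fix z assume z: "z \<in> ball x0 r"
    have "(h has_derivative (\<lambda>v. jacobian h (at z) *v v)) (at z)"
      using jacobian_has_derivative[OF U(3)] r z by blast
    then have "((\<lambda>x. h x - J *v x) has_derivative (\<lambda>v. jacobian h (at z) *v v - J *v v)) (at z)"
      by (intro has_derivative_diff bounded_linear.has_derivative[OF matrix_vector_mul_bounded_linear] has_derivative_ident)
    then show "((\<lambda>x. h x - J *v x) has_derivative D z) (at z within ball x0 r)"
      unfolding D_def by (rule has_derivative_at_withinI[OF has_derivative_eq_rhs]) (rule ext, simp add: matrix_vector_mult_diff_rdistrib)
    show "onorm (D z) \<le> \<eta>" using Jd[OF z] \<eta> unfolding D_def by (intro onorm_bound) auto
  qed
  have "M (h x - h y) \<le> (op_norm N M J + \<epsilon>) * N (x - y)" if xy: "x \<in> ball x0 r" "y \<in> ball x0 r" for x y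
  proof -
    have "h x - h y = J *v (x - y) + ((h x - J *v x) - (h y - J *v y))"
      by (simp add: matrix_vector_mult_diff_distrib)
    then have "M (h x - h y) \<le> M (J *v (x - y)) + M ((h x - J *v x) - (h y - J *v y))" using M.triangle by metis
    also have "M (J *v (x - y)) \<le> op_norm N M J * N (x - y)" by (rule op_norm_upper) fact+
    also have "M ((h x - J *v x) - (h y - J *v y)) \<le> CM * norm ((h x - J *v x) - (h y - J *v y))" by (rule CM)
    also have "\<dots> \<le> CM * (\<eta> * norm (x - y))" using key[OF xy] CM by (intro mult_left_mono) auto
    also have "\<dots> \<le> CM * (\<eta> * (cN * N (x - y)))" using cN(2) CM \<eta> by (intro mult_left_mono) auto
    also have "\<dots> = \<epsilon> * N (x - y)" using CM cN by (simp add: \<eta>_def)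
    finally show ?thesis by (simp add: algebra_simps)
  qed
  then show ?thesis using r(1) unfolding J_def by blast
qed

text \<open>
  Continuity of the Jacobian reduces the Clarke Jacobian to one point, and semismoothness becomes joint
  continuity of \<open>jacobian h (at x) *v u\<close>.
\<close>

lemma C1_around_imp_semismooth:
  fixes h :: "real ^ 'n \<Rightarrow> real ^ 'm"
  assumes C1: "C1_around h x0"
  shows "semismooth h x0"
  unfolding semismooth_def
proof (intro conjI allI)
  obtain r where r: "0 < r" "\<And>x x'. \<lbrakk>x \<in> ball x0 r; x' \<in> ball x0 r\<rbrakk> \<Longrightarrow>
     norm (h x - h x') \<le> (op_norm norm norm (jacobian h (at x0)) + 1) * norm (x - x')"
    using C1_lipschitz[OF C1 is_norm_norm is_norm_norm, of 1] by auto
  have "(op_norm norm norm (jacobian h (at x0)) + 1)-lipschitz_on (ball x0 r) h"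
  proof (rule lipschitz_onI)
    show "0 \<le> op_norm norm norm (jacobian h (at x0)) + 1"
      by (intro add_nonneg_nonneg op_norm_nonneg[OF is_norm_norm is_norm_norm]) simp
  qed (use r(2) in \<open>simp add: dist_norm\<close>)
  moreover have "x0 \<in> ball x0 r" using r(1) by simp
  ultimately show "lipschitz_around h x0"
    unfolding lipschitz_around_def using open_ball[of x0 r] by (intro exI conjI)
  obtain U where U: "open U" "x0 \<in> U" "\<And>x. x \<in> U \<Longrightarrow> h differentiable (at x)"
    "continuous_on U (\<lambda>x. jacobian h (at x))" using C1 unfolding C1_around_def by blast
  have cont: "isCont (\<lambda>x. jacobian h (at x)) x" if "x \<in> U" for x
    using U that by (simp add: continuous_on_eq_continuous_at)
  have cl: "V = jacobian h (at x)" if x: "x \<in> U" and V: "V \<in> clarke_jacobian h x" for x V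
  proof -
    have "jacobian_limits h x \<subseteq> {jacobian h (at x)}"
    proof
      fix A assume "A \<in> jacobian_limits h x"
      then obtain xs where xs: "xs \<longlonglongrightarrow> x" "(\<lambda>k. jacobian h (at (xs k))) \<longlonglongrightarrow> A"
        unfolding jacobian_limits_def by blast
      have "(\<lambda>k. jacobian h (at (xs k))) \<longlonglongrightarrow> jacobian h (at x)"
        by (rule isCont_tendsto_compose[OF cont[OF x] xs(1)])
      then show "A \<in> {jacobian h (at x)}" using LIMSEQ_unique xs(2) by blast
    qed
    then have "clarke_jacobian h x \<subseteq> {jacobian h (at x)}"
      unfolding clarke_jacobian_hull by (rule hull_minimal) simp
    then show ?thesis using V by blast
  qed
  fix u :: "real ^ 'n"
  define G where "G = nhds u \<times>\<^sub>F at_right (0::real)"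
  have l1: "((\<lambda>z. fst z) \<longlongrightarrow> u) G" unfolding G_def by (rule filterlim_fst)
  have "filterlim snd (at_right (0::real)) G" unfolding G_def by (rule filterlim_snd)
  then have l2: "((\<lambda>z. snd z) \<longlongrightarrow> 0) G" by (rule filterlim_mono[OF _ _ order_refl]) (simp add: at_within_le_nhds)
  have "((\<lambda>z. x0 + snd z *\<^sub>R fst z) \<longlongrightarrow> x0 + 0 *\<^sub>R u) G" by (intro tendsto_intros l1 l2)
  then have l3: "((\<lambda>z. x0 + snd z *\<^sub>R fst z) \<longlongrightarrow> x0) G" by simp
  have evU: "\<forall>\<^sub>F z in G. x0 + snd z *\<^sub>R fst z \<in> U" by (rule topological_tendstoD[OF l3 U(1,2)])
  have "((\<lambda>z. jacobian h (at (x0 + snd z *\<^sub>R fst z)) *v fst z) \<longlongrightarrow> jacobian h (at x0) *v u) G"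
    by (intro tendsto_matrix_vector_mult l1 isCont_tendsto_compose[OF cont[OF U(2)] l3])
  then have ev: "\<forall>\<^sub>F z in G. dist (jacobian h (at (x0 + snd z *\<^sub>R fst z)) *v fst z) (jacobian h (at x0) *v u) < \<epsilon>"
    if "0 < \<epsilon>" for \<epsilon> using that by (rule tendstoD)
  show "\<exists>l. \<forall>\<epsilon>>0. \<forall>\<^sub>F (u', t) in nhds u \<times>\<^sub>F at_right (0::real).
        \<forall>V\<in>clarke_jacobian h (x0 + t *\<^sub>R u'). dist (V *v u') l < \<epsilon>"
  proof (intro exI allI impI)
    fix \<epsilon> :: real assume "0 < \<epsilon>"
    from ev[OF this] evU show "\<forall>\<^sub>F (u', t) in nhds u \<times>\<^sub>F at_right (0::real).
        \<forall>V\<in>clarke_jacobian h (x0 + t *\<^sub>R u'). dist (V *v u') (jacobian h (at x0) *v u) < \<epsilon>"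
      unfolding G_def[symmetric] by eventually_elim (use cl in auto)
  qed
qed

lemma lip_leI:
  assumes "0 < r" and N: "is_norm N" and "\<And>x x'. \<lbrakk>x \<in> ball x0 r; x' \<in> ball x0 r\<rbrakk> \<Longrightarrow> M (h x - h x') \<le> K * N (x - x')"
  shows "lip N M h x0 \<le> ereal K"
proof -
  interpret N: vnorm N by standard fact
  have "\<forall>\<^sub>F z in at (x0, x0) within {(x, x'). x \<noteq> x'}. (\<lambda>(x, x'). ereal (M (h x - h x') / N (x - x'))) z \<le> ereal K"
    unfolding eventually_at
  proof (intro exI[of _ r] conjI assms(1) ballI impI)
    fix z assume z: "z \<in> {(x, x'). x \<noteq> x'}" "z \<noteq> (x0, x0) \<and> dist z (x0, x0) < r"
    obtain x x' where xx: "z = (x, x')" by (cases z)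
    have "dist x x0 < r" "dist x' x0 < r"
      using z(2) dist_fst_le[of z "(x0, x0)"] dist_snd_le[of z "(x0, x0)"] by (auto simp: xx)
    then have "M (h x - h x') \<le> K * N (x - x')" by (intro assms(3)) (auto simp: dist_commute)
    moreover have "0 < N (x - x')" using z xx by (intro N.pos) auto
    ultimately show "(\<lambda>(x, x'). ereal (M (h x - h x') / N (x - x'))) z \<le> ereal K" by (simp add: xx divide_le_eq)
  qed
  then show ?thesis unfolding lip_def by (rule Limsup_bounded)
qed

lemma lip_lessD:
  fixes N :: "'a::euclidean_space \<Rightarrow> real" and M :: "'b::euclidean_space \<Rightarrow> real"
  assumes N: "is_norm N" and M: "is_norm M" and less: "lip N M h x0 < ereal K"
  obtains r where "0 < r" "0 \<le> K" "\<And>x x'. \<lbrakk>x \<in> ball x0 r; x' \<in> ball x0 r\<rbrakk> \<Longrightarrow> M (h x - h x') \<le> K * N (x - x')"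
proof -
  interpret N: vnorm N by standard fact
  interpret M: vnorm M by standard fact
  have "\<forall>\<^sub>F z in at (x0, x0) within {(x, x'). x \<noteq> x'}. (\<lambda>(x, x'). ereal (M (h x - h x') / N (x - x'))) z < ereal K"
    using less unfolding lip_def by (rule Limsup_lessD)
  then obtain d where d: "0 < d" "\<And>x x'. \<lbrakk>x \<noteq> x'; dist (x, x') (x0, x0) < d\<rbrakk> \<Longrightarrow> M (h x - h x') / N (x - x') < K"
    unfolding eventually_at by auto
  have ball: "M (h x - h x') \<le> K * N (x - x')" if xx: "x \<in> ball x0 (d / 2)" "x' \<in> ball x0 (d / 2)" for x x'
  proof (cases "x = x'")
    case False
    have "dist (x, x') (x0, x0) \<le> dist x x0 + dist x' x0"
      unfolding dist_Pair_Pair by (rule sqrt_sum_squares_le_sum) auto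
    also have "\<dots> < d" using xx by (simp add: dist_commute)
    finally have "M (h x - h x') / N (x - x') < K" by (rule d(2)[OF False])
    moreover have "0 < N (x - x')" using False by (intro N.pos) auto
    ultimately show ?thesis by (simp add: divide_less_eq)
  qed simp
  obtain b :: 'a where b: "b \<in> Basis" using nonempty_Basis by blast
  define x where "x = x0 + (d / 4) *\<^sub>R b"
  have x: "x \<in> ball x0 (d / 2)" "x \<noteq> x0" using b d by (auto simp: x_def dist_norm)
  have "0 < N (x - x0)" using x by (intro N.pos) auto
  moreover have "x0 \<in> ball x0 (d / 2)" using d(1) by simp
  then have "0 \<le> K * N (x - x0)" by (rule order_trans[OF M.nonneg ball[OF x(1)]])
  ultimately have "0 \<le> K" by (simp add: zero_le_mult_iff)
  then show thesis using that[of "d / 2"] d(1) ball by simp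
qed

section \<open>From normals to failure of subregularity\<close>

text \<open>
  The normal cone is defined by tangent directions; compactness of the unit sphere upgrades this to
  the uniform inequality.
\<close>

lemma frechet_normal_inequality:
  fixes A :: "'a::euclidean_space set"
  assumes \<zeta>: "\<zeta> \<in> normal_cone A z" and \<epsilon>: "0 < \<epsilon>"
  shows "\<exists>\<delta>>0. \<forall>z'\<in>A. norm (z' - z) \<le> \<delta> \<longrightarrow> \<zeta> \<bullet> (z' - z) \<le> \<epsilon> * norm (z' - z)"
proof (rule ccontr)
  assume contra: "\<not> ?thesis"
  have "\<exists>z'\<in>A. norm (z' - z) \<le> 1 / real (Suc n) \<and> \<epsilon> * norm (z' - z) < \<zeta> \<bullet> (z' - z)" for n
  proof -
    have "0 < 1 / real (Suc n)" by simp
    then show ?thesis using contra by (meson not_le)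
  qed
  then obtain Z where Z: "\<And>n. Z n \<in> A" "\<And>n. norm (Z n - z) \<le> 1 / real (Suc n)"
    "\<And>n. \<epsilon> * norm (Z n - z) < \<zeta> \<bullet> (Z n - z)" by metis
  define t where "t n = norm (Z n - z)" for n
  have t: "0 < t n" for n using Z(3)[of n] by (auto simp: t_def)
  define W where "W n = (Z n - z) /\<^sub>R t n" for n
  have "W n \<in> sphere 0 1" for n using t[of n] by (simp add: W_def t_def)
  then obtain w \<sigma> where w: "strict_mono (\<sigma>::nat \<Rightarrow> nat)" "(W \<circ> \<sigma>) \<longlonglongrightarrow> w"
    using compact_sphere[of 0 1] unfolding compact_def by metis
  have "t \<longlonglongrightarrow> 0"
    by (rule Lim_null_comparison[OF always_eventually LIMSEQ_one_over_Suc]) (use Z(2) in \<open>simp add: t_def\<close>)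
  then have "(t \<circ> \<sigma>) \<longlonglongrightarrow> 0" using w(1) by (rule LIMSEQ_subseq_LIMSEQ)
  moreover have "z + (t \<circ> \<sigma>) n *\<^sub>R (W \<circ> \<sigma>) n \<in> A" for n
    using t[of "\<sigma> n"] Z(1)[of "\<sigma> n"] by (simp add: W_def)
  ultimately have "w \<in> tangent_cone A z" unfolding tangent_cone_def using w(2) t
    by (intro CollectI exI[of _ "W \<circ> \<sigma>"] exI[of _ "t \<circ> \<sigma>"]) auto
  then have "\<zeta> \<bullet> w \<le> 0" using \<zeta> by (auto simp: normal_cone_def split: if_splits)
  moreover have "\<epsilon> \<le> \<zeta> \<bullet> (W \<circ> \<sigma>) n" for n
  proof -
    define m where "m = \<sigma> n"
    have "t m *\<^sub>R W m = Z m - z" using t[of m] by (simp add: W_def)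
    then have "t m * (\<zeta> \<bullet> W m) = \<zeta> \<bullet> (Z m - z)" by (metis inner_scaleR_right)
    then have "t m * \<epsilon> \<le> t m * (\<zeta> \<bullet> W m)" using Z(3)[of m] by (simp add: t_def mult.commute)
    then show ?thesis using t[of m] by (simp add: m_def)
  qed
  then have "\<epsilon> \<le> \<zeta> \<bullet> w"
    by (intro tendsto_lowerbound[OF tendsto_inner[OF tendsto_const w(2)]]) auto
  ultimately show False using \<epsilon> by simp
qed

text \<open>
  A normal vector close to \<open>(u', - v')\<close> annihilates, up to a small error, the vectors
  \<open>(d, B d)\<close>, while its product with \<open>(0, - e)\<close> is close to \<open>1\<close>. The displacement
  \<open>(d, B d - (\<epsilon> * r) *\<^sub>R e)\<close> with \<open>norm d \<le> r\<close> therefore has a product of order \<open>\<epsilon> * r\<close> with the normal vector,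
  too large for a displacement inside the graph by the Frechet inequality.
\<close>

lemma normal_probe:
  fixes F :: "'a::euclidean_space \<Rightarrow> 'b::euclidean_space set"
  assumes pdd: "(u', v) \<in> primal_dual_derivative F x0 y0 u v'"
    and B: "bounded_linear B" and adj: "\<And>x. u' \<bullet> x = v' \<bullet> B x" and e: "v' \<bullet> e = 1" and \<epsilon>: "0 < \<epsilon>"
  shows "\<exists>t a b \<rho>. 0 < t \<and> t < \<epsilon> \<and> norm (a - u) < \<epsilon> \<and> norm (b - v) < \<epsilon> \<and> y0 + t *\<^sub>R b \<in> F (x0 + t *\<^sub>R a) \<and> 0 < \<rho> \<and>
    (\<forall>r x. 0 < r \<longrightarrow> r \<le> \<rho> \<longrightarrow> norm (x - (x0 + t *\<^sub>R a)) \<le> r \<longrightarrow>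
      y0 + t *\<^sub>R b - (\<epsilon> * r) *\<^sub>R e + B (x - (x0 + t *\<^sub>R a)) \<notin> F x)"
proof -
  interpret B: bounded_linear B by fact
  obtain \<beta> where \<beta>: "0 < \<beta>" "\<And>x. norm (B x) \<le> \<beta> * norm x" using B.pos_bounded by (metis mult.commute)
  obtain T ws zs where s: "\<And>i. (0::real) < T i" "T \<longlonglongrightarrow> 0" "ws \<longlonglongrightarrow> (u, v)" "zs \<longlonglongrightarrow> (u', - v')"
    "\<And>i::nat. zs i \<in> normal_cone (gph F) ((x0, y0) + T i *\<^sub>R ws i)"
    using pdd unfolding primal_dual_derivative_def dir_lim_normal_cone_def by blast
  \<comment> \<open>The accuracies \<open>\<gamma>\<close> of the normal vector and \<open>\<epsilon>'\<close> of the Frechet inequality are chosen such that the errors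
    do not exceed \<open>\<epsilon> * r / 4\<close>, while the main term is at least \<open>\<epsilon> * r / 2\<close>.\<close>
  define \<gamma> where "\<gamma> = min (1 / (2 * norm e + 1)) (\<epsilon> / (8 * (1 + \<beta>))) / 2"
  define R where "R = 1 + \<epsilon> * norm e + \<beta>"
  have R: "0 < R" using \<epsilon> \<beta> by (simp add: R_def add_pos_nonneg add_nonneg_pos)
  define \<epsilon>' where "\<epsilon>' = \<epsilon> / (8 * R)"
  have \<gamma>: "0 < \<gamma>" "\<gamma> * norm e \<le> 1 / 2" "\<gamma> * (1 + \<beta>) \<le> \<epsilon> / 8"
  proof -
    have ne: "0 < 2 * norm e + 1" by (simp add: add_nonneg_pos)
    show g0: "0 < \<gamma>" using \<epsilon> \<beta> ne by (simp add: \<gamma>_def)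
    have g2: "2 * \<gamma> \<le> 1 / (2 * norm e + 1)" "2 * \<gamma> \<le> \<epsilon> / (8 * (1 + \<beta>))"
      unfolding \<gamma>_def using min.cobounded1 min.cobounded2 by simp_all
    then have "\<gamma> \<le> 1 / (2 * norm e + 1)" using g0 by linarith
    then have "\<gamma> * norm e \<le> 1 / (2 * norm e + 1) * norm e" by (intro mult_right_mono) auto
    also have "\<dots> \<le> 1 / 2" using ne by (simp add: field_simps)
    finally show "\<gamma> * norm e \<le> 1 / 2" .
    have "\<gamma> \<le> \<epsilon> / (8 * (1 + \<beta>))" using g0 g2 by linarith
    then have "\<gamma> * (1 + \<beta>) \<le> \<epsilon> / (8 * (1 + \<beta>)) * (1 + \<beta>)" using \<beta> by (intro mult_right_mono) auto
    also have "\<dots> = \<epsilon> / 8" using \<beta> by (simp add: field_simps)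
    finally show "\<gamma> * (1 + \<beta>) \<le> \<epsilon> / 8" .
  qed
  have "\<forall>\<^sub>F i in sequentially. T i < \<epsilon> \<and> dist (ws i) (u, v) < \<epsilon> \<and> dist (zs i) (u', - v') < \<gamma>"
    using order_tendstoD(2)[OF s(2) \<epsilon>] tendstoD[OF s(3) \<epsilon>] tendstoD[OF s(4) \<gamma>(1)] by eventually_elim simp
  then obtain i where i: "T i < \<epsilon>" "dist (ws i) (u, v) < \<epsilon>" "dist (zs i) (u', - v') < \<gamma>"
    using eventually_happens'[OF sequentially_bot] by blast
  obtain a b where ab: "ws i = (a, b)" by (cases "ws i")
  obtain \<xi> \<zeta> where \<xi>\<zeta>: "zs i = (\<xi>, \<zeta>)" by (cases "zs i")
  define t where "t = T i"
  define x1 where "x1 = x0 + t *\<^sub>R a"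
  define y1 where "y1 = y0 + t *\<^sub>R b"
  have nc: "(\<xi>, \<zeta>) \<in> normal_cone (gph F) (x1, y1)" using s(5)[of i] by (simp add: ab \<xi>\<zeta> x1_def y1_def t_def)
  then have yF: "y1 \<in> F x1" by (auto simp: normal_cone_def gph_def split: if_splits)
  have ab': "norm (a - u) < \<epsilon>" "norm (b - v) < \<epsilon>"
    using i(2) dist_fst_le[of "ws i" "(u, v)"] dist_snd_le[of "ws i" "(u, v)"] by (auto simp: ab dist_norm)
  have \<xi>': "norm (\<xi> - u') < \<gamma>" "norm (\<zeta> + v') < \<gamma>"
    using i(3) dist_fst_le[of "zs i" "(u', - v')"] dist_snd_le[of "zs i" "(u', - v')"] by (auto simp: \<xi>\<zeta> dist_norm)
  have \<epsilon>': "0 < \<epsilon>'" using \<epsilon> R by (simp add: \<epsilon>'_def)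
  obtain \<delta> where \<delta>: "0 < \<delta>" "\<And>z'. \<lbrakk>z' \<in> gph F; norm (z' - (x1, y1)) \<le> \<delta>\<rbrakk> \<Longrightarrow>
      (\<xi>, \<zeta>) \<bullet> (z' - (x1, y1)) \<le> \<epsilon>' * norm (z' - (x1, y1))"
    using frechet_normal_inequality[OF nc \<epsilon>'] by blast
  have notin: "y1 - (\<epsilon> * r) *\<^sub>R e + B (x - x1) \<notin> F x" if r: "0 < r" "r \<le> \<delta> / R" and x: "norm (x - x1) \<le> r" for r x
  proof
    assume yF: "y1 - (\<epsilon> * r) *\<^sub>R e + B (x - x1) \<in> F x"
    define d where "d = x - x1"
    define z' where "z' = (x, y1 - (\<epsilon> * r) *\<^sub>R e + B d)"
    have zz: "z' - (x1, y1) = (d, B d - (\<epsilon> * r) *\<^sub>R e)" by (simp add: z'_def d_def)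
    have nd: "norm d \<le> r" using x by (simp add: d_def)
    have nBd: "norm (B d) \<le> \<beta> * r" using \<beta>(2)[of d] mult_left_mono[OF nd, of \<beta>] \<beta>(1) by linarith
    have "norm (z' - (x1, y1)) \<le> norm d + norm (B d - (\<epsilon> * r) *\<^sub>R e)" unfolding zz by (rule norm_Pair_le)
    also have "norm (B d - (\<epsilon> * r) *\<^sub>R e) \<le> norm (B d) + norm ((\<epsilon> * r) *\<^sub>R e)" by (rule norm_triangle_ineq4)
    finally have nz: "norm (z' - (x1, y1)) \<le> r * R" using nd nBd r \<epsilon> by (simp add: R_def algebra_simps)
    also have "\<dots> \<le> \<delta>" using r(2) R by (simp add: field_simps)
    finally have nz\<delta>: "norm (z' - (x1, y1)) \<le> \<delta>" .
    have "z' \<in> gph F" using yF by (simp add: z'_def gph_def d_def)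
    from \<delta>(2)[OF this nz\<delta>]
    have "\<xi> \<bullet> d + \<zeta> \<bullet> (B d - (\<epsilon> * r) *\<^sub>R e) \<le> \<epsilon>' * norm (z' - (x1, y1))" unfolding zz by simp
    also have "\<dots> \<le> \<epsilon>' * (r * R)" using nz \<epsilon>' by (intro mult_left_mono) auto
    also have "\<dots> = \<epsilon> / 8 * r" using R by (simp add: \<epsilon>'_def)
    finally have up: "\<xi> \<bullet> d + \<zeta> \<bullet> B d - \<epsilon> * r * (\<zeta> \<bullet> e) \<le> \<epsilon> / 8 * r" by (simp add: inner_diff_right)
    have "\<xi> \<bullet> d + \<zeta> \<bullet> B d = (\<xi> - u') \<bullet> d + (\<zeta> + v') \<bullet> B d"
      by (simp add: inner_diff_left inner_add_left adj)
    moreover have "- (norm (\<xi> - u') * norm d) \<le> (\<xi> - u') \<bullet> d"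
      using Cauchy_Schwarz_ineq2[of "\<xi> - u'" d] by linarith
    moreover have "- (norm (\<zeta> + v') * norm (B d)) \<le> (\<zeta> + v') \<bullet> B d"
      using Cauchy_Schwarz_ineq2[of "\<zeta> + v'" "B d"] by linarith
    moreover have "norm (\<xi> - u') * norm d \<le> \<gamma> * r" using \<xi>' nd \<gamma>(1) by (intro mult_mono) auto
    moreover have "norm (\<zeta> + v') * norm (B d) \<le> \<gamma> * (\<beta> * r)" using \<xi>' nBd \<gamma>(1) by (intro mult_mono) auto
    ultimately have lo: "- (\<gamma> * (1 + \<beta>) * r) \<le> \<xi> \<bullet> d + \<zeta> \<bullet> B d" by (simp add: algebra_simps)
    have "\<gamma> * (1 + \<beta>) * r \<le> \<epsilon> / 8 * r" using \<gamma>(3) r by (intro mult_right_mono) auto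
    with lo up have e1: "- (\<epsilon> * r * (\<zeta> \<bullet> e)) \<le> \<epsilon> / 4 * r" by linarith
    have "\<zeta> \<bullet> e = (\<zeta> + v') \<bullet> e - 1" by (simp add: inner_add_left e)
    moreover have "(\<zeta> + v') \<bullet> e \<le> \<gamma> * norm e"
      using norm_cauchy_schwarz[of "\<zeta> + v'" e] mult_right_mono[of "norm (\<zeta> + v')" \<gamma> "norm e"] \<xi>' by simp
    ultimately have "\<zeta> \<bullet> e \<le> - (1 / 2)" using \<gamma>(2) by linarith
    then have "\<epsilon> * r * (\<zeta> \<bullet> e) \<le> \<epsilon> * r * (- (1 / 2))" using \<epsilon> r by (intro mult_left_mono) auto
    with e1 have "\<epsilon> * r \<le> 0" by simp
    then show False using mult_pos_pos[OF \<epsilon> r(1)] by linarith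
  qed
  show ?thesis
    by (rule exI[of _ t], rule exI[of _ a], rule exI[of _ b], rule exI[of _ "\<delta> / R"])
      (use s(1)[of i] i(1) ab' yF notin \<delta>(1) R in \<open>auto simp: t_def[symmetric] x1_def[symmetric] y1_def[symmetric]\<close>)
qed

text \<open>
  The point \<open>x k\<close> has distance more than \<open>r k\<close> from the solutions but a residual that is small compared
  with \<open>r k\<close>, which rules out every constant of subregularity.
\<close>

lemma not_subregular_of_gaps:
  fixes N :: "'a::euclidean_space \<Rightarrow> real" and M :: "'b::euclidean_space \<Rightarrow> real"
  assumes N: "is_norm N" and M: "is_norm M" and x: "x \<longlonglongrightarrow> x0" and r: "\<And>k. 0 < r k" and c: "c \<longlonglongrightarrow> 0"
    and y: "\<And>k. \<exists>y\<in>G (x k). norm (y - y0) \<le> c k * r k"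
    and gap: "\<And>k z. norm (z - x k) \<le> r k \<Longrightarrow> y0 \<notin> G z"
  shows "\<not> metrically_subregular N M G x0 y0"
proof
  interpret N: vnorm N by standard fact
  interpret M: vnorm M by standard fact
  assume "metrically_subregular N M G x0 y0"
  then obtain \<kappa> U where \<kappa>: "0 \<le> \<kappa>" "open U" "x0 \<in> U"
    "\<And>x. x \<in> U \<Longrightarrow> norm_dist N x {x. y0 \<in> G x} \<le> ereal \<kappa> * norm_dist M y0 (G x)"
    unfolding metrically_subregular_def by blast
  obtain C where C: "0 < C" "\<And>x. M x \<le> C * norm x" using M.upper by blast
  obtain cN where cN: "0 < cN" "\<And>x. norm x \<le> cN * N x" using N.lower by blast
  have "\<forall>\<^sub>F k in sequentially. x k \<in> U" by (rule topological_tendstoD[OF x \<kappa>(2,3)])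
  then have ev: "\<forall>\<^sub>F k in sequentially. 1 / cN \<le> \<kappa> * C * c k"
  proof eventually_elim
    case (elim k)
    obtain y where y: "y \<in> G (x k)" "norm (y - y0) \<le> c k * r k" using assms(6) by blast
    have "ereal (r k / cN) \<le> norm_dist N (x k) {x. y0 \<in> G x}"
      unfolding norm_dist_def
    proof (rule INF_greatest)
      fix z assume "z \<in> {x. y0 \<in> G x}"
      then have "r k < norm (z - x k)" using gap[of z k] by force
      also have "\<dots> \<le> cN * N (x k - z)" using cN(2)[of "z - x k"] N.minus_commute[of z "x k"] by simp
      finally show "ereal (r k / cN) \<le> ereal (N (x k - z))" using cN(1) by (simp add: divide_le_eq mult.commute)
    qed
    also have "\<dots> \<le> ereal \<kappa> * norm_dist M y0 (G (x k))" by (rule \<kappa>(4)[OF elim])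
    also have "\<dots> \<le> ereal \<kappa> * ereal (M (y0 - y))"
      unfolding norm_dist_def by (rule ereal_mult_left_mono[OF INF_lower[OF y(1)]]) (use \<kappa> in simp)
    finally have "r k / cN \<le> \<kappa> * M (y0 - y)" by simp
    also have "\<dots> \<le> \<kappa> * (C * (c k * r k))"
    proof (rule mult_left_mono[OF _ \<kappa>(1)])
      have "M (y0 - y) \<le> C * norm (y - y0)" using C(2)[of "y0 - y"] by (simp add: norm_minus_commute)
      also have "\<dots> \<le> C * (c k * r k)" using y C by simp
      finally show "M (y0 - y) \<le> C * (c k * r k)" .
    qed
    finally have "r k * (1 / cN) \<le> r k * (\<kappa> * C * c k)" by (simp add: mult_ac)
    then show ?case by (rule iffD1[OF mult_le_cancel_left_pos[OF r]])
  qed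
  have "(\<lambda>k. \<kappa> * C * c k) \<longlonglongrightarrow> \<kappa> * C * 0" by (intro tendsto_intros c)
  then have "1 / cN \<le> \<kappa> * C * 0" using ev by (rule tendsto_lowerbound) simp
  then show False using cN(1) by simp
qed

text \<open>
  A rapidly decreasing choice: each scale \<open>t\<close> is at most \<open>\<theta>\<close> times all earlier ones, because it is
  smaller than the accuracy \<open>\<epsilon>\<close> that was chosen after them. The factor \<open>\<theta>\<close> will keep the supports of bumps
  apart, and the geometric bound on the accuracies makes their sum converge.
\<close>

lemma shrinking_probes:
  assumes probe: "\<And>\<epsilon>::real. 0 < \<epsilon> \<Longrightarrow> \<exists>s. Q \<epsilon> s" and small: "\<And>\<epsilon> s. Q \<epsilon> s \<Longrightarrow> 0 < t s \<and> t s < (\<epsilon>::real)"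
    and \<theta>: "0 < \<theta>" "\<theta> \<le> 1" and E0: "0 < E0"
  obtains E s where "\<And>k. Q (E k) (s k)" "\<And>k. 0 < E k" "\<And>k. E k \<le> E0 * (1 / 2) ^ k"
    "\<And>j k. j < k \<Longrightarrow> t (s k) \<le> \<theta> * t (s j)"
proof -
  have "\<exists>f :: nat \<Rightarrow> real \<times> 'a. \<forall>n. (0 < fst (f n) \<and> fst (f n) \<le> E0 * (1 / 2) ^ n \<and> Q (fst (f n)) (snd (f n))) \<and>
     t (snd (f (Suc n))) \<le> \<theta> * t (snd (f n))"
  proof (rule dependent_nat_choice)
    obtain s where "Q E0 s" using probe[OF E0] by blast
    then show "\<exists>x. 0 < fst x \<and> fst x \<le> E0 * (1 / 2) ^ 0 \<and> Q (fst x) (snd x)"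
      using E0 by (intro exI[of _ "(E0, s)"]) auto
  next
    fix x :: "real \<times> 'a" and n
    assume x: "0 < fst x \<and> fst x \<le> E0 * (1 / 2) ^ n \<and> Q (fst x) (snd x)"
    define \<epsilon> where "\<epsilon> = min (fst x / 2) (\<theta> * t (snd x))"
    have \<epsilon>: "0 < \<epsilon>" using x small \<theta> by (auto simp: \<epsilon>_def)
    obtain s where s: "Q \<epsilon> s" using probe[OF \<epsilon>] by blast
    have "t s < \<epsilon>" using small s by blast
    then have "t s \<le> \<theta> * t (snd x)" by (simp add: \<epsilon>_def)
    moreover have "\<epsilon> \<le> E0 * (1 / 2) ^ Suc n" 
    proof -
      have "\<epsilon> \<le> fst x / 2" by (simp add: \<epsilon>_def)
      then show ?thesis using x by simp
    qed
    ultimately show "\<exists>y. (0 < fst y \<and> fst y \<le> E0 * (1 / 2) ^ Suc n \<and> Q (fst y) (snd y)) \<and> t (snd y) \<le> \<theta> * t (snd x)"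
      using \<epsilon> s by (intro exI[of _ "(\<epsilon>, s)"]) simp
  qed
  then obtain f :: "nat \<Rightarrow> real \<times> 'a" where f: "\<And>n. 0 < fst (f n)" "\<And>n. fst (f n) \<le> E0 * (1 / 2) ^ n"
    "\<And>n. Q (fst (f n)) (snd (f n))" "\<And>n. t (snd (f (Suc n))) \<le> \<theta> * t (snd (f n))" by blast
  have tp: "0 < t (snd (f n))" for n using small f(3) by blast
  have chain: "t (snd (f (Suc j + d))) \<le> \<theta> * t (snd (f j))" for j d
  proof (induction d)
    case (Suc d)
    have "t (snd (f (Suc j + Suc d))) \<le> \<theta> * t (snd (f (Suc j + d)))" using f(4)[of "Suc j + d"] by simp
    also have "\<dots> \<le> 1 * t (snd (f (Suc j + d)))" using \<theta> tp[of "Suc j + d"] by (intro mult_right_mono) auto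
    finally show ?case using Suc by simp
  qed (use f(4) in simp)
  have "t (snd (f k)) \<le> \<theta> * t (snd (f j))" if "j < k" for j k
    using chain[of j "k - Suc j"] that by simp
  then show thesis using that[of "\<lambda>n. fst (f n)" "\<lambda>n. snd (f n)"] f by blast
qed

section \<open>Sums of bumps\<close>

lemma sum_matrix_vector_mult:
  fixes A :: "'i \<Rightarrow> real ^ 'n ^ 'm"
  assumes "finite I"
  shows "(\<Sum>i\<in>I. A i) *v v = (\<Sum>i\<in>I. A i *v v)"
  using assms by (induction I rule: finite_induct) (simp_all add: matrix_vector_mult_add_rdistrib)

text \<open>
  The derivatives converge uniformly by the Weierstrass criterion, so the series may be differentiated
  termwise and the derivative of the sum is continuous.
\<close>

lemma C1_series:
  fixes f :: "nat \<Rightarrow> real ^ 'n \<Rightarrow> real ^ 'm" and A :: "nat \<Rightarrow> real ^ 'n \<Rightarrow> real ^ 'n ^ 'm"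
  assumes der: "\<And>i x. (f i has_derivative (*v) (A i x)) (at x)"
    and cont: "\<And>i. continuous_on UNIV (A i)"
    and bound: "\<And>i x. norm (A i x) \<le> C i" and C: "summable C" and zero: "\<And>i. f i x0 = 0"
  obtains g where "\<And>x. (\<lambda>i. f i x) sums g x" "\<And>x. (g has_derivative (*v) (\<Sum>i. A i x)) (at x)"
    "continuous_on UNIV (\<lambda>x. \<Sum>i. A i x)"
proof -
  have ul: "uniform_limit UNIV (\<lambda>n x. \<Sum>i<n. A i x) (\<lambda>x. \<Sum>i. A i x) sequentially"
    by (rule Weierstrass_m_test[OF bound C])
  have contS: "continuous_on UNIV (\<lambda>x. \<Sum>i. A i x)"
    by (rule uniform_limit_theorem[OF always_eventually ul]) (auto intro!: continuous_on_sum cont)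
  have "\<exists>g. \<forall>x\<in>UNIV. (\<lambda>n. f n x) sums g x \<and> (g has_derivative (*v) (\<Sum>i. A i x)) (at x within UNIV)"
  proof (rule has_derivative_series)
    show "convex (UNIV :: (real ^ 'n) set)" by simp
    show "(f n has_derivative (*v) (A n x)) (at x within UNIV)" for n x using der by simp
    show "x0 \<in> UNIV" by simp
    show "(\<lambda>n. f n x0) sums 0" using zero by simp
    fix e :: real assume e: "0 < e"
    have "0 < e / real CARD('m)" using e by simp
    from uniform_limitD[OF ul this]
    show "\<forall>\<^sub>F n in sequentially. \<forall>x\<in>UNIV. \<forall>v. norm ((\<Sum>i<n. A i x *v v) - (\<Sum>i. A i x) *v v) \<le> e * norm v"
    proof eventually_elim
      case (elim n)
      show ?case
      proof (intro ballI allI)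
        fix x v
        have d: "norm ((\<Sum>i<n. A i x) - (\<Sum>i. A i x)) \<le> e / real CARD('m)"
          using elim by (simp add: dist_norm less_imp_le)
        have "(\<Sum>i<n. A i x *v v) - (\<Sum>i. A i x) *v v = ((\<Sum>i<n. A i x) - (\<Sum>i. A i x)) *v v"
          by (simp add: sum_matrix_vector_mult matrix_vector_mult_diff_rdistrib)
        also have "norm \<dots> \<le> real CARD('m) * norm ((\<Sum>i<n. A i x) - (\<Sum>i. A i x)) * norm v"
          by (rule norm_matrix_vector_mult_le)
        also have "\<dots> \<le> real CARD('m) * (e / real CARD('m)) * norm v"
          using d by (intro mult_right_mono mult_left_mono) auto
        finally show "norm ((\<Sum>i<n. A i x *v v) - (\<Sum>i. A i x) *v v) \<le> e * norm v" by simp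
      qed
    qed
  qed
  then show thesis using that contS by auto
qed

lemma has_real_derivative_square_pos:
  "((\<lambda>s. (max 0 s)\<^sup>2) has_real_derivative 2 * max 0 s) (at (s::real))"
  unfolding has_field_derivative_def
proof (rule has_derivativeI_sandwich[of 1])
  show "bounded_linear ((*) (2 * max 0 s))" by (rule bounded_linear_mult_right)
  fix y :: real assume y: "y \<noteq> s"
  have "\<bar>(max 0 y)\<^sup>2 - (max 0 s)\<^sup>2 - 2 * max 0 s * (y - s)\<bar> \<le> (y - s)\<^sup>2"
  proof (cases "0 \<le> s"; cases "0 \<le> y")
    assume *: "0 \<le> s" "\<not> 0 \<le> y"
    have "(max 0 y)\<^sup>2 - (max 0 s)\<^sup>2 - 2 * max 0 s * (y - s) = s * s - 2 * (s * y)"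
      using * by (simp add: max_def power2_eq_square algebra_simps)
    moreover have "(y - s)\<^sup>2 = y * y + s * s - 2 * (s * y)" by (simp add: power2_eq_square algebra_simps)
    moreover have "s * y \<le> 0" using * by (auto simp: mult_nonneg_nonpos)
    ultimately show ?thesis using zero_le_square[of y] zero_le_square[of s] by linarith
  next
    assume *: "\<not> 0 \<le> s" "0 \<le> y"
    have "s * s \<ge> 0" "s * y \<le> 0" using * by (auto simp: mult_nonpos_nonneg)
    then show ?thesis using * by (simp add: max_def power2_eq_square algebra_simps)
  next
    assume *: "0 \<le> s" "0 \<le> y"
    then have "(max 0 y)\<^sup>2 - (max 0 s)\<^sup>2 - 2 * max 0 s * (y - s) = (y - s)\<^sup>2"
      by (simp add: power2_eq_square algebra_simps)
    then show ?thesis by simp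
  next
    assume *: "\<not> 0 \<le> s" "\<not> 0 \<le> y"
    then have "max 0 s = 0" "max 0 y = 0" by auto
    then show ?thesis by simp
  qed
  then show "norm ((max 0 y)\<^sup>2 - (max 0 s)\<^sup>2 - 2 * max 0 s * (y - s)) / norm (y - s) \<le> \<bar>y - s\<bar>"
    using y by (simp add: divide_le_eq power2_eq_square abs_mult[symmetric])
next
  have "((\<lambda>y. \<bar>y - s\<bar>) \<longlongrightarrow> \<bar>s - s\<bar>) (at s)" by (intro tendsto_intros)
  then show "((\<lambda>y. \<bar>y - s\<bar>) \<longlongrightarrow> 0) (at s)" by simp
qed simp

text \<open>
  The square of the positive part is continuously differentiable, and composing it twice gives a cutoff that is
  constant on both sides.
\<close>

lemma C1_cutoff:
  obtains \<theta> \<theta>' :: "real \<Rightarrow> real" where "\<And>s. (\<theta> has_real_derivative \<theta>' s) (at s)" "continuous_on UNIV \<theta>'"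
    "\<And>s. s \<le> 1 \<Longrightarrow> \<theta> s = 1" "\<And>s. 2 \<le> s \<Longrightarrow> \<theta> s = 0" "\<And>s. 2 \<le> s \<Longrightarrow> \<theta>' s = 0" "\<And>s. \<bar>\<theta>' s\<bar> \<le> 4"
proof -
  define \<theta> :: "real \<Rightarrow> real" where "\<theta> s = (max 0 (1 - (max 0 (s - 1))\<^sup>2))\<^sup>2" for s
  define \<theta>' :: "real \<Rightarrow> real" where "\<theta>' s = 2 * max 0 (1 - (max 0 (s - 1))\<^sup>2) * (0 - 2 * max 0 (s - 1) * (1 - 0))" for s
  show thesis
  proof (rule that[of \<theta> \<theta>'])
    show "(\<theta> has_real_derivative \<theta>' s) (at s)" for s
      unfolding \<theta>_def \<theta>'_def
      by (intro DERIV_chain2[OF has_real_derivative_square_pos] DERIV_diff DERIV_const DERIV_ident)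
    show "continuous_on UNIV \<theta>'" unfolding \<theta>'_def by (intro continuous_intros)
    show "\<theta> s = 1" if "s \<le> 1" for s using that by (simp add: \<theta>_def)
    have sq: "1 \<le> (max 0 (s - 1))\<^sup>2" if "2 \<le> s" for s :: real
      using that by (simp add: max_def one_le_power)
    show "\<theta> s = 0" if "2 \<le> s" for s using sq[OF that] by (simp add: \<theta>_def)
    show z: "\<theta>' s = 0" if "2 \<le> s" for s using sq[OF that] by (simp add: \<theta>'_def)
    show "\<bar>\<theta>' s\<bar> \<le> 4" for s
    proof (cases "2 \<le> s")
      case False
      have "\<bar>\<theta>' s\<bar> = 2 * max 0 (1 - (max 0 (s - 1))\<^sup>2) * (2 * max 0 (s - 1))"
        by (simp add: \<theta>'_def abs_mult)
      also have "\<dots> \<le> 2 * 1 * (2 * 1)"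
        using False by (intro mult_mono) auto
      finally show ?thesis by simp
    qed (simp add: z)
  qed
qed

lemma C1_bump:
  fixes p :: "real ^ 'n" and c :: "real ^ 'm"
  assumes \<rho>: "0 < \<rho>"
  obtains f A where "\<And>x. (f has_derivative (*v) (A x)) (at x)" "continuous_on UNIV A"
    "\<And>x. norm (A x) \<le> real CARD('m) * (real CARD('n) * (16 / \<rho> * norm c))"
    "\<And>x. norm (x - p) \<le> \<rho> \<Longrightarrow> f x = c" "\<And>x. 2 * \<rho> \<le> norm (x - p) \<Longrightarrow> f x = 0" "\<And>x. 2 * \<rho> \<le> norm (x - p) \<Longrightarrow> A x = 0"
proof -
  obtain \<theta> \<theta>' :: "real \<Rightarrow> real" where \<theta>: "\<And>s. (\<theta> has_real_derivative \<theta>' s) (at s)" "continuous_on UNIV \<theta>'"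
    "\<And>s. s \<le> 1 \<Longrightarrow> \<theta> s = 1" "\<And>s. 2 \<le> s \<Longrightarrow> \<theta> s = 0" "\<And>s. 2 \<le> s \<Longrightarrow> \<theta>' s = 0" "\<And>s. \<bar>\<theta>' s\<bar> \<le> 4"
    by (rule C1_cutoff) blast
  define q where "q x = ((x - p) \<bullet> (x - p)) / \<rho>\<^sup>2" for x
  define s where "s x = \<theta>' (q x) * (2 / \<rho>\<^sup>2)" for x
  define f where "f x = \<theta> (q x) *\<^sub>R c" for x
  define A :: "real ^ 'n \<Rightarrow> real ^ 'n ^ 'm" where "A x = (\<chi> i j. c $ i * (s x * (x - p) $ j))" for x
  have Av: "A x *v v = (s x * ((x - p) \<bullet> v)) *\<^sub>R c" for x v
    by (simp add: A_def vec_eq_iff matrix_vector_mult_def inner_vec_def sum_distrib_left mult_ac)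
  have q2: "q x = (norm (x - p) / \<rho>)\<^sup>2" for x
    by (simp add: q_def power_divide power2_norm_eq_inner)
  have q_ge: "2 \<le> q x" if "2 * \<rho> \<le> norm (x - p)" for x
  proof -
    have "2 \<le> norm (x - p) / \<rho>" using that \<rho> by (simp add: le_divide_eq)
    then have "2\<^sup>2 \<le> (norm (x - p) / \<rho>)\<^sup>2" by (intro power_mono) auto
    then show ?thesis by (simp add: q2)
  qed
  have q_le: "q x \<le> 1" if "norm (x - p) \<le> \<rho>" for x
  proof -
    have "norm (x - p) / \<rho> \<le> 1" using that \<rho> by (simp add: divide_le_eq)
    then show ?thesis unfolding q2 using \<rho> by (intro power_le_one) auto
  qed
  have cont_q: "continuous_on UNIV q" unfolding q_def using \<rho> by (intro continuous_intros) auto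
  have cont_s: "continuous_on UNIV s" unfolding s_def
    by (intro continuous_intros continuous_on_compose2[OF \<theta>(2) cont_q]) auto
  show thesis
  proof (rule that[of f A])
    fix x
    have "(q has_derivative (\<lambda>v. (2 * ((x - p) \<bullet> v)) / \<rho>\<^sup>2)) (at x)"
      unfolding q_def divide_inverse by (auto intro!: derivative_eq_intros simp: inner_commute)
    moreover have "(\<theta> has_derivative (*) (\<theta>' (q x))) (at (q x))"
      using \<theta>(1) by (simp add: has_field_derivative_def)
    ultimately have "((\<lambda>x. \<theta> (q x)) has_derivative (\<lambda>v. \<theta>' (q x) * ((2 * ((x - p) \<bullet> v)) / \<rho>\<^sup>2))) (at x)"
      by (rule has_derivative_compose)
    then have "(f has_derivative (\<lambda>v. (\<theta>' (q x) * ((2 * ((x - p) \<bullet> v)) / \<rho>\<^sup>2)) *\<^sub>R c)) (at x)"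
      unfolding f_def by (rule has_derivative_scaleR_left)
    then show "(f has_derivative (*v) (A x)) (at x)"
      by (rule has_derivative_eq_rhs) (rule ext, simp add: Av s_def)
    have "norm (A x *v v) \<le> (16 / \<rho> * norm c) * norm v" for v
    proof -
      have sx: "\<bar>s x\<bar> * norm (x - p) \<le> 16 / \<rho>"
      proof (cases "2 * \<rho> \<le> norm (x - p)")
        case True
        then show ?thesis using \<theta>(5)[OF q_ge] \<rho> by (simp add: s_def)
      next
        case False
        have "\<bar>s x\<bar> * norm (x - p) \<le> (4 * (2 / \<rho>\<^sup>2)) * (2 * \<rho>)"
          using False \<theta>(6)[of "q x"] \<rho> unfolding s_def abs_mult by (intro mult_mono) auto
        also have "\<dots> = 16 / \<rho>" using \<rho> by (simp add: power2_eq_square)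
        finally show ?thesis .
      qed
      have "norm (A x *v v) = \<bar>s x\<bar> * \<bar>(x - p) \<bullet> v\<bar> * norm c" by (simp add: Av abs_mult)
      also have "\<dots> \<le> \<bar>s x\<bar> * (norm (x - p) * norm v) * norm c"
        by (intro mult_right_mono mult_left_mono Cauchy_Schwarz_ineq2) auto
      also have "\<dots> = (\<bar>s x\<bar> * norm (x - p)) * (norm v * norm c)" by simp
      also have "\<dots> \<le> 16 / \<rho> * (norm v * norm c)" using sx by (intro mult_right_mono) auto
      finally show ?thesis by (simp add: mult_ac)
    qed
    then show "norm (A x) \<le> real CARD('m) * (real CARD('n) * (16 / \<rho> * norm c))" by (rule norm_matrix_le)
    show "f x = c" if "norm (x - p) \<le> \<rho>" using \<theta>(3)[OF q_le[OF that]] by (simp add: f_def)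
    show "f x = 0" if "2 * \<rho> \<le> norm (x - p)" using \<theta>(4)[OF q_ge[OF that]] by (simp add: f_def)
    show "A x = 0" if "2 * \<rho> \<le> norm (x - p)" using \<theta>(5)[OF q_ge[OF that]] by (simp add: A_def s_def vec_eq_iff)
  next
    show "continuous_on UNIV A" unfolding A_def
      by (intro continuous_on_vec_lambda continuous_intros cont_s)
  qed
qed

text \<open>
  Each bump is dominated by a cone that vanishes outside its ball. For two points in different
  balls, the values add up to at most \<open>\<Lambda>\<close> times the distance that the connecting segment spends in the
  two balls, so gluing does not increase the Lipschitz constant.
\<close>

lemma lipschitz_disjoint_bumps:
  fixes N :: "'a::euclidean_space \<Rightarrow> real" and M :: "'b::euclidean_space \<Rightarrow> real" and \<phi> :: "nat \<Rightarrow> 'a \<Rightarrow> 'b"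
  assumes N: "is_norm N" and M: "is_norm M" and \<Lambda>: "0 \<le> \<Lambda>"
    and bound: "\<And>k z. M (\<phi> k z) \<le> \<Lambda> * max 0 (R k - N (z - x k))"
    and lip: "\<And>k z z'. M (\<phi> k z - \<phi> k z') \<le> \<Lambda> * N (z - z')"
    and disj: "\<And>j k. j \<noteq> k \<Longrightarrow> R j + R k \<le> N (x j - x k)"
  obtains h where "\<And>k z. N (z - x k) < R k \<Longrightarrow> h z = \<phi> k z" "\<And>z. (\<And>k. R k \<le> N (z - x k)) \<Longrightarrow> h z = 0"
    "\<And>z z'. M (h z - h z') \<le> \<Lambda> * N (z - z')"
proof -
  interpret N: vnorm N by standard fact
  interpret M: vnorm M by standard fact
  define h where "h z = (if \<exists>k. N (z - x k) < R k then \<phi> (SOME k. N (z - x k) < R k) z else 0)" for z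
  have uniq: "j = k" if "N (z - x j) < R j" "N (z - x k) < R k" for z j k
  proof (rule ccontr)
    assume "j \<noteq> k"
    then show False
      using disj[of j k] N.triangle_diff[of "x j" "x k" z] N.minus_commute[of z "x j"] that by linarith
  qed
  have h1: "h z = \<phi> k z" if "N (z - x k) < R k" for k z
  proof -
    have "(SOME k. N (z - x k) < R k) = k" using that uniq by (intro some_equality) auto
    then show ?thesis using that by (auto simp: h_def)
  qed
  have h2: "h z = 0" if "\<And>k. R k \<le> N (z - x k)" for z using that by (auto simp: h_def not_less[symmetric])
  have zero: "\<phi> k z = 0" if "R k \<le> N (z - x k)" for k z
  proof -
    have "max 0 (R k - N (z - x k)) = 0" using that by simp
    then have "M (\<phi> k z) \<le> 0" using bound[of k z] by simp
    then show ?thesis using M.nonneg[of "\<phi> k z"] M.eq0 by (metis antisym)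
  qed
  have one: "M (h z - h z') \<le> \<Lambda> * N (z - z')" if k: "N (z - x k) < R k" for k z z'
  proof (cases "\<exists>j. j \<noteq> k \<and> N (z' - x j) < R j")
    case True
    then obtain j where j: "j \<noteq> k" "N (z' - x j) < R j" by blast
    have "M (h z - h z') = M (\<phi> k z - \<phi> j z')" by (simp add: h1[OF k] h1[OF j(2)])
    also have "\<dots> \<le> M (\<phi> k z) + M (\<phi> j z')" using M.triangle[of "\<phi> k z" "- \<phi> j z'"] by simp
    also have "\<dots> \<le> \<Lambda> * (R k - N (z - x k)) + \<Lambda> * (R j - N (z' - x j))"
      using bound[of k z] bound[of j z'] k j by (simp add: max_def)
    also have "\<dots> = \<Lambda> * (R k + R j - N (z - x k) - N (z' - x j))" by (simp add: algebra_simps)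
    also have "\<dots> \<le> \<Lambda> * N (z - z')"
    proof (rule mult_left_mono[OF _ \<Lambda>])
      have "N (x k - x j) \<le> N (x k - z) + (N (z - z') + N (z' - x j))"
        using N.triangle_diff[of "x k" "x j" z] N.triangle_diff[of z "x j" z'] by linarith
      then show "R k + R j - N (z - x k) - N (z' - x j) \<le> N (z - z')"
        using disj[of k j] j N.minus_commute[of z "x k"] by auto
    qed
    finally show ?thesis .
  next
    case False
    have "h z' = \<phi> k z'"
    proof (cases "N (z' - x k) < R k")
      case False2: False
      then have "h z' = 0" using False by (intro h2) (metis not_less)
      then show ?thesis using zero[of k z'] False2 by simp
    qed (rule h1)
    then show ?thesis using lip h1[OF k] by simp
  qed
  have "M (h z - h z') \<le> \<Lambda> * N (z - z')" for z z'
  proof (cases "\<exists>k. N (z - x k) < R k")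
    case True
    then show ?thesis using one by blast
  next
    case no1: False
    show ?thesis
    proof (cases "\<exists>k. N (z' - x k) < R k")
      case True
      then show ?thesis using one[of z' _ z] M.minus_commute[of "h z"] N.minus_commute[of z] by auto
    next
      case False
      have "h z = 0" "h z' = 0" using no1 False by (auto simp: h_def)
      then show ?thesis using \<Lambda> by simp
    qed
  qed
  then show thesis using that h1 h2 by blast
qed

text \<open>
  On the ball around \<open>x0 + t k *\<^sub>R a k\<close> the set \<open>F z + h z\<close> contains \<open>y0\<close> exactly if \<open>F z\<close> contains the
  affine piece excluded by the probe. At the centre, the graph point \<open>y0 + t k *\<^sub>R b k\<close> is moved by \<open>h\<close> to
  within \<open>E k * r k * norm e\<close> of \<open>y0\<close>.
\<close>

lemma perturbation_not_subregular:
  fixes N :: "'a::euclidean_space \<Rightarrow> real" and M :: "'b::euclidean_space \<Rightarrow> real" and F :: "'a \<Rightarrow> 'b set"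
  assumes N: "is_norm N" and M: "is_norm M"
    and x: "(\<lambda>k. x0 + t k *\<^sub>R a k) \<longlonglongrightarrow> x0" and E: "E \<longlonglongrightarrow> 0" and r: "\<And>k. 0 < r k" and B0: "B 0 = (0::'b)"
    and inF: "\<And>k. y0 + t k *\<^sub>R b k \<in> F (x0 + t k *\<^sub>R a k)"
    and probe: "\<And>k x. norm (x - (x0 + t k *\<^sub>R a k)) \<le> r k \<Longrightarrow>
      y0 + t k *\<^sub>R b k - (E k * r k) *\<^sub>R e + B (x - (x0 + t k *\<^sub>R a k)) \<notin> F x"
    and h: "\<And>k x. norm (x - (x0 + t k *\<^sub>R a k)) \<le> r k \<Longrightarrow>
      h x = - (t k *\<^sub>R b k) + (E k * r k) *\<^sub>R e - B (x - (x0 + t k *\<^sub>R a k))"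
  shows "\<not> metrically_subregular N M (\<lambda>x. (\<lambda>y. y + h x) ` F x) x0 y0"
proof (rule not_subregular_of_gaps[OF N M x r])
  have "(\<lambda>k. \<bar>E k\<bar> * norm e) \<longlonglongrightarrow> \<bar>0\<bar> * norm e" by (intro tendsto_intros E)
  then show "(\<lambda>k. \<bar>E k\<bar> * norm e) \<longlonglongrightarrow> 0" by simp
  fix k
  have "h (x0 + t k *\<^sub>R a k) = - (t k *\<^sub>R b k) + (E k * r k) *\<^sub>R e"
    using h[of "x0 + t k *\<^sub>R a k" k] r[of k] B0 by simp
  then have "y0 + t k *\<^sub>R b k + h (x0 + t k *\<^sub>R a k) - y0 = (E k * r k) *\<^sub>R e" by simp
  then have "norm (y0 + t k *\<^sub>R b k + h (x0 + t k *\<^sub>R a k) - y0) \<le> \<bar>E k\<bar> * norm e * r k"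
    using r[of k] by (simp add: abs_mult)
  then show "\<exists>y\<in>(\<lambda>y. y + h (x0 + t k *\<^sub>R a k)) ` F (x0 + t k *\<^sub>R a k). norm (y - y0) \<le> \<bar>E k\<bar> * norm e * r k"
    using inF[of k] by blast
  fix z assume z: "norm (z - (x0 + t k *\<^sub>R a k)) \<le> r k"
  show "y0 \<notin> (\<lambda>y. y + h z) ` F z"
  proof
    assume "y0 \<in> (\<lambda>y. y + h z) ` F z"
    then have "y0 - h z \<in> F z" by auto
    moreover have "y0 - h z = y0 + t k *\<^sub>R b k - (E k * r k) *\<^sub>R e + B (z - (x0 + t k *\<^sub>R a k))"
      unfolding h[OF z] by simp
    ultimately show False using probe[OF z] by simp
  qed
qed

section \<open>Destabilizing perturbations\<close>

lemma probe_sequence: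
  fixes F :: "'a::euclidean_space \<Rightarrow> 'b::euclidean_space set"
  assumes pdd: "(u', v) \<in> primal_dual_derivative F x0 y0 u v'"
    and B: "bounded_linear B" and adj: "\<And>x. u' \<bullet> x = v' \<bullet> B x" and e: "v' \<bullet> e = 1"
    and \<theta>: "0 < \<theta>" "\<theta> \<le> 1" and E0: "0 < E0"
  obtains E t :: "nat \<Rightarrow> real" and a b \<rho> where
    "E \<longlonglongrightarrow> 0" "\<And>k. 0 < E k" "\<And>k. E k \<le> E0 * (1 / 2) ^ k" "\<And>k. E k \<le> E0"
    "\<And>j k. j < k \<Longrightarrow> t k \<le> \<theta> * t j" "(\<lambda>k. x0 + t k *\<^sub>R a k) \<longlonglongrightarrow> x0"
    "\<And>k. 0 < t k" "\<And>k. t k < E k" "\<And>k. norm (a k - u) < E k" "\<And>k. norm (b k - v) < E k"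
    "\<And>k. y0 + t k *\<^sub>R b k \<in> F (x0 + t k *\<^sub>R a k)" "\<And>k. 0 < \<rho> k"
    "\<And>k r x. \<lbrakk>0 < r; r \<le> \<rho> k; norm (x - (x0 + t k *\<^sub>R a k)) \<le> r\<rbrakk> \<Longrightarrow>
      y0 + t k *\<^sub>R b k - (E k * r) *\<^sub>R e + B (x - (x0 + t k *\<^sub>R a k)) \<notin> F x"
proof -
  define Q where "Q = (\<lambda>\<epsilon> (t, a, b, \<rho>). 0 < t \<and> t < \<epsilon> \<and> norm (a - u) < \<epsilon> \<and> norm (b - v) < \<epsilon> \<and>
      y0 + t *\<^sub>R b \<in> F (x0 + t *\<^sub>R a) \<and> 0 < \<rho> \<and>
    (\<forall>r x. 0 < r \<longrightarrow> r \<le> \<rho> \<longrightarrow> norm (x - (x0 + t *\<^sub>R a)) \<le> r \<longrightarrow>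
      y0 + t *\<^sub>R b - (\<epsilon> * r) *\<^sub>R e + B (x - (x0 + t *\<^sub>R a)) \<notin> F x))"
  have probe: "\<exists>s. Q \<epsilon> s" if "0 < \<epsilon>" for \<epsilon>
    using normal_probe[OF pdd B adj e that] unfolding Q_def by auto
  obtain E s where s: "\<And>k. Q (E k) (s k)" "\<And>k. 0 < E k" "\<And>k. E k \<le> E0 * (1 / 2) ^ k"
    "\<And>j k. j < k \<Longrightarrow> fst (s k) \<le> \<theta> * fst (s j)"
  proof (rule shrinking_probes[of Q fst \<theta> E0])
    show "\<exists>s. Q \<epsilon> s" if "0 < \<epsilon>" for \<epsilon> using that by (rule probe)
    show "0 < fst s \<and> fst s < \<epsilon>" if "Q \<epsilon> s" for \<epsilon> s using that by (auto simp: Q_def)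
  qed (use E0 \<theta> in auto)
  define t a b \<rho> where "t k = fst (s k)" and "a k = fst (snd (s k))" and "b k = fst (snd (snd (s k)))"
    and "\<rho> k = snd (snd (snd (s k)))" for k
  have sk: "s k = (t k, a k, b k, \<rho> k)" for k by (simp add: t_def a_def b_def \<rho>_def)
  have q: "0 < t k" "t k < E k" "norm (a k - u) < E k" "norm (b k - v) < E k"
    "y0 + t k *\<^sub>R b k \<in> F (x0 + t k *\<^sub>R a k)" "0 < \<rho> k"
    "\<And>r x. \<lbrakk>0 < r; r \<le> \<rho> k; norm (x - (x0 + t k *\<^sub>R a k)) \<le> r\<rbrakk> \<Longrightarrow>
      y0 + t k *\<^sub>R b k - (E k * r) *\<^sub>R e + B (x - (x0 + t k *\<^sub>R a k)) \<notin> F x" for k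
    using s(1)[of k] unfolding sk Q_def by auto
  have tt: "t k \<le> \<theta> * t j" if "j < k" for j k using s(4)[OF that] by (simp add: t_def)
  have EE: "E k \<le> E0" for k
  proof -
    have "E0 * (1 / 2) ^ k \<le> E0 * 1" using E0 by (intro mult_left_mono power_le_one) auto
    then show ?thesis using s(3)[of k] by simp
  qed
  have geo: "summable (\<lambda>k. E0 * (1 / 2) ^ k)" by (intro summable_mult summable_geometric) simp
  have Elim: "E \<longlonglongrightarrow> 0"
    by (rule Lim_null_comparison[OF always_eventually summable_LIMSEQ_zero[OF geo]])
      (use s(2,3) less_imp_le in \<open>simp add: abs_of_pos\<close>)
  have "(\<lambda>k. t k *\<^sub>R a k) \<longlonglongrightarrow> 0"
  proof (rule Lim_null_comparison[OF always_eventually])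
    show "(\<lambda>k. E k * (norm u + E0)) \<longlonglongrightarrow> 0" using tendsto_mult_right[OF Elim, of "norm u + E0"] by simp
    show "\<forall>k. norm (t k *\<^sub>R a k) \<le> E k * (norm u + E0)"
    proof
      fix k
      have "norm (a k) \<le> norm u + E0" using norm_triangle_sub[of "a k" u] q(3)[of k] EE[of k] by linarith
      then show "norm (t k *\<^sub>R a k) \<le> E k * (norm u + E0)"
        using q(1,2)[of k] by (simp add: mult_mono)
    qed
  qed
  from tendsto_add[OF tendsto_const[of x0] this]
  have Xlim: "(\<lambda>k. x0 + t k *\<^sub>R a k) \<longlonglongrightarrow> x0" by simp
  show thesis by (rule that[OF Elim s(2,3) EE tt Xlim q])
qed

text \<open>
  The perturbation is \<open>- B *v (z - x0)\<close> plus the bumps that are equal to \<open>c k\<close> near \<open>X k\<close>. Since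
  \<open>B *v u = v\<close>, the vector \<open>b k - B *v a k\<close> tends to \<open>0\<close>, so \<open>c k\<close> is small compared with \<open>t k\<close>, which is
  the order of the radius of the bump. The gradients of the bumps are summable and vanish at \<open>x0\<close>, so the sum is
  continuously differentiable and the Jacobian at \<open>x0\<close> is \<open>- B\<close>.
\<close>

lemma C1_destabilizing_perturbation:
  fixes N :: "real ^ 'n \<Rightarrow> real" and M :: "real ^ 'm \<Rightarrow> real" and F :: "real ^ 'n \<Rightarrow> (real ^ 'm) set"
  assumes N: "is_norm N" and M: "is_norm M"
    and pdd: "(transpose B *v v', B *v u) \<in> primal_dual_derivative F x0 y0 u v'"
    and u: "N u = 1" and v': "dual_norm M v' = 1"
  shows "\<exists>h\<in>F_C1 x0. \<not> metrically_subregular N M (\<lambda>x. (\<lambda>y. y + h x) ` F x) x0 y0 \<and>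
           lip N M h x0 \<le> ereal (op_norm N M B)"
proof -
  interpret N: vnorm N by standard fact
  interpret M: vnorm M by standard fact
  obtain e where e: "M e \<le> 1" "v' \<bullet> e = 1" using M.dual_attained[of v'] v' by metis
  define \<mu> where "\<mu> = norm u"
  have \<mu>: "0 < \<mu>" using u N.zero by (auto simp: \<mu>_def)
  have bl: "bounded_linear ((*v) B)" by (rule matrix_vector_mul_bounded_linear)
  obtain \<beta> where \<beta>: "0 < \<beta>" "\<And>x. norm (B *v x) \<le> \<beta> * norm x"
    using bounded_linear.pos_bounded[OF bl] by (metis mult.commute)
  define E0 where "E0 = min 1 (\<mu> / 2)"
  have E0: "0 < E0" using \<mu> by (simp add: E0_def)
  \<comment> \<open>For this ratio the ball of radius \<open>R k\<close> around \<open>X k\<close> does not meet the support of any other bump.\<close>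
  have \<theta>: "0 < (1 / 7 :: real)" "1 / 7 \<le> (1 :: real)" by auto
  obtain E t :: "nat \<Rightarrow> real" and a b \<rho> where
    Elim: "E \<longlonglongrightarrow> 0" and E: "\<And>k. 0 < E k" "\<And>k. E k \<le> E0 * (1 / 2) ^ k" "\<And>k. E k \<le> E0" and
    tt: "\<And>j k. j < k \<Longrightarrow> t k \<le> 1 / 7 * t j" and Xlim: "(\<lambda>k. x0 + t k *\<^sub>R a k) \<longlonglongrightarrow> x0" and
    q: "\<And>k. 0 < t k" "\<And>k. t k < E k" "\<And>k. norm (a k - u) < E k" "\<And>k. norm (b k - B *v u) < E k"
      "\<And>k. y0 + t k *\<^sub>R b k \<in> F (x0 + t k *\<^sub>R a k)" "\<And>k. 0 < \<rho> k"
      "\<And>k r x. \<lbrakk>0 < r; r \<le> \<rho> k; norm (x - (x0 + t k *\<^sub>R a k)) \<le> r\<rbrakk> \<Longrightarrow>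
        y0 + t k *\<^sub>R b k - (E k * r) *\<^sub>R e + B *v (x - (x0 + t k *\<^sub>R a k)) \<notin> F x"
    by (rule probe_sequence[OF pdd bl inner_transpose e(2) \<theta> E0]) blast
  have geo: "summable (\<lambda>k. E0 * (1 / 2) ^ k)" by (intro summable_mult summable_geometric) simp
  define X where "X k = x0 + t k *\<^sub>R a k" for k
  have na: "\<mu> / 2 \<le> norm (a k)" "norm (a k) \<le> 3 / 2 * \<mu>" for k
  proof -
    have "norm (a k - u) \<le> \<mu> / 2" using q(3)[of k] E(3)[of k] by (simp add: E0_def)
    then show "\<mu> / 2 \<le> norm (a k)" "norm (a k) \<le> 3 / 2 * \<mu>"
      using norm_triangle_ineq2[of u "a k"] norm_triangle_sub[of "a k" u] by (auto simp: \<mu>_def norm_minus_commute)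
  qed
  have nX: "t k * \<mu> / 2 \<le> norm (X k - x0)" "norm (X k - x0) \<le> 3 / 2 * (t k * \<mu>)" for k
    using mult_left_mono[OF na(1), of "t k" k] mult_left_mono[OF na(2), of "t k" k] q(1)[of k] by (auto simp: X_def)
  define R where "R k = t k * \<mu> / 8" for k
  have R: "0 < R k" for k using q(1) \<mu> by (simp add: R_def)
  have sep: "2 * R j \<le> norm (z - X j)" if z: "norm (z - X k) \<le> R k" and jk: "j \<noteq> k" for j k z
  proof -
    have tr: "norm (X k - x0) \<le> norm (z - X k) + norm (z - X j) + norm (X j - x0)"
      "norm (X j - x0) \<le> norm (z - X k) + norm (z - X j) + norm (X k - x0)"
      using norm_triangle_ineq[of "X k - z" "z - x0"] norm_triangle_ineq[of "z - X j" "X j - x0"]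
        norm_triangle_ineq[of "X j - z" "z - x0"] norm_triangle_ineq[of "z - X k" "X k - x0"]
      by (simp_all add: norm_minus_commute)
    consider "j < k" | "k < j" using jk by linarith
    then show ?thesis
    proof cases
      case 1
      then have "t k * \<mu> \<le> 1 / 7 * (t j * \<mu>)" using mult_right_mono[OF tt[OF 1], of \<mu>] \<mu> by simp
      then show ?thesis using tr(2) nX(1)[of j] nX(2)[of k] z mult_pos_pos[OF q(1)[of j] \<mu>] unfolding R_def by linarith
    next
      case 2
      then have "t j * \<mu> \<le> 1 / 7 * (t k * \<mu>)" using mult_right_mono[OF tt[OF 2], of \<mu>] \<mu> by simp
      then show ?thesis using tr(1) nX(1)[of k] nX(2)[of j] z mult_pos_pos[OF q(1)[of k] \<mu>] unfolding R_def by linarith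
    qed
  qed
  define r where "r k = min (\<rho> k) (R k)" for k
  have r: "0 < r k" "r k \<le> \<rho> k" "r k \<le> R k" for k using q(6)[of k] R[of k] by (auto simp: r_def)
  \<comment> \<open>The bump adds to \<open>- B *v (z - x0)\<close> what is missing to the affine piece of \<open>perturbation_not_subregular\<close>.\<close>
  define c where "c k = - (t k *\<^sub>R (b k - B *v a k)) + (E k * r k) *\<^sub>R e" for k
  define \<Gamma> where "\<Gamma> = 1 + \<beta> + \<mu> * norm e"
  have \<Gamma>: "0 \<le> \<Gamma>" using \<beta> \<mu> by (simp add: \<Gamma>_def)
  have nc: "norm (c k) \<le> t k * (E k * \<Gamma>)" for k
  proof -
    have "b k - B *v a k = (b k - B *v u) - B *v (a k - u)" by (simp add: matrix_vector_mult_diff_distrib)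
    then have "norm (b k - B *v a k) \<le> norm (b k - B *v u) + norm (B *v (a k - u))" by (metis norm_triangle_ineq4)
    also have "norm (B *v (a k - u)) \<le> \<beta> * norm (a k - u)" by (rule \<beta>)
    also have "\<dots> \<le> \<beta> * E k" using q(3)[of k] \<beta> by simp
    finally have "norm (b k - B *v a k) \<le> E k * (1 + \<beta>)" using q(4)[of k] by (simp add: algebra_simps)
    then have 1: "t k * norm (b k - B *v a k) \<le> t k * (E k * (1 + \<beta>))" using q(1)[of k] by simp
    have "r k \<le> t k * \<mu>" using r(3)[of k] mult_pos_pos[OF q(1)[of k] \<mu>] by (simp add: R_def)
    then have 2: "E k * r k * norm e \<le> E k * (t k * \<mu>) * norm e"
      using E(1)[of k] by (intro mult_right_mono mult_left_mono) auto
    have "norm (c k) \<le> t k * norm (b k - B *v a k) + E k * r k * norm e"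
      using norm_triangle_ineq[of "- (t k *\<^sub>R (b k - B *v a k))" "(E k * r k) *\<^sub>R e"] q(1)[of k] E(1)[of k] r(1)[of k]
      by (simp add: c_def abs_mult)
    also have "\<dots> \<le> t k * (E k * (1 + \<beta>)) + E k * (t k * \<mu>) * norm e" using 1 2 by (rule add_mono)
    finally show ?thesis by (simp add: \<Gamma>_def algebra_simps)
  qed
  have "\<forall>k. \<exists>fA :: (real ^ 'n \<Rightarrow> real ^ 'm) \<times> (real ^ 'n \<Rightarrow> real ^ 'n ^ 'm).
    (\<forall>x. (fst fA has_derivative (*v) (snd fA x)) (at x)) \<and> continuous_on UNIV (snd fA) \<and>
    (\<forall>x. norm (snd fA x) \<le> real CARD('m) * (real CARD('n) * (16 / R k * norm (c k)))) \<and>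
    (\<forall>x. norm (x - X k) \<le> R k \<longrightarrow> fst fA x = c k) \<and>
    (\<forall>x. 2 * R k \<le> norm (x - X k) \<longrightarrow> fst fA x = 0 \<and> snd fA x = 0)"
  proof
    fix k
    obtain f and A :: "real ^ 'n \<Rightarrow> real ^ 'n ^ 'm" where
      "\<And>x. (f has_derivative (*v) (A x)) (at x)" "continuous_on UNIV A"
      "\<And>x. norm (A x) \<le> real CARD('m) * (real CARD('n) * (16 / R k * norm (c k)))"
      "\<And>x. norm (x - X k) \<le> R k \<Longrightarrow> f x = c k" "\<And>x. 2 * R k \<le> norm (x - X k) \<Longrightarrow> f x = 0"
      "\<And>x. 2 * R k \<le> norm (x - X k) \<Longrightarrow> A x = 0"
      by (rule C1_bump[where p = "X k" and c = "c k", OF R[of k]]) blast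
    then show "\<exists>fA :: (real ^ 'n \<Rightarrow> real ^ 'm) \<times> (real ^ 'n \<Rightarrow> real ^ 'n ^ 'm).
    (\<forall>x. (fst fA has_derivative (*v) (snd fA x)) (at x)) \<and> continuous_on UNIV (snd fA) \<and>
    (\<forall>x. norm (snd fA x) \<le> real CARD('m) * (real CARD('n) * (16 / R k * norm (c k)))) \<and>
    (\<forall>x. norm (x - X k) \<le> R k \<longrightarrow> fst fA x = c k) \<and>
    (\<forall>x. 2 * R k \<le> norm (x - X k) \<longrightarrow> fst fA x = 0 \<and> snd fA x = 0)"
      by (intro exI[of _ "(f, A)"]) simp
  qed
  from choice[OF this] obtain fA :: "nat \<Rightarrow> (real ^ 'n \<Rightarrow> real ^ 'm) \<times> (real ^ 'n \<Rightarrow> real ^ 'n ^ 'm)" where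
    fA: "\<And>k x. (fst (fA k) has_derivative (*v) (snd (fA k) x)) (at x)" "\<And>k. continuous_on UNIV (snd (fA k))"
    "\<And>k x. norm (snd (fA k) x) \<le> real CARD('m) * (real CARD('n) * (16 / R k * norm (c k)))"
    "\<And>k x. norm (x - X k) \<le> R k \<Longrightarrow> fst (fA k) x = c k"
    "\<And>k x. 2 * R k \<le> norm (x - X k) \<Longrightarrow> fst (fA k) x = 0"
    "\<And>k x. 2 * R k \<le> norm (x - X k) \<Longrightarrow> snd (fA k) x = 0" by blast
  define f A where "f k = fst (fA k)" and "A k = snd (fA k)" for k
  define W where "W = real CARD('m) * (real CARD('n) * (128 / \<mu> * \<Gamma>))"
  have W: "0 \<le> W" using \<mu> \<Gamma> by (simp add: W_def)
  have Abound: "norm (A k x) \<le> W * (E0 * (1 / 2) ^ k)" for k x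
  proof -
    have "norm (A k x) \<le> real CARD('m) * (real CARD('n) * (16 / R k * norm (c k)))" using fA(3) by (simp add: A_def)
    also have "\<dots> \<le> real CARD('m) * (real CARD('n) * (16 / R k * (t k * (E k * \<Gamma>))))"
      using R[of k] nc[of k] by (intro mult_left_mono) auto
    also have "16 / R k * (t k * (E k * \<Gamma>)) = 128 / \<mu> * \<Gamma> * E k" using q(1)[of k] \<mu> by (simp add: R_def)
    also have "real CARD('m) * (real CARD('n) * (128 / \<mu> * \<Gamma> * E k)) = W * E k" by (simp add: W_def)
    also have "\<dots> \<le> W * (E0 * (1 / 2) ^ k)" using E(2) W by (intro mult_left_mono)
    finally show ?thesis .
  qed
  have far: "2 * R k \<le> norm (x0 - X k)" for k
    using nX(1)[of k] mult_pos_pos[OF q(1)[of k] \<mu>] unfolding R_def norm_minus_commute[of x0] by linarith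
  have f0: "f k x0 = 0" and A0: "A k x0 = 0" for k using fA(5,6)[OF far] by (simp_all add: f_def A_def)
  obtain g where g: "\<And>x. (\<lambda>i. f i x) sums g x" "\<And>x. (g has_derivative (*v) (\<Sum>i. A i x)) (at x)"
    "continuous_on UNIV (\<lambda>x. \<Sum>i. A i x)"
    by (rule C1_series[of f A "\<lambda>k. W * (E0 * (1 / 2) ^ k)" x0])
      (use fA(1,2) Abound geo f0 in \<open>auto simp: f_def[symmetric] A_def[symmetric] intro: summable_mult\<close>)
  have gx0: "g x0 = 0" using sums_unique2[OF g(1)[of x0]] f0 by simp
  have gk: "g z = c k" if z: "norm (z - X k) \<le> r k" for z k
  proof -
    have zR: "norm (z - X k) \<le> R k" using z r(3)[of k] by linarith
    have "f i z = (if i = k then c k else 0)" for i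
      using fA(4)[OF zR] fA(5)[OF sep[OF zR]] by (auto simp: f_def)
    then have "(\<lambda>i. f i z) sums c k" using sums_single[of k "\<lambda>_. c k"] by simp
    then show ?thesis using sums_unique2[OF g(1)] by blast
  qed
  define h where "h z = - (B *v (z - x0)) + g z" for z
  have hder: "(h has_derivative (*v) (- B + (\<Sum>i. A i z))) (at z)" for z
  proof -
    have "(h has_derivative (\<lambda>v. - (B *v (v - 0)) + (\<Sum>i. A i z) *v v)) (at z)"
      unfolding h_def
      by (intro has_derivative_add g(2) has_derivative_minus bounded_linear.has_derivative[OF bl] has_derivative_diff
          has_derivative_ident has_derivative_const)
    then show ?thesis
    proof (rule has_derivative_eq_rhs, intro ext)
      fix v
      have "(- B) *v v = - (B *v v)" by (simp add: vec_eq_iff matrix_vector_mult_def sum_negf)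
      then show "- (B *v (v - 0)) + (\<Sum>i. A i z) *v v = (- B + (\<Sum>i. A i z)) *v v"
        by (simp add: matrix_vector_mult_add_rdistrib matrix_vector_mult_diff_rdistrib)
    qed
  qed
  have jac: "jacobian h (at z) = - B + (\<Sum>i. A i z)" for z
    using jacobian_derivative[OF hder] by (simp add: matrix_eq)
  have C1: "C1_around h x0"
    unfolding C1_around_def
  proof (intro exI[of _ UNIV] conjI ballI)
    show "h differentiable (at z)" for z using hder by (rule differentiableI)
    show "continuous_on UNIV (\<lambda>z. jacobian h (at z))" unfolding jac by (intro continuous_intros g(3))
  qed auto
  have "jacobian h (at x0) = - B" unfolding jac by (simp add: A0)
  moreover have "(- B) *v x = - (B *v x)" for x by (simp add: vec_eq_iff matrix_vector_mult_def sum_negf)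
  ultimately have op: "op_norm N M (jacobian h (at x0)) = op_norm N M B" by (simp add: op_norm_def)
  have lip: "lip N M h x0 \<le> ereal (op_norm N M B)"
  proof (rule ereal_le_epsilon2)
    fix \<epsilon> :: real assume "0 < \<epsilon>"
    then obtain \<delta> where "0 < \<delta>" "\<And>x x'. \<lbrakk>x \<in> ball x0 \<delta>; x' \<in> ball x0 \<delta>\<rbrakk> \<Longrightarrow> M (h x - h x') \<le> (op_norm N M B + \<epsilon>) * N (x - x')"
      using C1_lipschitz[OF C1 N M] unfolding op by meson
    then have "lip N M h x0 \<le> ereal (op_norm N M B + \<epsilon>)" by (intro lip_leI[OF _ N])
    then show "lip N M h x0 \<le> ereal (op_norm N M B) + ereal \<epsilon>" by simp
  qed
  have "\<not> metrically_subregular N M (\<lambda>x. (\<lambda>y. y + h x) ` F x) x0 y0"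
  proof (rule perturbation_not_subregular[where B = "(*v) B" and E = E and t = t and a = a and b = b and e = e and r = r])
    show "y0 + t k *\<^sub>R b k - (E k * r k) *\<^sub>R e + B *v (x - (x0 + t k *\<^sub>R a k)) \<notin> F x"
      if "norm (x - (x0 + t k *\<^sub>R a k)) \<le> r k" for k x
      by (rule q(7)[OF r(1,2) that])
    show "h x = - (t k *\<^sub>R b k) + (E k * r k) *\<^sub>R e - B *v (x - (x0 + t k *\<^sub>R a k))"
      if x: "norm (x - (x0 + t k *\<^sub>R a k)) \<le> r k" for k x
    proof -
      have "g x = c k" using gk x by (simp add: X_def)
      moreover have "B *v (x - x0) = B *v (x - (x0 + t k *\<^sub>R a k)) + t k *\<^sub>R (B *v a k)"
      proof -
        have "x - x0 = (x - (x0 + t k *\<^sub>R a k)) + t k *\<^sub>R a k" by simp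
        then show ?thesis by (metis matrix_vector_right_distrib matrix_vector_mult_scaleR)
      qed
      ultimately show ?thesis by (simp add: h_def c_def scaleR_diff_right)
    qed
  qed (use N M Xlim Elim r(1) q(5) in auto)
  moreover have "h \<in> F_C1 x0" using C1 gx0 by (simp add: F_C1_def h_def)
  ultimately show ?thesis using lip by blast
qed

text \<open>
  The perturbation has to take a value close to \<open>- t k *\<^sub>R b k\<close> at \<open>X k\<close>, which is at \<open>N\<close>-distance about
  \<open>t k\<close> from \<open>x0\<close>, and to have the slope \<open>- B\<close> near \<open>X k\<close>. A cone over a ball of radius \<open>R k\<close> slightly
  below \<open>t k\<close>, truncated at height \<open>t k\<close> and multiplied by \<open>- b k\<close>, provides the value with slope about
  \<open>M v\<close>; the slope \<open>1 + \<eta>\<close> of the cone leaves room for a plateau around \<open>X k\<close>, on which this part is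
  constant. The slope of \<open>B\<close> is at most the dual norm of \<open>u'\<close>, and clipping between multiples of the same cone
  confines this part to the ball with Lipschitz constant at most \<open>K\<close>.
\<close>

lemma Lipschitz_destabilizing_perturbation:
  fixes N :: "real ^ 'n \<Rightarrow> real" and M :: "real ^ 'm \<Rightarrow> real" and F :: "real ^ 'n \<Rightarrow> (real ^ 'm) set"
  assumes N: "is_norm N" and M: "is_norm M"
    and pdd: "(u', v) \<in> primal_dual_derivative F x0 y0 u v'"
    and u: "N u = 1" and v': "dual_norm M v' = 1" and \<eta>: "0 < \<eta>" "\<eta> \<le> 1"
  shows "\<exists>h\<in>F_Lip x0. \<not> metrically_subregular N M (\<lambda>x. (\<lambda>y. y + h x) ` F x) x0 y0 \<and>
           lip N M h x0 \<le> ereal ((1 + \<eta>) * (M v + \<eta>) + (dual_norm N u' + \<eta>))"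
proof -
  interpret N: vnorm N by standard fact
  interpret M: vnorm M by standard fact
  obtain e where e: "M e \<le> 1" "v' \<bullet> e = 1" using M.dual_attained[of v'] v' by metis
  obtain CN where CN: "0 < CN" "\<And>x. N x \<le> CN * norm x" using N.upper by blast
  obtain CM where CM: "0 < CM" "\<And>x. M x \<le> CM * norm x" using M.upper by blast
  obtain cN where cN: "0 < cN" "\<And>x. norm x \<le> cN * N x" using N.lower by blast
  obtain cM where cM: "0 < cM" "\<And>x. norm x \<le> cM * M x" using M.lower by blast
  define B where "B x = (u' \<bullet> x) *\<^sub>R e" for x
  have bl: "bounded_linear B" unfolding B_def
    by (rule bounded_linear_scaleR_const[OF bounded_linear_inner_right])
  have adj: "u' \<bullet> x = v' \<bullet> B x" for x using e(2) by (simp add: B_def)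
  define K0 where "K0 = dual_norm N u'"
  have K0: "0 \<le> K0" by (simp add: K0_def N.dual_nonneg)
  have u'x: "\<bar>u' \<bullet> x\<bar> \<le> K0 * N x" for x
    using N.inner_le_dual[of u' x] N.inner_le_dual[of u' "- x"] by (simp add: K0_def abs_le_iff)
  define K where "K = K0 + \<eta>"
  have K: "0 < K" "K0 \<le> K" "\<eta> \<le> K" using K0 \<eta> by (auto simp: K_def)
  define E0 where "E0 = Min {1, \<eta> / (16 * CN), \<eta> / CM}"
  have E0: "0 < E0" "E0 \<le> 1" "E0 \<le> \<eta> / (16 * CN)" "E0 \<le> \<eta> / CM" using \<eta> CN CM by (auto simp: E0_def)
  have E0N: "CN * E0 \<le> \<eta> / 16" "CM * E0 \<le> \<eta>" using E0(3,4) CN CM by (auto simp: field_simps)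
  have \<theta>: "0 < \<eta> / 16" "\<eta> / 16 \<le> 1" using \<eta> by auto
  obtain E t :: "nat \<Rightarrow> real" and a b \<rho> where
    Elim: "E \<longlonglongrightarrow> 0" and E: "\<And>k. 0 < E k" "\<And>k. E k \<le> E0 * (1 / 2) ^ k" "\<And>k. E k \<le> E0" and
    tt: "\<And>j k. j < k \<Longrightarrow> t k \<le> \<eta> / 16 * t j" and Xlim: "(\<lambda>k. x0 + t k *\<^sub>R a k) \<longlonglongrightarrow> x0" and
    q: "\<And>k. 0 < t k" "\<And>k. t k < E k" "\<And>k. norm (a k - u) < E k" "\<And>k. norm (b k - v) < E k"
      "\<And>k. y0 + t k *\<^sub>R b k \<in> F (x0 + t k *\<^sub>R a k)" "\<And>k. 0 < \<rho> k"
      "\<And>k r x. \<lbrakk>0 < r; r \<le> \<rho> k; norm (x - (x0 + t k *\<^sub>R a k)) \<le> r\<rbrakk> \<Longrightarrow>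
        y0 + t k *\<^sub>R b k - (E k * r) *\<^sub>R e + B (x - (x0 + t k *\<^sub>R a k)) \<notin> F x"
    by (rule probe_sequence[OF pdd bl adj e(2) \<theta> E0(1)]) blast
  define X where "X k = x0 + t k *\<^sub>R a k" for k
  have Na: "1 - \<eta> / 16 \<le> N (a k)" "N (a k) \<le> 1 + \<eta> / 16" for k
  proof -
    have "N (a k - u) \<le> CN * norm (a k - u)" by (rule CN)
    also have "\<dots> \<le> CN * E0" using q(3)[of k] E(3)[of k] CN by (intro mult_left_mono) auto
    finally have "N (a k - u) \<le> \<eta> / 16" using E0N by simp
    then show "1 - \<eta> / 16 \<le> N (a k)" "N (a k) \<le> 1 + \<eta> / 16"
      using N.reverse_triangle[of "a k" u] u by auto
  qed
  have NX: "t k * (1 - \<eta> / 16) \<le> N (X k - x0)" "N (X k - x0) \<le> t k * (1 + \<eta> / 16)" for k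
    using mult_left_mono[OF Na(1), of "t k" k] mult_left_mono[OF Na(2), of "t k" k] q(1)[of k] by (auto simp: X_def N.scale)
  \<comment> \<open>The cone has height \<open>(1 + \<eta>) * R k = t k * (1 + \<eta> / 2)\<close>, above the truncation level \<open>t k\<close>,
    and \<open>R k\<close> is at most \<open>N (X k - x0)\<close>, so \<open>x0\<close> is outside all balls.\<close>
  define R where "R k = t k * ((1 + \<eta> / 2) / (1 + \<eta>))" for k
  have frac: "(1 + \<eta> / 2) / (1 + \<eta>) \<le> 1 - \<eta> / 4" "3 / 4 \<le> (1 + \<eta> / 2) / (1 + \<eta>)"
  proof -
    have "\<eta> * \<eta> \<le> \<eta> * 1" using \<eta> by (intro mult_left_mono) auto
    moreover have "(1 - \<eta> / 4) * (1 + \<eta>) = 1 + \<eta> - \<eta> / 4 - \<eta> * \<eta> / 4" by (simp add: field_simps)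
    ultimately have "1 + \<eta> / 2 \<le> (1 - \<eta> / 4) * (1 + \<eta>)" by linarith
    then show "(1 + \<eta> / 2) / (1 + \<eta>) \<le> 1 - \<eta> / 4" using \<eta> by (intro mult_imp_div_pos_le) auto
    show "3 / 4 \<le> (1 + \<eta> / 2) / (1 + \<eta>)" using \<eta> by (simp add: le_divide_eq)
  qed
  have R: "R k \<le> t k * (1 - \<eta> / 4)" "t k * (3 / 4) \<le> R k" "(1 + \<eta>) * R k = t k * (1 + \<eta> / 2)" for k
    using mult_left_mono[OF frac(1), of "t k"] mult_left_mono[OF frac(2), of "t k"] q(1)[of k] \<eta> by (auto simp: R_def)
  have disj: "R j + R k \<le> N (X j - X k)" if "j \<noteq> k" for j k
  proof -
    have aux: "R j + R k \<le> N (X j - X k)" if jk: "j < k" for j k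
    proof -
      have "N (X j - x0) \<le> N (X j - X k) + N (X k - x0)" by (rule N.triangle_diff)
      moreover have "t k * (1 + \<eta> / 16) \<le> t k * (17 / 16)" using q(1)[of k] \<eta> by (intro mult_left_mono) auto
      moreover have "R k \<le> t k"
        using R(1)[of k] mult_pos_pos[OF q(1)[of k] \<eta>(1)] by (simp add: algebra_simps)
      moreover have "t j * (1 - \<eta> / 16) - t j * (1 - \<eta> / 4) = 3 * (\<eta> / 16 * t j)" by (simp add: algebra_simps)
      ultimately show ?thesis using NX(1)[of j] NX(2)[of k] R(1)[of j] tt[OF jk] q(1)[of k] by linarith
    qed
    show ?thesis
      using aux[of j k] aux[of k j] that N.minus_commute[of "X j" "X k"] by (cases "j < k") (auto simp: add.commute)
  qed
  have far: "R k \<le> N (x0 - X k)" for k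
  proof -
    have "t k * (1 - \<eta> / 4) \<le> t k * (1 - \<eta> / 16)" using q(1)[of k] \<eta> by (intro mult_left_mono) auto
    then show ?thesis using R(1)[of k] NX(1)[of k] N.minus_commute[of x0 "X k"] by linarith
  qed
  \<comment> \<open>On the ball of radius \<open>t k * \<omega>\<close> the first bound keeps the cone above the truncation level \<open>t k\<close>,
    and the second keeps the affine function within the clipping bounds.\<close>
  define \<omega> where "\<omega> = min (\<eta> / (4 * CN)) (\<eta> / (2 * (1 + K0 * CN)))"
  have den: "0 < 1 + K0 * CN" using K0 CN by (simp add: add_pos_nonneg)
  have \<omega>: "0 < \<omega>" "CN * \<omega> \<le> \<eta> / 4" "(1 + K0 * CN) * \<omega> \<le> \<eta> / 2"
  proof -
    show "0 < \<omega>" using \<eta> CN den by (simp add: \<omega>_def)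
    have "\<omega> \<le> \<eta> / (4 * CN)" "\<omega> \<le> \<eta> / (2 * (1 + K0 * CN))"
      unfolding \<omega>_def by (rule min.cobounded1, rule min.cobounded2)
    then show "CN * \<omega> \<le> \<eta> / 4" "(1 + K0 * CN) * \<omega> \<le> \<eta> / 2"
      using CN den by (auto simp: le_divide_eq mult_ac)
  qed
  define r where "r k = min (\<rho> k) (t k * \<omega>)" for k
  have r: "0 < r k" "r k \<le> \<rho> k" "r k \<le> t k * \<omega>" for k using q(1,6)[of k] \<omega> by (auto simp: r_def)
  have rN: "CN * r k \<le> t k * (\<eta> / 4)" for k
  proof -
    have "CN * r k \<le> CN * (t k * \<omega>)" using r(3)[of k] CN by (intro mult_left_mono) auto
    also have "\<dots> = t k * (CN * \<omega>)" by simp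
    also have "\<dots> \<le> t k * (\<eta> / 4)" using \<omega>(2) q(1)[of k] by (intro mult_left_mono) auto
    finally show ?thesis .
  qed
  have rK: "(1 + K0 * CN) * r k \<le> t k * (\<eta> / 2)" for k
  proof -
    have "(1 + K0 * CN) * r k \<le> (1 + K0 * CN) * (t k * \<omega>)" using r(3)[of k] den by (intro mult_left_mono) auto
    also have "\<dots> = t k * ((1 + K0 * CN) * \<omega>)" by simp
    also have "\<dots> \<le> t k * (\<eta> / 2)" using \<omega>(3) q(1)[of k] by (intro mult_left_mono) auto
    finally show ?thesis .
  qed
  define \<psi> where "\<psi> k z = max 0 (R k - N (z - X k))" for k z
  define plateau where "plateau k z = min (t k) ((1 + \<eta>) * \<psi> k z)" for k z
  define clip where "clip k z = max (- (K * \<psi> k z)) (min (K * \<psi> k z) (E k * r k - u' \<bullet> (z - X k)))" for k z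
  define \<phi> where "\<phi> k z = - (plateau k z *\<^sub>R b k) + clip k z *\<^sub>R e" for k z
  define \<Lambda> where "\<Lambda> = (1 + \<eta>) * (M v + \<eta>) + K"
  have \<Lambda>: "0 \<le> \<Lambda>" using \<eta> K by (simp add: \<Lambda>_def)
  have \<psi>0: "0 \<le> \<psi> k z" for k z by (simp add: \<psi>_def)
  have \<psi>lip: "\<bar>\<psi> k z - \<psi> k z'\<bar> \<le> N (z - z')" for k z z'
    using N.reverse_triangle[of "z - X k" "z' - X k"] unfolding \<psi>_def by (simp add: max_def abs_if split: if_splits)
  have c\<psi>lip: "\<bar>c * \<psi> k z - c * \<psi> k z'\<bar> \<le> c * N (z - z')" if "0 \<le> c" for c k z z'
    using mult_left_mono[OF \<psi>lip[of k z z'] that] that by (simp add: right_diff_distrib[symmetric] abs_mult)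
  have minlip: "\<bar>min d p - min d p'\<bar> \<le> D" if "\<bar>p - p'\<bar> \<le> D" for d p p' D :: real
    using that by (simp add: min_def abs_if split: if_splits)
  have plip: "\<bar>plateau k z - plateau k z'\<bar> \<le> (1 + \<eta>) * N (z - z')" for k z z'
    unfolding plateau_def by (rule minlip[OF c\<psi>lip]) (use \<eta> in simp)
  have ulip: "\<bar>(E k * r k - u' \<bullet> (z - X k)) - (E k * r k - u' \<bullet> (z' - X k))\<bar> \<le> K * N (z - z')" for k z z'
  proof -
    have "(E k * r k - u' \<bullet> (z - X k)) - (E k * r k - u' \<bullet> (z' - X k)) = u' \<bullet> (z' - z)" by (simp add: inner_diff_right)
    then show ?thesis using u'x[of "z' - z"] mult_right_mono[OF K(2) N.nonneg, of "z' - z"] N.minus_commute[of z z'] by simp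
  qed
  have cliplip: "\<bar>max (- p) (min p w) - max (- p') (min p' w')\<bar> \<le> D"
    if "\<bar>p - p'\<bar> \<le> D" "\<bar>w - w'\<bar> \<le> D" for p p' w w' D :: real
    using that by (simp add: max_def min_def abs_if split: if_splits)
  have clip: "\<bar>clip k z - clip k z'\<bar> \<le> K * N (z - z')" for k z z'
    unfolding clip_def by (rule cliplip[OF c\<psi>lip ulip]) (use K in simp)
  have clipb: "\<bar>clip k z\<bar> \<le> K * \<psi> k z" for k z
    unfolding clip_def using mult_nonneg_nonneg[OF less_imp_le[OF K(1)] \<psi>0[of k z]] by (simp add: abs_le_iff)
  have platb: "0 \<le> plateau k z" "plateau k z \<le> (1 + \<eta>) * \<psi> k z" for k z
    using \<psi>0[of k z] \<eta> q(1)[of k] by (auto simp: plateau_def)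
  have Mb: "M (b k) \<le> M v + \<eta>" for k
  proof -
    have "M (b k - v) \<le> CM * norm (b k - v)" by (rule CM)
    also have "\<dots> \<le> CM * E0" using q(4)[of k] E(3)[of k] CM by (intro mult_left_mono) auto
    finally have "M (b k - v) \<le> \<eta>" using E0N by simp
    then show ?thesis using M.triangle[of "b k - v" v] by simp
  qed
  have Mcomb: "M (- (p *\<^sub>R b k) + w *\<^sub>R e) \<le> \<Lambda> * D"
    if "\<bar>p\<bar> \<le> (1 + \<eta>) * D" "\<bar>w\<bar> \<le> K * D" for p w D k
  proof -
    have D: "0 \<le> D" using that(2) K(1) abs_ge_zero[of w] by (metis order_trans zero_le_mult_iff not_less less_le_not_le)
    have "M (- (p *\<^sub>R b k) + w *\<^sub>R e) \<le> M (- (p *\<^sub>R b k)) + M (w *\<^sub>R e)" by (rule M.triangle)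
    also have "\<dots> = \<bar>p\<bar> * M (b k) + \<bar>w\<bar> * M e" by (simp add: M.scale)
    also have "\<bar>p\<bar> * M (b k) \<le> ((1 + \<eta>) * D) * (M v + \<eta>)" using that(1) Mb D \<eta> by (intro mult_mono) auto
    also have "\<bar>w\<bar> * M e \<le> (K * D) * 1" using that(2) e(1) D K by (intro mult_mono) auto
    finally show ?thesis by (simp add: \<Lambda>_def algebra_simps)
  qed
  have \<phi>b: "M (\<phi> k z) \<le> \<Lambda> * max 0 (R k - N (z - X k))" for k z
    unfolding \<phi>_def \<psi>_def[symmetric] using platb[of k z] clipb[of k z] by (intro Mcomb) auto
  have \<phi>l: "M (\<phi> k z - \<phi> k z') \<le> \<Lambda> * N (z - z')" for k z z'
  proof -
    have "\<phi> k z - \<phi> k z' = - ((plateau k z - plateau k z') *\<^sub>R b k) + (clip k z - clip k z') *\<^sub>R e"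
      by (simp add: \<phi>_def scaleR_left_diff_distrib)
    then show ?thesis using Mcomb[OF plip clip] by simp
  qed
  obtain h where h: "\<And>k z. N (z - X k) < R k \<Longrightarrow> h z = \<phi> k z" "\<And>z. (\<And>k. R k \<le> N (z - X k)) \<Longrightarrow> h z = 0"
    "\<And>z z'. M (h z - h z') \<le> \<Lambda> * N (z - z')"
  proof (rule lipschitz_disjoint_bumps[where \<phi> = \<phi> and R = R and x = X, OF N M \<Lambda> \<phi>b \<phi>l disj])
    fix h
    assume a1: "\<And>k z. N (z - X k) < R k \<Longrightarrow> h z = \<phi> k z" and a2: "\<And>z. (\<And>k. R k \<le> N (z - X k)) \<Longrightarrow> h z = 0"
      and a3: "\<And>z z'. M (h z - h z') \<le> \<Lambda> * N (z - z')"
    show thesis by (rule that[of h]) (fact a1, erule a2, rule a3)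
  qed
  have hk: "h z = - (t k *\<^sub>R b k) + (E k * r k) *\<^sub>R e - B (z - X k)" if z: "norm (z - X k) \<le> r k" for k z
  proof -
    have Nz: "N (z - X k) \<le> CN * r k" using CN(2)[of "z - X k"] mult_left_mono[OF z, of CN] CN(1) by linarith
    have t4: "t k * (\<eta> / 4) \<le> t k * (1 / 4)" using q(1)[of k] \<eta> by (intro mult_left_mono) auto
    have NR: "N (z - X k) < R k" using Nz rN[of k] t4 R(2)[of k] q(1)[of k] by linarith
    have \<psi>z: "\<psi> k z = R k - N (z - X k)" using NR by (simp add: \<psi>_def)
    have "plateau k z = t k"
    proof -
      have "(1 + \<eta>) * N (z - X k) \<le> 2 * (t k * (\<eta> / 4))" using Nz rN[of k] \<eta> by (intro mult_mono) auto
      then have "t k \<le> (1 + \<eta>) * R k - (1 + \<eta>) * N (z - X k)" unfolding R(3) by (simp add: algebra_simps)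
      then show ?thesis by (simp add: plateau_def \<psi>z right_diff_distrib)
    qed
    moreover have "clip k z = E k * r k - u' \<bullet> (z - X k)"
    proof -
      have "\<bar>E k * r k - u' \<bullet> (z - X k)\<bar> \<le> \<bar>E k * r k\<bar> + \<bar>u' \<bullet> (z - X k)\<bar>" by (rule abs_triangle_ineq4)
      also have "\<bar>E k * r k\<bar> \<le> 1 * r k" using E(1)[of k] E(3)[of k] E0(2) r(1)[of k] by (simp add: abs_mult)
      also have "\<bar>u' \<bullet> (z - X k)\<bar> \<le> K0 * (CN * r k)"
        using u'x[of "z - X k"] mult_left_mono[OF Nz K0] by linarith
      finally have "\<bar>E k * r k - u' \<bullet> (z - X k)\<bar> \<le> (1 + K0 * CN) * r k" by (simp add: algebra_simps)
      also have "\<dots> \<le> t k * (\<eta> / 2)" by (rule rK)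
      also have "\<dots> \<le> K * (t k / 2)" using mult_right_mono[OF K(3), of "t k / 2"] q(1)[of k] by (simp add: mult_ac)
      also have "\<dots> \<le> K * \<psi> k z"
        unfolding \<psi>z using Nz rN[of k] t4 R(2)[of k] K(1) by (intro mult_left_mono) auto
      finally show ?thesis by (simp add: clip_def abs_le_iff)
    qed
    ultimately show ?thesis by (simp add: h(1)[OF NR] \<phi>_def B_def scaleR_left_diff_distrib)
  qed
  have hx0: "h x0 = 0" using h(2) far by blast
  have "(cM * \<Lambda> * CN)-lipschitz_on UNIV h"
  proof (rule lipschitz_onI)
    fix z z'
    have "norm (h z - h z') \<le> cM * M (h z - h z')" by (rule cM)
    also have "\<dots> \<le> cM * (\<Lambda> * N (z - z'))" using h(3) cM by (intro mult_left_mono) auto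
    also have "\<dots> \<le> cM * (\<Lambda> * (CN * norm (z - z')))" using CN(2) \<Lambda> cM by (intro mult_left_mono) auto
    finally show "dist (h z) (h z') \<le> cM * \<Lambda> * CN * dist z z'" by (simp add: dist_norm mult_ac)
  qed (use cM \<Lambda> CN in simp)
  then have "h \<in> F_Lip x0" unfolding F_Lip_def lipschitz_around_def using hx0 by blast
  moreover have "lip N M h x0 \<le> ereal \<Lambda>" by (rule lip_leI[OF zero_less_one N]) (rule h(3))
  moreover have "\<not> metrically_subregular N M (\<lambda>x. (\<lambda>y. y + h x) ` F x) x0 y0"
  proof (rule perturbation_not_subregular[where B = B and E = E and t = t and a = a and b = b and e = e and r = r])
    show "y0 + t k *\<^sub>R b k - (E k * r k) *\<^sub>R e + B (x - (x0 + t k *\<^sub>R a k)) \<notin> F x"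
      if "norm (x - (x0 + t k *\<^sub>R a k)) \<le> r k" for k x
      by (rule q(7)[OF r(1,2) that])
    show "h x = - (t k *\<^sub>R b k) + (E k * r k) *\<^sub>R e - B (x - (x0 + t k *\<^sub>R a k))"
      if "norm (x - (x0 + t k *\<^sub>R a k)) \<le> r k" for k x
      using hk[of x k] that by (simp add: X_def)
    show "B 0 = 0" by (simp add: B_def)
  qed (use N M Xlim Elim r(1) q(5) in auto)
  ultimately show ?thesis unfolding \<Lambda>_def K_def K0_def by blast
qed

section \<open>The radius theorem\<close>

lemma lipschitz_around_balls:
  fixes h :: "real ^ 'n \<Rightarrow> real ^ 'm"
  assumes "lipschitz_around h x0" and r1: "0 < r1"
  obtains r L where "0 < r" "r \<le> r1" "L-lipschitz_on (cball x0 r) h"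
proof -
  obtain L U where LU: "open U" "x0 \<in> U" "L-lipschitz_on U h" using assms(1) unfolding lipschitz_around_def by blast
  obtain s where s: "0 < s" "cball x0 s \<subseteq> U" using LU open_contains_cball by blast
  show thesis
  proof (rule that[of "min s r1" L])
    have "cball x0 (min s r1) \<subseteq> U" using s(2) by auto
    then show "L-lipschitz_on (cball x0 (min s r1)) h" using LU(3) lipschitz_on_subset by blast
  qed (use s r1 in auto)
qed

lemma rad_SR_antimono: "P \<subseteq> P' \<Longrightarrow> rad_SR P' N M F x0 y0 \<le> rad_SR P N M F x0 y0"
  unfolding rad_SR_def by (rule Inf_superset_mono) blast

theorem theorem8:
  fixes N :: "real ^ 'n \<Rightarrow> real" and M :: "real ^ 'm \<Rightarrow> real"
    and F :: "real ^ 'n \<Rightarrow> (real ^ 'm) set"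
    and x0 :: "real ^ 'n" and y0 :: "real ^ 'm"
  assumes "is_norm N" and "is_norm M"
    and "closed (gph F)" and "(x0, y0) \<in> gph F"
  shows "rg N M F x0 y0 \<le> rad_SR (F_Lip x0) N M F x0 y0 \<and>
    rad_SR (F_Lip x0) N M F x0 y0 \<le> rg_bar N M F x0 y0 \<and>
    rad_SR (F_ss x0) N M F x0 y0 = rad_SR (F_C1 x0) N M F x0 y0 \<and>
    rad_SR (F_C1 x0) N M F x0 y0 = rg_circ N M F x0 y0"
proof -
  interpret M: vnorm M by standard fact
  \<comment> \<open>A bound for every \<open>K\<close> above the modulus of \<open>h\<close> is a bound for the modulus, which may also be infinite.\<close>
  have below_rad: "c \<le> rad_SR P N M F x0 y0"
    if P: "\<And>h. h \<in> P \<Longrightarrow> h x0 = 0 \<and> lipschitz_around h x0"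
      and c: "\<And>h r L K. \<lbrakk>h \<in> P; h x0 = 0; 0 < r; L-lipschitz_on (cball x0 r) h; 0 \<le> K;
          \<not> metrically_subregular N M (\<lambda>x. (\<lambda>y. y + h x) ` F x) x0 y0;
          \<And>x x'. \<lbrakk>x \<in> ball x0 r; x' \<in> ball x0 r\<rbrakk> \<Longrightarrow> M (h x - h x') \<le> K * N (x - x')\<rbrakk> \<Longrightarrow> c \<le> ereal K"
    for c P
    unfolding rad_SR_def
  proof (rule Inf_greatest, clarify)
    fix h :: "real ^ 'n \<Rightarrow> real ^ 'm"
    assume h: "h \<in> P" and nsr: "\<not> metrically_subregular N M (\<lambda>x. (\<lambda>y. y + h x) ` F x) x0 y0"
    show "c \<le> lip N M h x0"
    proof (rule dense_ge)
      fix z assume less: "lip N M h x0 < z"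
      show "c \<le> z"
      proof (cases z)
        case (real K)
        obtain r1 where r1: "0 < r1" "0 \<le> K"
          "\<And>x x'. \<lbrakk>x \<in> ball x0 r1; x' \<in> ball x0 r1\<rbrakk> \<Longrightarrow> M (h x - h x') \<le> K * N (x - x')"
          using lip_lessD[OF assms(1,2) less[unfolded real]] by metis
        obtain r L where r: "0 < r" "r \<le> r1" "L-lipschitz_on (cball x0 r) h"
          using lipschitz_around_balls[OF _ r1(1)] P[OF h] by metis
        show ?thesis unfolding real
          by (rule c[OF h _ r(1,3) r1(2) nsr]) (use P[OF h] r(2) in \<open>auto intro!: r1(3)\<close>)
      qed (use less in auto)
    qed
  qed
  have lower: "rg N M F x0 y0 \<le> rad_SR (F_Lip x0) N M F x0 y0"
    by (rule below_rad) (auto simp: F_Lip_def intro: rg_le_of_nonsubregular[OF assms])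
  have lower_ss: "rg_circ N M F x0 y0 \<le> rad_SR (F_ss x0) N M F x0 y0"
  proof (rule below_rad)
    fix h r L K
    assume h: "h \<in> F_ss x0" "h x0 = 0" "0 < r" "L-lipschitz_on (cball x0 r) h" "0 \<le> K"
      and nsr: "\<not> metrically_subregular N M (\<lambda>x. (\<lambda>y. y + h x) ` F x) x0 y0"
      and hK: "\<And>x x'. \<lbrakk>x \<in> ball x0 r; x' \<in> ball x0 r\<rbrakk> \<Longrightarrow> M (h x - h x') \<le> K * N (x - x')"
    have ss: "\<exists>l. \<forall>\<epsilon>>0. \<forall>\<^sub>F (u', t) in nhds u \<times>\<^sub>F at_right (0::real).
        \<forall>V\<in>clarke_jacobian h (x0 + t *\<^sub>R u'). dist (V *v u') l < \<epsilon>" for u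
      using h(1) unfolding F_ss_def semismooth_def by blast
    show "rg_circ N M F x0 y0 \<le> ereal K"
      by (rule rg_circ_le_of_nonsubregular[OF assms h(3,4,2) nsr h(5) hK ss])
  qed (auto simp: F_ss_def semismooth_def)
  have upper: "rad_SR (F_Lip x0) N M F x0 y0 \<le> rg_bar N M F x0 y0"
    unfolding rg_bar_def
  proof (rule Inf_greatest, clarify)
    fix u' v u v'
    assume pdd: "(u', v) \<in> primal_dual_derivative F x0 y0 u v'" and u: "N u = 1" and v': "dual_norm M v' = 1"
    show "rad_SR (F_Lip x0) N M F x0 y0 \<le> ereal (dual_norm N u' + M v)"
    proof (rule ereal_le_epsilon2)
      fix \<epsilon> :: real assume \<epsilon>: "0 < \<epsilon>"
      \<comment> \<open>The excess of \<open>(1 + \<eta>) * (M v + \<eta>) + \<eta>\<close> over \<open>M v\<close> is at most \<open>\<eta> * (M v + 3)\<close> for \<open>\<eta> \<le> 1\<close>.\<close>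
      define \<eta> where "\<eta> = min 1 (\<epsilon> / (M v + 3))"
      have d: "0 < M v + 3" using M.nonneg[of v] by linarith
      have \<eta>: "0 < \<eta>" "\<eta> \<le> 1" using \<epsilon> d by (auto simp: \<eta>_def)
      have "\<eta> \<le> \<epsilon> / (M v + 3)" unfolding \<eta>_def by (rule min.cobounded2)
      then have \<eta>\<epsilon>: "\<eta> * (M v + 3) \<le> \<epsilon>" using d by (simp add: le_divide_eq)
      obtain h where h: "h \<in> F_Lip x0" "\<not> metrically_subregular N M (\<lambda>x. (\<lambda>y. y + h x) ` F x) x0 y0"
        "lip N M h x0 \<le> ereal ((1 + \<eta>) * (M v + \<eta>) + (dual_norm N u' + \<eta>))"
        using Lipschitz_destabilizing_perturbation[OF assms(1,2) pdd u v' \<eta>] by blast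
      have "rad_SR (F_Lip x0) N M F x0 y0 \<le> lip N M h x0"
        unfolding rad_SR_def by (rule Inf_lower) (use h in blast)
      also have "\<dots> \<le> ereal ((1 + \<eta>) * (M v + \<eta>) + (dual_norm N u' + \<eta>))" by (rule h(3))
      also have "(1 + \<eta>) * (M v + \<eta>) + (dual_norm N u' + \<eta>) \<le> dual_norm N u' + M v + \<epsilon>"
      proof -
        have "\<eta> * \<eta> \<le> \<eta> * 1" using \<eta> by (intro mult_left_mono) auto
        then show ?thesis using \<eta>\<epsilon> by (simp add: algebra_simps)
      qed
      finally show "rad_SR (F_Lip x0) N M F x0 y0 \<le> ereal (dual_norm N u' + M v) + ereal \<epsilon>" by simp
    qed
  qed
  have upper_C1: "rad_SR (F_C1 x0) N M F x0 y0 \<le> rg_circ N M F x0 y0"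
    unfolding rg_circ_def
  proof (rule Inf_greatest, clarify)
    fix B :: "real ^ 'n ^ 'm" and u v'
    assume pdd: "(transpose B *v v', B *v u) \<in> primal_dual_derivative F x0 y0 u v'"
      and u: "N u = 1" and v': "dual_norm M v' = 1"
    obtain h where h: "h \<in> F_C1 x0" "\<not> metrically_subregular N M (\<lambda>x. (\<lambda>y. y + h x) ` F x) x0 y0"
      "lip N M h x0 \<le> ereal (op_norm N M B)"
      using C1_destabilizing_perturbation[OF assms(1,2) pdd u v'] by blast
    have "rad_SR (F_C1 x0) N M F x0 y0 \<le> lip N M h x0"
      unfolding rad_SR_def by (rule Inf_lower) (use h in blast)
    then show "rad_SR (F_C1 x0) N M F x0 y0 \<le> ereal (op_norm N M B)" using h(3) by (rule order_trans)
  qed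
  have "rad_SR (F_ss x0) N M F x0 y0 \<le> rad_SR (F_C1 x0) N M F x0 y0"
    by (rule rad_SR_antimono) (auto simp: F_ss_def F_C1_def C1_around_imp_semismooth)
  then show ?thesis using lower lower_ss upper upper_C1 by auto
qed

end
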